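(* There is an algorithm that, given two nontrivial elements $u, v$ of the free group $F_2$, determines whether or not $u$ and $v$ are boundedly translation equivalent in $F_2$.
   Context: $F_2$ is the free group with basis $\{a,b\}$, with elements given as words in $a^{\pm1},b^{\pm1}$. For $w\in F_2$, $\|w\|$ denotes the cyclic length of $w$, i.e. the length of a cyclically reduced word conjugate to $w$. Two nontrivial elements $u,v\in F_2$ are boundedly translation equivalent in $F_2$ if there is $C>0$ such that $\frac1C\le\frac{\|\phi(u)\|}{\|\phi(v)\|}\le C$ for every automorphism $\phi$ of $F_2$. *)

theory Defs
  imports Complex_Main "HOL-Algebra.Bij" "HOL-Library.Nat_Bijection"
begin

section \<open>The free group of rank two\<close>

datatype basis = Gen_a | Gen_b

text \<open>The letter \<open>(x, True)\<close> stands for \<open>x\<close>, the letter \<open>(x, False)\<close> for \<open>x\<^sup>-\<^sup>1\<close>.\<close>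

type_synonym letter = "basis \<times> bool"
type_synonym word = "letter list"

definition letter_inv :: "letter \<Rightarrow> letter" where
  "letter_inv l = (fst l, \<not> snd l)"

fun reduced :: "word \<Rightarrow> bool" where
  "reduced (x # y # w) \<longleftrightarrow> y \<noteq> letter_inv x \<and> reduced (y # w)"
| "reduced _ \<longleftrightarrow> True"

fun red_cons :: "letter \<Rightarrow> word \<Rightarrow> word" where
  "red_cons x [] = [x]"
| "red_cons x (y # w) = (if y = letter_inv x then w else x # y # w)"

definition reduce :: "word \<Rightarrow> word" where
  "reduce w = foldr red_cons w []"

text \<open>Elements of the free group are reduced words; an arbitrary word \<open>w\<close> represents the
  element \<open>reduce w\<close>.\<close>

definition F2 :: "word monoid" where
  "F2 = \<lparr>carrier = {w. reduced w}, mult = (\<lambda>u v. reduce (u @ v)), one = []\<rparr>"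

lemma letter_inv_inv [simp]: "letter_inv (letter_inv x) = x"
  by (simp add: letter_inv_def)

lemma letter_inv_neq [simp]: "letter_inv x \<noteq> x" "x \<noteq> letter_inv x"
  by (cases x; simp add: letter_inv_def)+

lemma reduced_Cons: "reduced (x # w) \<longleftrightarrow> (w = [] \<or> hd w \<noteq> letter_inv x) \<and> reduced w"
  by (cases w) auto

lemma reduced_append:
  "reduced (u @ v) \<longleftrightarrow>
     reduced u \<and> reduced v \<and> (u = [] \<or> v = [] \<or> hd v \<noteq> letter_inv (last u))"
  by (induction u) (auto simp: reduced_Cons hd_append)

lemma reduced_red_cons: "reduced w \<Longrightarrow> reduced (red_cons x w)"
  by (cases w) (auto simp: reduced_Cons)

lemma reduced_foldr: "reduced w \<Longrightarrow> reduced (foldr red_cons u w)"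
  by (induction u) (auto simp: reduced_red_cons)

lemma reduced_reduce [simp]: "reduced (reduce w)"
  by (simp add: reduce_def reduced_foldr)

lemma reduce_reduced [simp]: "reduced w \<Longrightarrow> reduce w = w"
proof (induction w)
  case (Cons x w)
  then show ?case by (cases w) (auto simp: reduce_def reduced_Cons)
qed (simp add: reduce_def)

lemma red_cons_cancel: "reduced w \<Longrightarrow> red_cons x (red_cons (letter_inv x) w) = w"
proof (cases w)
  case (Cons y v)
  assume "reduced w"
  with Cons show ?thesis by (cases v) auto
qed simp

lemma foldr_red_cons:
  assumes "reduced r"
  shows "foldr red_cons (red_cons x u) r = red_cons x (foldr red_cons u r)"
proof (cases u)
  case (Cons y v)
  then show ?thesis
    using red_cons_cancel[OF reduced_foldr[OF assms], of x v] by auto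
qed simp

lemma foldr_reduce: "reduced r \<Longrightarrow> foldr red_cons (reduce u) r = foldr red_cons u r"
  by (induction u) (simp_all add: reduce_def foldr_red_cons)

lemma reduce_append: "reduce (u @ v) = foldr red_cons u (reduce v)"
  by (simp add: reduce_def)

lemma reduce_append_right [simp]: "reduce (u @ reduce v) = reduce (u @ v)"
  by (simp add: reduce_append)

lemma reduce_append_left [simp]: "reduce (reduce u @ v) = reduce (u @ v)"
  by (simp add: reduce_append foldr_reduce)

lemma reduce_word_inverse: "reduce (rev (map letter_inv w) @ w) = []"
proof (induction w)
  case (Cons x w)
  have "foldr red_cons (rev (map letter_inv w)) (red_cons (letter_inv x) (red_cons x (reduce w)))
      = foldr red_cons (rev (map letter_inv w)) (reduce w)"
    using red_cons_cancel[of "reduce w" "letter_inv x"] by simp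
  also have "\<dots> = []" using Cons by (simp add: reduce_append)
  finally show ?case by (simp add: reduce_def)
qed (simp add: reduce_def)

lemma group_F2: "group F2"
proof (rule groupI)
  fix x assume "x \<in> carrier F2"
  show "\<exists>y\<in>carrier F2. y \<otimes>\<^bsub>F2\<^esub> x = \<one>\<^bsub>F2\<^esub>"
    by (rule bexI[of _ "reduce (rev (map letter_inv x))"])
      (auto simp: F2_def reduce_word_inverse)
next
  fix x y z
  show "x \<otimes>\<^bsub>F2\<^esub> y \<otimes>\<^bsub>F2\<^esub> z = x \<otimes>\<^bsub>F2\<^esub> (y \<otimes>\<^bsub>F2\<^esub> z)"
    by (simp add: F2_def)
qed (auto simp: F2_def)


section \<open>Cyclic length and bounded translation equivalence\<close>

definition cyc_reduced :: "word \<Rightarrow> bool" where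
  "cyc_reduced w \<longleftrightarrow> reduced w \<and> (w = [] \<or> hd w \<noteq> letter_inv (last w))"

definition conjugate_F2 :: "word \<Rightarrow> word \<Rightarrow> bool" where
  "conjugate_F2 w c \<longleftrightarrow> (\<exists>g\<in>carrier F2. c = g \<otimes>\<^bsub>F2\<^esub> w \<otimes>\<^bsub>F2\<^esub> inv\<^bsub>F2\<^esub> g)"

definition cyc_length :: "word \<Rightarrow> nat" where
  "cyc_length w = (THE n. \<exists>c. cyc_reduced c \<and> conjugate_F2 w c \<and> n = length c)"

definition bdd_trans_equiv :: "word \<Rightarrow> word \<Rightarrow> bool" where
  "bdd_trans_equiv u v \<longleftrightarrow>
     (\<exists>C::real. C > 0 \<and>
        (\<forall>\<phi>\<in>auto F2.
           1 / C \<le> real (cyc_length (\<phi> u)) / real (cyc_length (\<phi> v)) \<and>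
           real (cyc_length (\<phi> u)) / real (cyc_length (\<phi> v)) \<le> C))"

lemma conjugate_F2_trans:
  assumes "u \<in> carrier F2" "conjugate_F2 u v" "conjugate_F2 v w"
  shows "conjugate_F2 u w"
proof -
  interpret group F2 by (rule group_F2)
  from assms obtain g h where gh: "g \<in> carrier F2" "h \<in> carrier F2"
    "v = g \<otimes>\<^bsub>F2\<^esub> u \<otimes>\<^bsub>F2\<^esub> inv\<^bsub>F2\<^esub> g" "w = h \<otimes>\<^bsub>F2\<^esub> v \<otimes>\<^bsub>F2\<^esub> inv\<^bsub>F2\<^esub> h"
    by (auto simp: conjugate_F2_def)
  then have "w = (h \<otimes>\<^bsub>F2\<^esub> g) \<otimes>\<^bsub>F2\<^esub> u \<otimes>\<^bsub>F2\<^esub> inv\<^bsub>F2\<^esub> (h \<otimes>\<^bsub>F2\<^esub> g)"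
    using assms(1) by (simp add: m_assoc inv_mult_group)
  moreover have "h \<otimes>\<^bsub>F2\<^esub> g \<in> carrier F2" using gh by simp
  ultimately show ?thesis unfolding conjugate_F2_def by (rule rev_bexI[rotated])
qed

lemma conjugate_F2_sym:
  assumes "u \<in> carrier F2" "conjugate_F2 u v"
  shows "conjugate_F2 v u"
proof -
  interpret group F2 by (rule group_F2)
  from assms obtain g where g: "g \<in> carrier F2" "v = g \<otimes>\<^bsub>F2\<^esub> u \<otimes>\<^bsub>F2\<^esub> inv\<^bsub>F2\<^esub> g"
    by (auto simp: conjugate_F2_def)
  have "inv\<^bsub>F2\<^esub> g \<otimes>\<^bsub>F2\<^esub> (g \<otimes>\<^bsub>F2\<^esub> u) = u"
    using g(1) assms(1) by (subst m_assoc[symmetric]) auto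
  then have "u = inv\<^bsub>F2\<^esub> g \<otimes>\<^bsub>F2\<^esub> v \<otimes>\<^bsub>F2\<^esub> inv\<^bsub>F2\<^esub> (inv\<^bsub>F2\<^esub> g)"
    using g assms(1) by (simp add: m_assoc)
  moreover have "inv\<^bsub>F2\<^esub> g \<in> carrier F2" using g by simp
  ultimately show ?thesis unfolding conjugate_F2_def by (rule rev_bexI[rotated])
qed

lemma conjugate_F2_carrier:
  assumes "u \<in> carrier F2" "conjugate_F2 u v"
  shows "v \<in> carrier F2"
proof -
  interpret group F2 by (rule group_F2)
  from assms show ?thesis by (auto simp: conjugate_F2_def)
qed

lemma ex_cyc_reduced_conjugate:
  "reduced w \<Longrightarrow> \<exists>c. cyc_reduced c \<and> conjugate_F2 w c"
proof (induction "length w" arbitrary: w rule: less_induct)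
  case less
  interpret group F2 by (rule group_F2)
  have w: "w \<in> carrier F2" using less.prems by (simp add: F2_def)
  show ?case
  proof (cases "cyc_reduced w")
    case True
    have "conjugate_F2 w w"
      unfolding conjugate_F2_def using w by (intro bexI[of _ "\<one>\<^bsub>F2\<^esub>"]) auto
    with True show ?thesis by blast
  next
    case False
    then have ne: "w \<noteq> []" and hl: "hd w = letter_inv (last w)"
      using less.prems by (auto simp: cyc_reduced_def)
    obtain x v where xv: "w = x # v" using ne by (cases w) auto
    have "v \<noteq> []" using hl xv by auto
    then obtain m y where my: "v = m @ [y]" by (cases v rule: rev_cases) auto
    have xy: "x = letter_inv y" using hl xv my by simp
    have m: "reduced m" using less.prems xv my by (auto simp: reduced_append reduced_Cons)
    obtain c where c: "cyc_reduced c" "conjugate_F2 m c"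
      using less.hyps[of m] m xv my by auto
    have "inv\<^bsub>F2\<^esub> [x] = [y]"
      by (rule inv_equality) (auto simp: F2_def xy reduce_def)
    moreover have "w = [x] \<otimes>\<^bsub>F2\<^esub> m \<otimes>\<^bsub>F2\<^esub> [y]"
      using less.prems xv my by (simp add: F2_def)
    moreover have "[x] \<in> carrier F2" by (simp add: F2_def)
    ultimately have "conjugate_F2 m w" unfolding conjugate_F2_def by metis
    then have "conjugate_F2 w m" using m conjugate_F2_sym by (auto simp: F2_def)
    with c show ?thesis using conjugate_F2_trans w by blast
  qed
qed

lemma length_red_cons_le: "length (red_cons x w) \<le> Suc (length w)"
  by (cases w) auto

lemma length_reduce_le: "length (reduce w) \<le> length w"
proof (induction w)
  case (Cons x w)
  then show ?case using length_red_cons_le[of x "reduce w"] by (simp add: reduce_def)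
qed (simp add: reduce_def)

lemma length_mult_F2_le: "length (u \<otimes>\<^bsub>F2\<^esub> v) \<le> length u + length v"
  using length_reduce_le[of "u @ v"] by (simp add: F2_def)

lemma cyc_reduced_power:
  assumes "cyc_reduced c"
  shows "length (c [^]\<^bsub>F2\<^esub> (n::nat)) = n * length c"
proof -
  have "c [^]\<^bsub>F2\<^esub> n = concat (replicate n c)
    \<and> reduced (concat (replicate n c))
    \<and> (n > 0 \<longrightarrow> c \<noteq> [] \<longrightarrow> concat (replicate n c) \<noteq> [] \<and> last (concat (replicate n c)) = last c)"
  proof (induction n)
    case 0
    show ?case by (simp add: F2_def nat_pow_def)
  next
    case (Suc n)
    interpret group F2 by (rule group_F2)
    have comm: "c @ concat (replicate n c) = concat (replicate n c) @ c" for n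
      by (induction n) auto
    have red: "reduced (concat (replicate n c) @ c)"
      using Suc assms by (cases "n = 0") (auto simp: reduced_append cyc_reduced_def)
    have "c [^]\<^bsub>F2\<^esub> Suc n = reduce (concat (replicate n c) @ c)"
      using Suc by (simp add: F2_def)
    with red show ?case by (simp add: comm)
  qed
  then have "c [^]\<^bsub>F2\<^esub> n = concat (replicate n c)" by blast
  then show ?thesis by (simp add: length_concat sum_list_replicate)
qed

lemma conjugate_power:
  assumes "group G" "g \<in> carrier G" "w \<in> carrier G"
  shows "(g \<otimes>\<^bsub>G\<^esub> w \<otimes>\<^bsub>G\<^esub> inv\<^bsub>G\<^esub> g) [^]\<^bsub>G\<^esub> (n::nat) = g \<otimes>\<^bsub>G\<^esub> w [^]\<^bsub>G\<^esub> n \<otimes>\<^bsub>G\<^esub> inv\<^bsub>G\<^esub> g"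
proof -
  interpret group G by fact
  show ?thesis
  proof (induction n)
    case (Suc n)
    have "inv\<^bsub>G\<^esub> g \<otimes>\<^bsub>G\<^esub> (g \<otimes>\<^bsub>G\<^esub> (w \<otimes>\<^bsub>G\<^esub> inv\<^bsub>G\<^esub> g)) = w \<otimes>\<^bsub>G\<^esub> inv\<^bsub>G\<^esub> g"
      using assms by (subst m_assoc[symmetric]) auto
    then show ?case using assms Suc by (simp add: m_assoc)
  qed (use assms in simp)
qed

lemma cyc_reduced_conjugate_length_le:
  assumes "cyc_reduced c" "cyc_reduced d" "conjugate_F2 c d"
  shows "length d \<le> length c"
proof (rule ccontr)
  assume "\<not> ?thesis"
  then have lt: "Suc (length c) \<le> length d" by simp
  have cc: "c \<in> carrier F2" using assms by (simp add: F2_def cyc_reduced_def)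
  obtain g where g: "g \<in> carrier F2" "d = g \<otimes>\<^bsub>F2\<^esub> c \<otimes>\<^bsub>F2\<^esub> inv\<^bsub>F2\<^esub> g"
    using assms by (auto simp: conjugate_F2_def)
  define K where "K = length g + length (inv\<^bsub>F2\<^esub> g)"
  define n where "n = Suc K"
  have "n * length d = length (d [^]\<^bsub>F2\<^esub> n)" using cyc_reduced_power assms by simp
  also have "\<dots> = length (g \<otimes>\<^bsub>F2\<^esub> c [^]\<^bsub>F2\<^esub> n \<otimes>\<^bsub>F2\<^esub> inv\<^bsub>F2\<^esub> g)"
    using conjugate_power[OF group_F2 g(1) cc, of n] g(2) by simp
  also have "\<dots> \<le> length (c [^]\<^bsub>F2\<^esub> n) + K"
    using length_mult_F2_le[of "g \<otimes>\<^bsub>F2\<^esub> c [^]\<^bsub>F2\<^esub> n" "inv\<^bsub>F2\<^esub> g"]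
      length_mult_F2_le[of g "c [^]\<^bsub>F2\<^esub> n"] by (simp add: K_def)
  also have "\<dots> = n * length c + K" using cyc_reduced_power assms by simp
  finally have "n * length d \<le> n * length c + K" .
  moreover have "n * Suc (length c) \<le> n * length d" using lt by (rule mult_le_mono2)
  ultimately show False by (simp add: n_def)
qed

lemma cyc_length_eq:
  assumes "w \<in> carrier F2" "cyc_reduced c" "conjugate_F2 w c"
  shows "cyc_length w = length c"
  unfolding cyc_length_def
proof (rule the_equality)
  show "\<exists>c'. cyc_reduced c' \<and> conjugate_F2 w c' \<and> length c = length c'"
    using assms by blast
next
  fix n assume "\<exists>c'. cyc_reduced c' \<and> conjugate_F2 w c' \<and> n = length c'"
  then obtain d where d: "cyc_reduced d" "conjugate_F2 w d" "n = length d" by blast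
  have car: "c \<in> carrier F2" "d \<in> carrier F2"
    using assms d conjugate_F2_carrier by blast+
  have "conjugate_F2 c d" "conjugate_F2 d c"
    using assms d car conjugate_F2_sym conjugate_F2_trans by blast+
  then show "n = length c"
    using cyc_reduced_conjugate_length_le assms d by (metis le_antisym)
qed


section \<open>Partial recursive functions\<close>

datatype recf =
    Zero
  | Succ
  | Proj nat
  | Comp recf "recf list"
  | Prim_Rec recf recf
  | Mu recf

text \<open>\<open>rec_eval f xs y\<close>: the computation of \<open>f\<close> on the argument list \<open>xs\<close> halts with result \<open>y\<close>.\<close>

inductive rec_eval :: "recf \<Rightarrow> nat list \<Rightarrow> nat \<Rightarrow> bool" where
  Zero: "rec_eval Zero xs 0"
| Succ: "rec_eval Succ [x] (Suc x)"
| Proj: "i < length xs \<Longrightarrow> rec_eval (Proj i) xs (xs ! i)"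
| Comp: "list_all2 (\<lambda>g y. rec_eval g xs y) gs ys \<Longrightarrow> rec_eval f ys z
    \<Longrightarrow> rec_eval (Comp f gs) xs z"
| Prim_Rec_0: "rec_eval f xs y \<Longrightarrow> rec_eval (Prim_Rec f g) (0 # xs) y"
| Prim_Rec_Suc: "rec_eval (Prim_Rec f g) (n # xs) y \<Longrightarrow> rec_eval g (n # y # xs) z
    \<Longrightarrow> rec_eval (Prim_Rec f g) (Suc n # xs) z"
| Mu: "rec_eval f (n # xs) 0 \<Longrightarrow> \<forall>m<n. \<exists>k. rec_eval f (m # xs) (Suc k)
    \<Longrightarrow> rec_eval (Mu f) xs n"

lemma rec_eval_deterministic: "rec_eval f xs y \<Longrightarrow> rec_eval f xs z \<Longrightarrow> y = z"
proof (induction arbitrary: z rule: rec_eval.induct)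
  case (Comp xs gs ys f z')
  from Comp.prems obtain ys' where
    ys': "list_all2 (\<lambda>g y. rec_eval g xs y) gs ys'" "rec_eval f ys' z"
    by (cases rule: rec_eval.cases) auto
  have "ys = ys'"
    using Comp.IH(1) ys'(1) by (auto simp: list_all2_conv_all_nth intro!: nth_equalityI)
  then show ?case using Comp.IH(2) ys'(2) by blast
next
  case (Prim_Rec_Suc f g n xs y w)
  from Prim_Rec_Suc.prems obtain y' where
    "rec_eval (Prim_Rec f g) (n # xs) y'" "rec_eval g (n # y' # xs) z"
    by (cases rule: rec_eval.cases) auto
  then show ?case using Prim_Rec_Suc.IH by blast
next
  case (Mu f n xs)
  from Mu.prems have z: "rec_eval f (z # xs) 0" "\<forall>m<z. \<exists>k. rec_eval f (m # xs) (Suc k)"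
    by (cases rule: rec_eval.cases; auto)+
  show ?case
  proof (cases n z rule: linorder_cases)
    case less
    then show ?thesis using z(2) Mu.IH(1) by fastforce
  next
    case greater
    then show ?thesis using z(1) Mu.IH(2) by fastforce
  qed
next
  case (Prim_Rec_0 f xs y g)
  from Prim_Rec_0.prems have "rec_eval f xs z"
    by (cases rule: rec_eval.cases) auto
  then show ?case by (rule Prim_Rec_0.IH)
next
  case (Zero xs)
  then show ?case by (cases rule: rec_eval.cases) auto
next
  case (Succ x)
  then show ?case by (cases rule: rec_eval.cases) auto
next
  case (Proj i xs)
  from Proj.prems show ?case by (cases rule: rec_eval.cases) auto
qed


section \<open>Coding of words\<close>

fun letter_code :: "letter \<Rightarrow> nat" where
  "letter_code (Gen_a, True) = 0"
| "letter_code (Gen_a, False) = 1"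
| "letter_code (Gen_b, True) = 2"
| "letter_code (Gen_b, False) = 3"

definition word_code :: "word \<Rightarrow> nat" where
  "word_code w = list_encode (map letter_code w)"

end

theory Submission
  imports Defs
begin


text \<open>Let \<open>sig\<close> be the twist \<open>a \<mapsto> ab\<close>, \<open>tau\<close> the twist \<open>b \<mapsto> ba\<close> and \<open>iota\<close> the inversion of \<open>b\<close>. By Nielsen
  reduction every automorphism is, up to conjugation and signed permutations of the basis (which
  preserve cyclic length), a positive product of \<open>sig\<close> and \<open>tau\<close>, possibly preceded by \<open>iota\<close>.

  Call \<open>w\<close> elliptic if \<open>sig w\<close> is conjugate to \<open>w\<close>; otherwise the length of \<open>sig\<^sup>n w\<close> tends to infinity
  with \<open>n\<close>. Hence boundedly translation equivalent \<open>u\<close>, \<open>v\<close> are made elliptic by the same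
  automorphisms. Conversely, let every automorphism that makes \<open>v\<close> elliptic make \<open>u\<close> elliptic. The length
  of \<open>u\<close> under a positive product \<open>m\<close> is at most a constant times the length of \<open>m a\<close> plus that of \<open>m b\<close>,
  and if \<open>u\<close> is elliptic the second length suffices. Matching lower bounds for \<open>v\<close> come from a potential,
  the number of letters that twists may still cancel. While both twists meet such letters, either one
  decreases the potential. If only \<open>tau\<close> meets some, then \<open>tau \<circ> sig\<^sup>n\<close> removes all of them, for every
  \<open>n > 0\<close>. Without such letters the lengths obey a linear recursion with positive coefficients.

  The criterion is decidable since \<open>v\<close> can be made elliptic only by automorphisms \<open>m\<close> for which
  \<open>m\<^sup>-\<^sup>1 b\<close> is not longer than \<open>v\<close>, unless \<open>v\<close> is fixed by both twists up to conjugation.\<close>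

section \<open>Words up to conjugation\<close>

text \<open>On cyclically reduced words ellipticity is combinatorial: the signs of the letters of
  type a alternate around the cycle (\<open>same Gen_a w = 0\<close>). In general
  \<open>same Gen_a\<close> is invariant under \<open>sig\<close>, and it is the rate at which the
  iterates lengthen once \<open>bad Gen_b\<close> is zero. If \<open>bad\<close> vanishes for both
  generators, \<open>same\<close> equals \<open>cnt - turns\<close> for each of them, and these two
  numbers are the coefficients of the linear recursion; if both are positive, the lower bound
  matches the general upper bound.

  The potential is \<open>bad Gen_a + bad Gen_b\<close>. The obstacle is that \<open>sig\<close>
  need not lower it when only \<open>tau\<close> meets such letters: the induction then branches
  over the infinitely many beginnings \<open>tau \<circ> sig^n\<close>, and nothing bounds their
  constants uniformly. The constants are therefore taken from the induction hypothesis only for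
  \<open>n\<close> up to \<open>turns v\<close>; beyond that the recursion gives a lower bound
  proportional to \<open>n - turns v\<close>, which is uniform.

  Ellipticity is itself decidable, since an explicit iterate of \<open>sig\<close> makes
  \<open>w\<close> cyclically longer unless \<open>w\<close> is elliptic. So the algorithm only
  reduces words and compares lengths.\<close>

definition word_inv :: "word \<Rightarrow> word" where
  "word_inv w = rev (map letter_inv w)"

lemma word_inv_simps [simp]:
  "word_inv [] = []" "word_inv (x # w) = word_inv w @ [letter_inv x]"
  "word_inv (u @ v) = word_inv v @ word_inv u" "word_inv (word_inv w) = w"
  "length (word_inv w) = length w" "word_inv w = [] \<longleftrightarrow> w = []"
  by (auto simp: word_inv_def rev_map comp_def)

lemma letter_inv_eq_iff [simp]: "letter_inv x = letter_inv y \<longleftrightarrow> x = y"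
  by (auto simp: letter_inv_def prod_eq_iff)

lemma letter_inv_Pair [simp]: "letter_inv (x, s) = (x, \<not> s)"
  by (simp add: letter_inv_def)

lemma reduce_Nil [simp]: "reduce [] = []"
  by (simp add: reduce_def)

lemma reduce_inv_left [simp]: "reduce (word_inv w @ w) = []"
  by (simp add: reduce_word_inverse word_inv_def)

lemma reduce_inv_right [simp]: "reduce (w @ word_inv w) = []"
  using reduce_inv_left[of "word_inv w"] by simp

lemma reduce_cong_append:
  "reduce u = reduce u' \<Longrightarrow> reduce v = reduce v' \<Longrightarrow> reduce (u @ v) = reduce (u' @ v')"
  by (metis reduce_append_left reduce_append_right)

lemma reduce_cancel_left: "reduce u = [] \<Longrightarrow> reduce (u @ v) = reduce v"
  by (metis append_Nil reduce_Nil reduce_cong_append)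

lemma reduce_cancel_mid: "reduce u = [] \<Longrightarrow> reduce (w @ u @ v) = reduce (w @ v)"
  by (rule reduce_cong_append) (simp_all add: reduce_cancel_left)

lemma reduce_eq_word_inv: "reduce u = reduce v \<Longrightarrow> reduce (word_inv u) = reduce (word_inv v)"
proof -
  assume eq: "reduce u = reduce v"
  have "reduce (word_inv u) = reduce (word_inv u @ (v @ word_inv v))"
    using reduce_cong_append[of "word_inv u" "word_inv u" "[]" "v @ word_inv v"] by simp
  also have "\<dots> = reduce ((word_inv u @ v) @ word_inv v)" by simp
  also have "reduce (word_inv u @ v) = reduce (word_inv u @ u)"
    by (rule reduce_cong_append) (simp_all add: eq)
  hence "reduce ((word_inv u @ v) @ word_inv v) = reduce (word_inv v)"
    by (intro reduce_cancel_left) simp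
  finally show ?thesis .
qed

lemma reduce_append_right2 [simp]: "reduce (u @ v @ reduce w) = reduce (u @ v @ w)"
  using reduce_append_right[of "u @ v" w] by simp

lemma reduced_iff_nth:
  "reduced w \<longleftrightarrow> (\<forall>i. Suc i < length w \<longrightarrow> w ! Suc i \<noteq> letter_inv (w ! i))"
proof (induction w rule: reduced.induct)
  case (1 x y w)
  have all_nat: "(\<forall>i. P i) \<longleftrightarrow> P 0 \<and> (\<forall>i. P (Suc i))" for P
    by (metis not0_implies_Suc)
  show ?case unfolding reduced.simps(1) 1
    by (subst (2) all_nat) simp
qed auto

text \<open>Phrased for arbitrary words and up to \<open>reduce\<close>, so that substitutions and
  concatenations apply without renormalising; on reduced words it is conjugacy in
  \<open>F2\<close>.\<close>

definition word_conj :: "word \<Rightarrow> word \<Rightarrow> bool" where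
  "word_conj u v \<longleftrightarrow> (\<exists>g. reduce v = reduce (g @ u @ word_inv g))"

lemma word_conjI: "reduce v = reduce (g @ u @ word_inv g) \<Longrightarrow> word_conj u v"
  by (auto simp: word_conj_def)

lemma word_conj_reduce_eq: "reduce u = reduce v \<Longrightarrow> word_conj u v"
  by (rule word_conjI[of _ "[]"]) simp

lemma word_conj_refl [simp]: "word_conj u u"
  by (simp add: word_conj_reduce_eq)

lemma word_conj_trans [trans]:
  assumes "word_conj u v" "word_conj v w" shows "word_conj u w"
proof -
  from assms obtain g h where "reduce v = reduce (g @ u @ word_inv g)"
    "reduce w = reduce (h @ v @ word_inv h)" by (auto simp: word_conj_def)
  then have "reduce w = reduce (h @ (g @ u @ word_inv g) @ word_inv h)"
    by (metis reduce_cong_append)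
  then show ?thesis by (intro word_conjI[of _ "h @ g"]) simp
qed

lemma word_conj_sym: assumes "word_conj u v" shows "word_conj v u"
proof -
  from assms obtain g where g: "reduce v = reduce (g @ u @ word_inv g)"
    by (auto simp: word_conj_def)
  have "reduce (word_inv g @ v @ g) = reduce (word_inv g @ (g @ u @ word_inv g) @ g)"
    by (intro reduce_cong_append g refl)
  also have "\<dots> = reduce ((word_inv g @ g) @ (u @ word_inv g @ g))" by simp
  also have "\<dots> = reduce (u @ (word_inv g @ g))" by (rule reduce_cancel_left) simp
  also have "\<dots> = reduce u" using reduce_cong_append[of u u "word_inv g @ g" "[]"] by simp
  finally show ?thesis by (intro word_conjI[of _ "word_inv g"]) simp
qed

lemma word_conj_rotate: "word_conj (u @ v) (v @ u)"
proof (rule word_conjI[of _ v])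
  have "reduce ((v @ u) @ (v @ word_inv v)) = reduce ((v @ u) @ [])"
    by (rule reduce_cong_append) simp_all
  then show "reduce (v @ u) = reduce (v @ (u @ v) @ word_inv v)" by simp
qed

lemma word_conj_rotate': "word_conj w (rotate k w)"
  by (metis append_take_drop_id rotate_drop_take word_conj_rotate)

lemma word_conj_conjugator: "word_conj (g @ u @ word_inv g) u"
  by (intro word_conj_sym[OF word_conjI[of _ g]]) simp

lemma inv_F2: "reduced g \<Longrightarrow> inv\<^bsub>F2\<^esub> g = reduce (word_inv g)"
  by (rule group.inv_equality[OF group_F2]) (auto simp: F2_def)

lemma word_conj_imp_conjugate_F2:
  assumes "word_conj u v" shows "conjugate_F2 (reduce u) (reduce v)"
proof -
  from assms obtain g where g: "reduce v = reduce (g @ u @ word_inv g)"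
    by (auto simp: word_conj_def)
  have "reduce (word_inv (reduce g)) = reduce (word_inv g)" by (rule reduce_eq_word_inv) simp
  then have "reduce v = reduce g \<otimes>\<^bsub>F2\<^esub> reduce u \<otimes>\<^bsub>F2\<^esub> inv\<^bsub>F2\<^esub> (reduce g)"
    unfolding g by (simp add: inv_F2) (simp add: F2_def)
  then show ?thesis unfolding conjugate_F2_def
    by (intro bexI[of _ "reduce g"]) (simp_all add: F2_def)
qed

lemma conjugate_F2_imp_word_conj:
  assumes "reduced u" "conjugate_F2 u v" shows "word_conj u v"
proof -
  from assms obtain g where "reduced g" "v = g \<otimes>\<^bsub>F2\<^esub> u \<otimes>\<^bsub>F2\<^esub> inv\<^bsub>F2\<^esub> g"
    unfolding conjugate_F2_def by (auto simp: F2_def)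
  then have "v = reduce (g @ u @ word_inv g)" by (simp add: inv_F2) (simp add: F2_def)
  then show ?thesis by (auto intro: word_conjI[of _ g])
qed

definition clen :: "word \<Rightarrow> nat" where
  "clen w = cyc_length (reduce w)"

lemma carrier_F2 [simp]: "w \<in> carrier F2 \<longleftrightarrow> reduced w"
  by (simp add: F2_def)

lemma clen_eqI: "cyc_reduced c \<Longrightarrow> word_conj w c \<Longrightarrow> clen w = length c"
  unfolding clen_def
  by (rule cyc_length_eq)
    (use word_conj_imp_conjugate_F2[of w c] in \<open>auto simp: cyc_reduced_def\<close>)

lemma ex_cyc_reduced_word_conj: "\<exists>c. cyc_reduced c \<and> word_conj w c"
proof -
  obtain c where c: "cyc_reduced c" "conjugate_F2 (reduce w) c"
    using ex_cyc_reduced_conjugate[of "reduce w"] by auto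
  then have "word_conj (reduce w) c" by (intro conjugate_F2_imp_word_conj) auto
  moreover have "word_conj w (reduce w)" by (rule word_conj_reduce_eq) simp
  ultimately show ?thesis using c word_conj_trans by blast
qed

lemma clen_cong: "word_conj u v \<Longrightarrow> clen u = clen v"
  by (metis clen_eqI ex_cyc_reduced_word_conj word_conj_sym word_conj_trans)

lemma clen_cyc_reduced: "cyc_reduced c \<Longrightarrow> clen c = length c"
  by (rule clen_eqI) simp_all

lemma cyc_reduced_core:
  "reduced w \<Longrightarrow> \<exists>p c. w = p @ c @ word_inv p \<and> cyc_reduced c"
proof (induction "length w" arbitrary: w rule: less_induct)
  case less
  show ?case
  proof (cases "cyc_reduced w")
    case True
    then show ?thesis by (intro exI[of _ "[]"] exI[of _ w]) simp
  next
    case False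
    then have ne: "w \<noteq> []" and hl: "hd w = letter_inv (last w)"
      using less.prems by (auto simp: cyc_reduced_def)
    obtain x v where xv: "w = x # v" using ne by (cases w) auto
    have "v \<noteq> []" using hl xv by auto
    then obtain m y where my: "v = m @ [y]" by (cases v rule: rev_cases) auto
    have xy: "x = letter_inv y" using hl xv my by simp
    have m: "reduced m" using less.prems xv my by (auto simp: reduced_append reduced_Cons)
    obtain p c where "m = p @ c @ word_inv p" "cyc_reduced c"
      using less.hyps[of m] m xv my by auto
    then show ?thesis by (intro exI[of _ "x # p"] exI[of _ c]) (simp add: xv my xy)
  qed
qed

lemma reduce_core:
  obtains p c where "reduce w = p @ c @ word_inv p" "cyc_reduced c" "clen w = length c"
proof -
  obtain p c where pc: "reduce w = p @ c @ word_inv p" "cyc_reduced c"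
    using cyc_reduced_core[of "reduce w"] by auto
  have "word_conj w c"
    using word_conj_trans[OF word_conj_reduce_eq word_conj_conjugator, of w p c] pc(1)
    by (metis reduce_reduced reduced_reduce)
  then show ?thesis using that[OF pc] clen_eqI[OF pc(2)] by simp
qed

lemma clen_le_length: "clen w \<le> length w"
  using length_reduce_le[of w] by (rule_tac w = w in reduce_core) simp

text \<open>If the reduced word is p c p^-1 with cyclically reduced core c, its square reduces to p
  c c p^-1, which is longer by the length of c. Cyclic length is thus computed by free reduction
  alone, which is how the algorithm obtains it.\<close>

lemma clen_square: "clen w = length (reduce (w @ w)) - length (reduce w)"
proof -
  obtain p c where pc: "reduce w = p @ c @ word_inv p" "cyc_reduced c" and cl: "clen w = length c"
    by (rule reduce_core)
  have red: "reduced (p @ c @ word_inv p)" using pc(1) by (metis reduced_reduce)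
  have "reduce (w @ w) = reduce ((p @ c @ word_inv p) @ (p @ c @ word_inv p))"
    by (rule reduce_cong_append) (simp_all flip: pc(1))
  also have "\<dots> = reduce ((p @ c) @ (word_inv p @ p) @ (c @ word_inv p))" by simp
  also have "\<dots> = reduce ((p @ c) @ (c @ word_inv p))" by (rule reduce_cancel_mid) simp
  finally have eq: "reduce (w @ w) = reduce (p @ c @ c @ word_inv p)" by simp
  show ?thesis
  proof (cases "c = []")
    case True
    then show ?thesis using cl eq pc(1) by simp
  next
    case False
    then have "reduced (p @ c @ c @ word_inv p)"
      using red pc(2) by (simp add: reduced_append cyc_reduced_def)
    then show ?thesis using cl eq pc(1) by simp
  qed
qed

lemma clen_pos: "reduce w \<noteq> [] \<Longrightarrow> clen w > 0"
proof -
  assume ne: "reduce w \<noteq> []"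
  obtain c where c: "cyc_reduced c" "word_conj w c" using ex_cyc_reduced_word_conj by blast
  have "c \<noteq> []"
  proof
    assume "c = []"
    then have "word_conj [] w" using c word_conj_sym by blast
    then show False using ne by (auto simp: word_conj_def)
  qed
  then show ?thesis using clen_eqI[OF c] by simp
qed

section \<open>Substitutions\<close>

definition subst :: "(basis \<Rightarrow> word) \<Rightarrow> word \<Rightarrow> word" where
  "subst s w = concat (map (\<lambda>(x, p). if p then s x else word_inv (s x)) w)"

lemma subst_simps [simp]:
  "subst s [] = []"
  "subst s ((x, True) # w) = s x @ subst s w"
  "subst s ((x, False) # w) = word_inv (s x) @ subst s w"
  "subst s (u @ v) = subst s u @ subst s v"
  by (simp_all add: subst_def)

lemma subst_word_inv: "subst s (word_inv w) = word_inv (subst s w)"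
proof (induction w)
  case (Cons l w)
  obtain x p where l: "l = (x, p)" by (cases l)
  show ?case using Cons unfolding l by (cases p) auto
qed simp

lemma subst_letter_inv: "subst s [letter_inv l] = word_inv (subst s [l])"
  using subst_word_inv[of s "[l]"] by simp

lemma subst_subst: "subst s (subst t w) = subst (\<lambda>x. subst s (t x)) w"
proof (induction w)
  case (Cons l w)
  obtain x p where l: "l = (x, p)" by (cases l)
  show ?case using Cons unfolding l by (cases p) (auto simp: subst_word_inv)
qed simp

lemma subst_Cons: "subst s (l # w) = subst s [l] @ subst s w"
  by (simp add: subst_def)

lemma reduce_subst_reduce: "reduce (subst s (reduce w)) = reduce (subst s w)"
proof (induction w)
  case (Cons l w)
  have rc: "reduce (subst s (red_cons l v)) = reduce (subst s [l] @ subst s v)" for v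
  proof (cases v)
    case (Cons y z)
    show ?thesis
    proof (cases "y = letter_inv l")
      case True
      have "reduce ((subst s [l] @ word_inv (subst s [l])) @ subst s z) = reduce (subst s z)"
        by (rule reduce_cancel_left) simp
      moreover have "subst s (y # z) = word_inv (subst s [l]) @ subst s z"
        unfolding True using subst_Cons[of s "letter_inv l" z] by (simp only: subst_letter_inv)
      ultimately show ?thesis using True by (simp add: Cons)
    qed (simp add: Cons subst_Cons[of s l "y # z"])
  qed simp
  have "reduce (subst s (reduce (l # w))) = reduce (subst s [l] @ subst s (reduce w))"
    using rc[of "reduce w"] by (simp add: reduce_def)
  also have "\<dots> = reduce (subst s [l] @ subst s w)" by (rule reduce_cong_append) (simp_all add: Cons)
  finally show ?case by (simp add: subst_Cons[of s l w])
qed simp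

lemma reduce_subst_cong: "reduce u = reduce v \<Longrightarrow> reduce (subst s u) = reduce (subst s v)"
  by (metis reduce_subst_reduce)

lemma word_conj_subst: "word_conj u v \<Longrightarrow> word_conj (subst s u) (subst s v)"
proof -
  assume "word_conj u v"
  then obtain g where "reduce v = reduce (g @ u @ word_inv g)" by (auto simp: word_conj_def)
  then have "reduce (subst s v) = reduce (subst s (g @ u @ word_inv g))" by (rule reduce_subst_cong)
  then show ?thesis by (intro word_conjI[of _ "subst s g"]) (simp add: subst_word_inv)
qed

text \<open>A common conjugator on the generators passes to all words because the inner factors g^-1
  g cancel. Identities between automorphisms modulo inner ones therefore need checking only on a and
  b.\<close>

lemma reduce_subst_conj:
  assumes "\<And>x. reduce (t x) = reduce (g @ s x @ word_inv g)"
  shows "reduce (subst t w) = reduce (g @ subst s w @ word_inv g)"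
proof (induction w)
  case (Cons l w)
  obtain x p where l: "l = (x, p)" by (cases l)
  have 1: "reduce (subst t [l]) = reduce (g @ subst s [l] @ word_inv g)"
    using assms[of x] reduce_eq_word_inv[OF assms[of x]] by (cases p) (auto simp: l)
  have "reduce (subst t (l # w)) = reduce (subst t [l] @ subst t w)" by (simp add: subst_Cons[of t l w])
  also have "\<dots> = reduce ((g @ subst s [l] @ word_inv g) @ (g @ subst s w @ word_inv g))"
    by (intro reduce_cong_append 1 Cons)
  also have "\<dots> = reduce ((g @ subst s [l]) @ (word_inv g @ g) @ (subst s w @ word_inv g))" by simp
  also have "\<dots> = reduce ((g @ subst s [l]) @ (subst s w @ word_inv g))" by (rule reduce_cancel_mid) simp
  finally show ?case by (simp add: subst_Cons[of s l w])
qed simp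

lemma word_conj_subst_cong:
  assumes "\<And>x. reduce (t x) = reduce (g @ s x @ word_inv g)"
  shows "word_conj (subst s w) (subst t w)"
  using reduce_subst_conj[OF assms] by (intro word_conjI[of _ g]) simp

lemma word_conj_subst_cong_gens:
  assumes "reduce (t Gen_a) = reduce (g @ s Gen_a @ word_inv g)"
    and "reduce (t Gen_b) = reduce (g @ s Gen_b @ word_inv g)"
  shows "word_conj (subst s w) (subst t w)"
  by (rule word_conj_subst_cong[of _ g]) (metis assms basis.exhaust)

lemma reduce_subst_cong_fun:
  assumes "\<And>x. reduce (t x) = reduce (s x)"
  shows "reduce (subst t w) = reduce (subst s w)"
  using reduce_subst_conj[of t "[]" s w] assms by simp

lemma subst_id: "subst (\<lambda>x. [(x, True)]) w = w"
proof (induction w)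
  case (Cons l w)
  obtain x p where l: "l = (x, p)" by (cases l)
  show ?case using Cons unfolding l by (cases p) auto
qed simp

abbreviation "La \<equiv> (Gen_a, True)"
abbreviation "LA \<equiv> (Gen_a, False)"
abbreviation "Lb \<equiv> (Gen_b, True)"
abbreviation "LB \<equiv> (Gen_b, False)"

definition sig :: "word \<Rightarrow> word" where
  "sig = subst (\<lambda>x. case x of Gen_a \<Rightarrow> [La, Lb] | Gen_b \<Rightarrow> [Lb])"

definition flip_basis :: "basis \<Rightarrow> basis" where
  "flip_basis x = (case x of Gen_a \<Rightarrow> Gen_b | Gen_b \<Rightarrow> Gen_a)"

definition swap :: "word \<Rightarrow> word" where
  "swap = map (map_prod flip_basis id)"

definition iota :: "word \<Rightarrow> word" where
  "iota = map (\<lambda>(x, p). (x, p \<noteq> (x = Gen_b)))"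

definition neg :: "word \<Rightarrow> word" where
  "neg = map letter_inv"

definition tau :: "word \<Rightarrow> word" where
  "tau w = swap (sig (swap w))"

lemma flip_basis_simps [simp]: "flip_basis Gen_a = Gen_b" "flip_basis Gen_b = Gen_a"
  "flip_basis (flip_basis x) = x"
  by (auto simp: flip_basis_def split: basis.splits)

lemma flip_basis_eq_iff [simp]: "flip_basis x = flip_basis y \<longleftrightarrow> x = y"
  by (cases x; cases y) auto

lemma swap_swap [simp]: "swap (swap w) = w"
  by (simp add: swap_def comp_def prod.map_comp map_idI split_beta map_prod_def)

lemma iota_iota [simp]: "iota (iota w) = w"
  by (simp add: iota_def) (rule map_idI, auto)

lemma neg_neg [simp]: "neg (neg w) = w"
  by (simp add: neg_def comp_def map_idI)

lemma length_swap [simp]: "length (swap w) = length w"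
  by (simp add: swap_def)

lemma swap_tau [simp]: "swap (tau w) = sig (swap w)" "tau (swap w) = swap (sig w)"
  by (simp_all add: tau_def)

lemma map_eq_subst:
  assumes "\<And>l. f (letter_inv l) = letter_inv (f l)"
  shows "map f w = subst (\<lambda>x. [f (x, True)]) w"
proof (induction w)
  case (Cons l w)
  obtain x p where l: "l = (x, p)" by (cases l)
  show ?case using Cons assms[of "(x, True)"] unfolding l by (cases p) auto
qed simp

lemma swap_subst: "swap = subst (\<lambda>x. [(flip_basis x, True)])"
  unfolding swap_def by (rule ext, subst map_eq_subst) (auto simp: letter_inv_def)

lemma iota_subst: "iota = subst (\<lambda>x. [(x, x \<noteq> Gen_b)])"
  unfolding iota_def
  by (rule ext, subst map_eq_subst) (auto simp: letter_inv_def)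

lemma neg_subst: "neg = subst (\<lambda>x. [(x, False)])"
  unfolding neg_def by (rule ext, subst map_eq_subst) (auto simp: letter_inv_def)

lemma tau_subst: "tau = subst (\<lambda>x. case x of Gen_a \<Rightarrow> [La] | Gen_b \<Rightarrow> [Lb, La])"
  unfolding tau_def swap_subst sig_def subst_subst
  by (rule ext, rule arg_cong[where f="\<lambda>s. subst s _"]) (auto split: basis.splits)

text \<open>An injective renaming that respects inversion neither creates nor destroys cancelling
  pairs, so it preserves cyclically reduced words.\<close>

lemma clen_map:
  assumes "\<And>l. f (letter_inv l) = letter_inv (f l)" "inj f"
  shows "clen (map f w) = clen w"
proof -
  obtain c where c: "cyc_reduced c" "word_conj w c" using ex_cyc_reduced_word_conj by blast
  have "reduced (map f v) = reduced v" for v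
    by (induction v rule: reduced.induct)
      (simp_all flip: assms(1) add: inj_eq[OF assms(2)])
  then have "cyc_reduced (map f c)" using c(1)
    by (cases "c = []") (auto simp: cyc_reduced_def hd_map last_map inj_eq[OF assms(2)] simp flip: assms(1))
  moreover have "word_conj (map f w) (map f c)"
    using word_conj_subst[OF c(2)] by (simp add: map_eq_subst[of f, OF assms(1)])
  ultimately show ?thesis using clen_eqI c by (metis length_map)
qed

lemma clen_swap [simp]: "clen (swap w) = clen w"
  unfolding swap_def by (rule clen_map) (auto simp: letter_inv_def inj_def prod_eq_iff)

lemma clen_iota [simp]: "clen (iota w) = clen w"
  unfolding iota_def by (rule clen_map) (auto simp: letter_inv_def inj_def split: if_splits)

lemma clen_neg [simp]: "clen (neg w) = clen w"
  unfolding neg_def by (rule clen_map) (auto simp: inj_def)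

lemma word_conj_sig: "word_conj u v \<Longrightarrow> word_conj (sig u) (sig v)"
  unfolding sig_def by (rule word_conj_subst)

lemma word_conj_tau: "word_conj u v \<Longrightarrow> word_conj (tau u) (tau v)"
  unfolding tau_subst by (rule word_conj_subst)

lemma word_conj_swap: "word_conj u v \<Longrightarrow> word_conj (swap u) (swap v)"
  unfolding swap_subst by (rule word_conj_subst)

lemma word_conj_iota: "word_conj u v \<Longrightarrow> word_conj (iota u) (iota v)"
  unfolding iota_subst by (rule word_conj_subst)

lemma word_conj_neg: "word_conj u v \<Longrightarrow> word_conj (neg u) (neg v)"
  unfolding neg_subst by (rule word_conj_subst)

lemma sig_iota_sig: "word_conj (sig (iota (sig w))) (iota w)"
  unfolding sig_def iota_subst subst_subst
  by (rule word_conj_subst_cong_gens[of _ "[]"]) (simp_all add: reduce_def)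

lemma swap_iota: "swap (iota w) = neg (iota (swap w))"
  by (auto simp: swap_def iota_def neg_def letter_inv_def flip_basis_def split: basis.splits)

lemma sig_neg: "word_conj (sig (neg w)) (neg (sig w))"
  unfolding sig_def neg_subst subst_subst
  by (rule word_conj_subst_cong_gens[of _ "[Lb]"]) (simp_all add: reduce_def)

lemma tau_iota_tau: "word_conj (tau (iota (tau w))) (iota w)"
  unfolding tau_subst iota_subst subst_subst
  by (rule word_conj_subst_cong_gens[of _ "[La]"]) (simp_all add: reduce_def)

lemma tau_neg: "word_conj (tau (neg w)) (neg (tau w))"
  unfolding tau_subst neg_subst subst_subst
  by (rule word_conj_subst_cong_gens[of _ "[La]"]) (simp_all add: reduce_def)

text \<open>Since \<open>iota\<close> turns \<open>sig\<close> into its inverse, this is a product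
  of a twist with the inverse of the other one. It collapses to a single twist up to symmetries of
  the basis, which is what keeps products positive in \<open>positive_length_sig\<close>.\<close>

lemma tau_iota_sig: "word_conj (tau (iota (sig w))) (neg (sig (swap w)))"
  unfolding tau_subst neg_subst sig_def swap_subst iota_subst subst_subst
  by (rule word_conj_subst_cong_gens[of _ "[]"]) (simp_all add: reduce_def)


section \<open>Sums over the rotations of a cyclic word\<close>

definition rsum :: "('a list \<Rightarrow> int) \<Rightarrow> 'a list \<Rightarrow> int" where
  "rsum G w = (\<Sum>i<length w. G (rotate i w))"

lemma rsum_rotate1: "rsum G (rotate1 w) = rsum G w"
proof (cases "length w")
  case (Suc n)
  have "rsum G (rotate1 w) = (\<Sum>i<Suc n. G (rotate (Suc i) w))"
    by (simp add: rsum_def Suc rotate1_rotate_swap)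
  also have "\<dots> = (\<Sum>i<n. G (rotate (Suc i) w)) + G (rotate (length w) w)"
    using Suc by simp
  also have "\<dots> = G (rotate 0 w) + (\<Sum>i<n. G (rotate (Suc i) w))"
    by simp
  also have "\<dots> = rsum G w"
    unfolding rsum_def Suc by (rule sum.lessThan_Suc_shift[symmetric])
  finally show ?thesis .
qed (simp add: rsum_def)

lemma rsum_rotate [simp]: "rsum G (rotate k w) = rsum G w"
  by (induction k) (simp_all add: rsum_rotate1)

lemma rsum_map: "rsum G (map f w) = rsum (\<lambda>w. G (map f w)) w"
  by (simp add: rsum_def rotate_map)

lemma rsum_add: "rsum (\<lambda>w. F w + G w) w = rsum F w + rsum G w"
  by (simp add: rsum_def sum.distrib)

lemma rsum_one: "rsum (\<lambda>_. 1) w = int (length w)"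
  by (simp add: rsum_def)

lemma rsum_mono: "(\<And>i. i < length w \<Longrightarrow> F (rotate i w) \<le> G (rotate i w)) \<Longrightarrow> rsum F w \<le> rsum G w"
  by (auto simp: rsum_def intro: sum_mono)

lemma rsum_cong: "(\<And>i. i < length w \<Longrightarrow> F (rotate i w) = G (rotate i w)) \<Longrightarrow> rsum F w = rsum G w"
  by (auto simp: rsum_def intro: sum.cong)

lemma rsum_nonneg: "(\<And>v. 0 \<le> G v) \<Longrightarrow> 0 \<le> rsum G w"
  by (auto simp: rsum_def intro: sum_nonneg)

lemma rsum_eq_0D: "rsum G w = 0 \<Longrightarrow> (\<And>v. 0 \<le> G v) \<Longrightarrow> i < length w \<Longrightarrow> G (rotate i w) = 0"
  unfolding rsum_def by (subst (asm) sum_nonneg_eq_0_iff) auto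

lemma rsum_posD: "rsum G w > 0 \<Longrightarrow> \<exists>i<length w. G (rotate i w) > 0"
  unfolding rsum_def by (metis lessThan_iff not_le sum_nonpos)

lemma rsum_strict_mono:
  assumes "\<And>i. i < length w \<Longrightarrow> F (rotate i w) \<le> G (rotate i w)"
    and "j < length w" "F (rotate j w) < G (rotate j w)"
  shows "rsum F w < rsum G w"
  unfolding rsum_def by (rule sum_strict_mono_ex1) (use assms in auto)

lemma rsum_concat_aux:
  fixes G :: "'a list \<Rightarrow> int"
  shows
  "(\<Sum>i<length (concat xss). G (rotate (length (concat yss) + i) (concat (yss @ xss))))
   = (\<Sum>j<length xss. \<Sum>i<length (xss ! j). G (rotate i (concat (rotate (length yss + j) (yss @ xss)))))"
proof (induction xss arbitrary: yss)
  case (Cons x xss)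
  have sum_add_index: "(\<Sum>i<m + n. f i) = (\<Sum>i<m. f i) + (\<Sum>i<n. f (m + i))" for m n :: nat and f :: "nat \<Rightarrow> int"
    by (induction n) (simp_all add: add.assoc)
  have 1: "rotate (length (concat yss) + i) (concat (yss @ x # xss)) = rotate i (concat (rotate (length yss) (yss @ x # xss)))" for i
    by (simp add: rotate_append flip: rotate_rotate) (metis append.assoc add.commute rotate_append rotate_rotate)
  have "(\<Sum>i<length (concat (x # xss)). G (rotate (length (concat yss) + i) (concat (yss @ x # xss))))
      = (\<Sum>i<length x. G (rotate (length (concat yss) + i) (concat (yss @ x # xss))))
      + (\<Sum>i<length (concat xss). G (rotate (length (concat yss) + (length x + i)) (concat (yss @ x # xss))))"
    unfolding concat.simps length_append by (rule sum_add_index)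
  also have "(\<Sum>i<length (concat xss). G (rotate (length (concat yss) + (length x + i)) (concat (yss @ x # xss))))
    = (\<Sum>j<length xss. \<Sum>i<length (xss ! j). G (rotate i (concat (rotate (length yss + Suc j) (yss @ x # xss)))))"
    using Cons.IH[of "yss @ [x]"] by (simp add: add.assoc)
  also have "(\<Sum>i<length x. G (rotate (length (concat yss) + i) (concat (yss @ x # xss))))
    = (\<Sum>i<length ((x # xss) ! 0). G (rotate i (concat (rotate (length yss + 0) (yss @ x # xss)))))"
    by (simp only: 1 nth_Cons_0 add_0_right)
  finally show ?case
    by (simp only: length_Cons sum.lessThan_Suc_shift nth_Cons_Suc)
qed simp

text \<open>Each rotation index of the concatenation splits uniquely into the choice of a block and
  a position inside that block.\<close>

lemma rsum_concat:
  "rsum G (concat xss) = rsum (\<lambda>yss. \<Sum>i<length (hd yss). G (rotate i (concat yss))) xss"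
proof -
  have "hd (rotate j xss) = xss ! j" if "j < length xss" for j
    using that by (subst hd_rotate_conv_nth) auto
  then show ?thesis
    using rsum_concat_aux[where yss = "[]" and xss = xss and G = G] by (simp add: rsum_def)
qed

text \<open>Statistics of cyclic words; as sums over all rotations they are rotation invariant by
  construction. The next letter of the same kind in \<open>same\<close> and the neighbouring letters of the other
  kind in \<open>bad\<close> are found by skipping letters. The letters \<open>b\<^sup>-\<^sup>1\<close> of a run between two letters \<open>a\<close>, which
  \<open>sig\<close> partly cancels, are counted by \<open>bad Gen_b\<close>.\<close>

definition cnt :: "basis \<Rightarrow> word \<Rightarrow> int" where
  "cnt x = rsum (\<lambda>w. of_bool (fst (hd w) = x))"

definition turns :: "word \<Rightarrow> int" where
  "turns = rsum (\<lambda>w. of_bool (snd (hd (rotate1 w)) \<noteq> snd (hd w)))"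

definition same :: "basis \<Rightarrow> word \<Rightarrow> int" where
  "same x = rsum (\<lambda>w. of_bool (fst (hd w) = x \<and>
     snd (hd (filter (\<lambda>l. fst l = x) (rotate1 w))) = snd (hd w)))"

definition bad :: "basis \<Rightarrow> word \<Rightarrow> int" where
  "bad x = rsum (\<lambda>w. of_bool (fst (hd w) = x \<and> filter (\<lambda>l. fst l \<noteq> x) (tl w) \<noteq> [] \<and>
     snd (hd (filter (\<lambda>l. fst l \<noteq> x) (tl w))) \<noteq> snd (hd w) \<and>
     snd (last (filter (\<lambda>l. fst l \<noteq> x) (tl w))) \<noteq> snd (hd w)))"

definition adj :: "basis \<Rightarrow> word \<Rightarrow> int" where
  "adj x = rsum (\<lambda>w. of_bool (fst (hd w) = x \<and> fst (hd (rotate1 w)) = x))"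

definition cancels :: "word \<Rightarrow> int" where
  "cancels = rsum (\<lambda>w. of_bool (hd (rotate1 w) = letter_inv (hd w)))"

text \<open>Makes cyclic reducedness the vanishing of a rotation sum, so that it is handled like the
  other statistics: invariant under rotation, transported by \<open>swap\<close> and computed from
  blocks.\<close>

lemma cyc_reduced_iff_cancels: "cyc_reduced w \<longleftrightarrow> cancels w = 0"
proof (cases "w = []")
  case False
  have hd1: "hd (rotate1 v) = v ! (1 mod length v)" if "v \<noteq> []" for v :: word
    using that hd_rotate_conv_nth[of v 1] by simp
  have "cancels w = 0 \<longleftrightarrow> (\<forall>i<length w. hd (rotate1 (rotate i w)) \<noteq> letter_inv (hd (rotate i w)))"
    unfolding cancels_def rsum_def by (subst sum_nonneg_eq_0_iff) auto
  also have "\<dots> \<longleftrightarrow> (\<forall>i<length w. w ! (Suc i mod length w) \<noteq> letter_inv (w ! i))"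
    using False hd_rotate_conv_nth[OF False] by (simp flip: rotate_Suc)
  also have "\<dots> \<longleftrightarrow> (\<forall>i. Suc i < length w \<longrightarrow> w ! Suc i \<noteq> letter_inv (w ! i)) \<and>
      w ! 0 \<noteq> letter_inv (w ! (length w - 1))"
  proof (intro iffI conjI allI impI)
    fix i assume "\<forall>i<length w. w ! (Suc i mod length w) \<noteq> letter_inv (w ! i)" "Suc i < length w"
    then show "w ! Suc i \<noteq> letter_inv (w ! i)" by (metis Suc_lessD mod_less)
  next
    assume "\<forall>i<length w. w ! (Suc i mod length w) \<noteq> letter_inv (w ! i)"
    then show "w ! 0 \<noteq> letter_inv (w ! (length w - 1))"
      using False by (metis Suc_pred' diff_less length_greater_0_conv less_numeral_extra(1) mod_self)
  next
    fix i assume "(\<forall>i. Suc i < length w \<longrightarrow> w ! Suc i \<noteq> letter_inv (w ! i)) \<and>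
      w ! 0 \<noteq> letter_inv (w ! (length w - 1))" "i < length w"
    then show "w ! (Suc i mod length w) \<noteq> letter_inv (w ! i)"
      by (cases "Suc i = length w") (metis diff_Suc_1 mod_self, metis Suc_lessI mod_less)
  qed
  finally show ?thesis using False
    by (simp add: cyc_reduced_def reduced_iff_nth hd_conv_nth last_conv_nth)
qed (simp add: cancels_def rsum_def cyc_reduced_def)

lemma cyc_reduced_rotate: "cyc_reduced (rotate k w) = cyc_reduced w"
  by (simp add: cyc_reduced_iff_cancels cancels_def)

text \<open>Lets the facts about \<open>tau\<close> be read off from those about
  \<open>sig\<close>.\<close>

lemma swap_stats:
  "cnt x (swap w) = cnt (flip_basis x) w" "turns (swap w) = turns w"
  "same x (swap w) = same (flip_basis x) w" "bad x (swap w) = bad (flip_basis x) w"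
  "adj x (swap w) = adj (flip_basis x) w" "cancels (swap w) = cancels w"
proof -
  let ?m = "map (map_prod flip_basis id) :: word \<Rightarrow> word"
  have flip: "flip_basis y = x \<longleftrightarrow> y = flip_basis x" for x y by (cases x; cases y) auto
  have hd_m: "hd (?m v) = (flip_basis (fst (hd v)), snd (hd v))" if "v \<noteq> []" for v
    using that by (simp add: hd_map map_prod_def split_beta)
  have filter_m: "filter (\<lambda>l. fst l = x) (?m v) = ?m (filter (\<lambda>l. fst l = flip_basis x) v)"
    "filter (\<lambda>l. fst l \<noteq> x) (?m v) = ?m (filter (\<lambda>l. fst l \<noteq> flip_basis x) v)" for x v
    by (simp_all add: filter_map comp_def flip)
  have same: "of_bool (fst (hd (?m v)) = x \<and>
      snd (hd (filter (\<lambda>l. fst l = x) (rotate1 (?m v)))) = snd (hd (?m v))) =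
    (of_bool (fst (hd v) = flip_basis x \<and>
      snd (hd (filter (\<lambda>l. fst l = flip_basis x) (rotate1 v))) = snd (hd v)) :: int)"
    if "v \<noteq> []" for v x
  proof (cases "fst (hd v) = flip_basis x")
    case True
    then have "filter (\<lambda>l. fst l = flip_basis x) (rotate1 v) \<noteq> []"
      using that by (auto simp: filter_empty_conv)
    then show ?thesis using that by (simp add: rotate1_map filter_m hd_m flip)
  qed (simp add: hd_m[OF that] flip)
  have bad: "of_bool (fst (hd (?m v)) = x \<and> filter (\<lambda>l. fst l \<noteq> x) (tl (?m v)) \<noteq> [] \<and>
      snd (hd (filter (\<lambda>l. fst l \<noteq> x) (tl (?m v)))) \<noteq> snd (hd (?m v)) \<and>
      snd (last (filter (\<lambda>l. fst l \<noteq> x) (tl (?m v)))) \<noteq> snd (hd (?m v))) =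
    (of_bool (fst (hd v) = flip_basis x \<and> filter (\<lambda>l. fst l \<noteq> flip_basis x) (tl v) \<noteq> [] \<and>
      snd (hd (filter (\<lambda>l. fst l \<noteq> flip_basis x) (tl v))) \<noteq> snd (hd v) \<and>
      snd (last (filter (\<lambda>l. fst l \<noteq> flip_basis x) (tl v))) \<noteq> snd (hd v)) :: int)"
    if "v \<noteq> []" for v x
    unfolding map_tl[symmetric] filter_m hd_m[OF that]
    by (cases "filter (\<lambda>l. fst l \<noteq> flip_basis x) (tl v) = []") (simp_all add: hd_m last_map flip)
  show "cnt x (swap w) = cnt (flip_basis x) w" "turns (swap w) = turns w"
    "adj x (swap w) = adj (flip_basis x) w" "cancels (swap w) = cancels w"
    unfolding swap_def cnt_def turns_def adj_def cancels_def
    by (subst rsum_map, rule rsum_cong; subgoal_tac "w \<noteq> []";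
        auto simp: hd_m rotate1_map flip letter_inv_def prod_eq_iff)+
  show "same x (swap w) = same (flip_basis x) w"
    unfolding swap_def same_def by (subst rsum_map, rule rsum_cong, rule same) auto
  show "bad x (swap w) = bad (flip_basis x) w"
    unfolding swap_def bad_def by (subst rsum_map, rule rsum_cong, rule bad) auto
qed

lemma cyc_reduced_swap [simp]: "cyc_reduced (swap w) = cyc_reduced w"
  by (simp add: cyc_reduced_iff_cancels swap_stats)

lemma stats_nonneg: "0 \<le> cnt x w" "0 \<le> turns w" "0 \<le> same x w" "0 \<le> bad x w" "0 \<le> adj x w"
  unfolding cnt_def turns_def same_def bad_def adj_def by (auto intro: rsum_nonneg)

lemma length_eq_cnt: "int (length w) = cnt Gen_a w + cnt Gen_b w"
proof -
  have "cnt Gen_a w + cnt Gen_b w = rsum (\<lambda>_. 1) w"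
    unfolding cnt_def by (subst rsum_add[symmetric], rule rsum_cong) (auto, metis basis.exhaust)
  then show ?thesis by (simp add: rsum_one)
qed


section \<open>Words in the form of a product of blocks\<close>

type_synonym block = "bool \<times> int"

text \<open>Between consecutive letters of type a only one integer matters, possibly zero. A twist
  then acts by arithmetic on exponents, and cancellation never has to be traced inside the
  word.\<close>

fun blk :: "block \<Rightarrow> word" where
  "blk (p, e) = (Gen_a, p) # replicate (nat \<bar>e\<bar>) (Gen_b, e > 0)"

definition W :: "block list \<Rightarrow> word" where
  "W xs = concat (map blk xs)"

lemma W_simps [simp]: "W [] = []" "W (x # xs) = blk x @ W xs" "W (xs @ ys) = W xs @ W ys"
  by (simp_all add: W_def)

lemma W_eq_Nil [simp]: "W xs = [] \<longleftrightarrow> xs = []"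
  by (cases xs) auto

lemma filter_W [simp]:
  "filter (\<lambda>l. fst l = Gen_a) (W xs) = map (\<lambda>x. (Gen_a, fst x)) xs"
  "filter (\<lambda>l. fst l \<noteq> Gen_b) (W xs) = map (\<lambda>x. (Gen_a, fst x)) xs"
  by (induction xs) (auto simp: W_def)

lemma W_Cons_hd: "xs \<noteq> [] \<Longrightarrow> W xs \<noteq> [] \<and> hd (W xs) = (Gen_a, fst (hd xs))"
  by (cases xs) auto

lemma rsum_W:
  "rsum G (W xs) = rsum (\<lambda>ys. \<Sum>i<length (blk (hd ys)). G (rotate i (W ys))) xs"
  unfolding W_def
  by (subst rsum_concat, subst rsum_map, rule rsum_cong)
    (metis (no_types, lifting) hd_map list.size(3) not_less_zero rotate_is_Nil_conv)

lemma rotate_block: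
  assumes "i < n"
  shows "rotate (Suc i) ((a # replicate n l) @ r) = l # replicate (n - Suc i) l @ r @ a # replicate i l"
proof -
  have "n = Suc i + (n - Suc i)" using assms by simp
  then have "replicate n l = replicate (Suc i) l @ replicate (n - Suc i) l"
    by (metis replicate_add)
  then have "(a # replicate n l) @ r = (a # replicate i l) @ (l # replicate (n - Suc i) l @ r)"
    by (simp add: replicate_append_same)
  moreover have "length (a # replicate i l) = Suc i" by simp
  ultimately show ?thesis by (metis append_Cons append_assoc rotate_append)
qed

text \<open>The rotation starting at the letter of type b with index \<open>i\<close> (from 0) in
  the first block; the letters already passed stand at the end.\<close>

abbreviation rot_blk :: "bool \<Rightarrow> int \<Rightarrow> block list \<Rightarrow> nat \<Rightarrow> word" where
  "rot_blk p e xs i \<equiv> (Gen_b, e > 0) # replicate (nat \<bar>e\<bar> - Suc i) (Gen_b, e > 0) @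
     W xs @ (Gen_a, p) # replicate i (Gen_b, e > 0)"

lemma block_sum:
  "(\<Sum>i<length (blk (p, e)). G (rotate i (W ((p, e) # xs)))) =
     G (W ((p, e) # xs)) +
     (\<Sum>i<nat \<bar>e\<bar>. G (rot_blk p e xs i))"
proof -
  have "length (blk (p, e)) = Suc (nat \<bar>e\<bar>)" by simp
  then have "(\<Sum>i<length (blk (p, e)). G (rotate i (W ((p, e) # xs)))) =
     G (W ((p, e) # xs)) + (\<Sum>i<nat \<bar>e\<bar>. G (rotate (Suc i) (W ((p, e) # xs))))"
    by (simp only: sum.lessThan_Suc_shift) simp
  also have "(\<Sum>i<nat \<bar>e\<bar>. G (rotate (Suc i) (W ((p, e) # xs)))) =
     (\<Sum>i<nat \<bar>e\<bar>. G (rot_blk p e xs i))"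
    by (rule sum.cong[OF refl], subst W_simps(2), subst blk.simps, subst rotate_block) auto
  finally show ?thesis .
qed

lemma rsum_W_eqI:
  assumes "\<And>p e xs. G (W ((p, e) # xs)) +
     (\<Sum>i<nat \<bar>e\<bar>. G (rot_blk p e xs i)) = H ((p, e) # xs)"
  shows "rsum G (W xs) = rsum H xs"
  unfolding rsum_W
proof (rule rsum_cong)
  fix i assume "i < length xs"
  then have "rotate i xs \<noteq> []" by auto
  then obtain p e ys where "rotate i xs = (p, e) # ys" by (metis list.exhaust prod.exhaust)
  then show "(\<Sum>ia<length (blk (hd (rotate i xs))). G (rotate ia (W (rotate i xs)))) = H (rotate i xs)"
    using assms[of p e ys] block_sum[where p = p and e = e and G = G and xs = ys] by simp
qed

lemma rsum_W_geI:
  assumes "\<And>v. fst (hd v) = Gen_b \<Longrightarrow> G v = 0"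
    and "\<And>p e xs. H ((p, e) # xs) \<le> G (W ((p, e) # xs))"
  shows "rsum H xs \<le> rsum G (W xs)"
proof -
  have "rsum G (W xs) = rsum (\<lambda>ys. if ys = [] then 0 else G (W ys)) xs"
    by (rule rsum_W_eqI) (simp add: assms(1))
  also have "\<dots> \<ge> rsum H xs"
  proof (rule rsum_mono)
    fix i assume "i < length xs"
    then have "rotate i xs \<noteq> []" by auto
    then obtain p e ys where "rotate i xs = (p, e) # ys" by (metis list.exhaust prod.exhaust)
    then show "H (rotate i xs) \<le> (if rotate i xs = [] then 0 else G (W (rotate i xs)))"
      using assms(2) by simp
  qed
  finally show ?thesis .
qed

lemma rsum_W_leI:
  assumes "\<And>v. fst (hd v) = Gen_b \<Longrightarrow> G v = 0"
    and "\<And>p e xs. G (W ((p, e) # xs)) \<le> H ((p, e) # xs)"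
  shows "rsum G (W xs) \<le> rsum H xs"
proof -
  have "rsum (\<lambda>ys. - H ys) xs \<le> rsum (\<lambda>v. - G v) (W xs)"
    by (rule rsum_W_geI) (use assms in \<open>simp_all del: W_simps\<close>)
  then show ?thesis by (simp add: rsum_def sum_negf)
qed

lemma sum_if_last: "(\<Sum>i<n. if Suc i < n then c else d) = (if n = 0 then 0 else int (n - 1) * c + d)"
  for c d :: int
proof (cases n)
  case (Suc m)
  have "(\<Sum>i<m. if Suc i < n then c else d) = (\<Sum>i<m. c)"
    by (rule sum.cong) (auto simp: Suc)
  then show ?thesis by (simp add: Suc)
qed simp

abbreviation nxt :: "block list \<Rightarrow> bool" where
  "nxt xs \<equiv> fst (hd (rotate1 xs))"

lemma block_tail:
  assumes "i < nat \<bar>e\<bar>"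
  shows "hd (rotate1 ((Gen_b, s) # replicate (nat \<bar>e\<bar> - Suc i) (Gen_b, s) @ W xs @ (Gen_a, p) # replicate i (Gen_b, s)))
    = (if Suc i < nat \<bar>e\<bar> then (Gen_b, s) else (Gen_a, nxt ((p, e) # xs)))"
proof (cases "Suc i < nat \<bar>e\<bar>")
  case True
  then obtain k where "nat \<bar>e\<bar> - Suc i = Suc k" by (metis Suc_diff_Suc)
  then show ?thesis using True by simp
next
  case False
  then show ?thesis using assms by (cases xs) auto
qed

section \<open>Statistics read off from the blocks\<close>

lemma cnt_a_W: "cnt Gen_a (W xs) = rsum (\<lambda>ys. 1) xs"
  unfolding cnt_def by (rule rsum_W_eqI) simp

lemma cnt_b_W: "cnt Gen_b (W xs) = rsum (\<lambda>ys. \<bar>snd (hd ys)\<bar>) xs"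
  unfolding cnt_def by (rule rsum_W_eqI) simp

lemma hd_rotate1_W:
  "hd (rotate1 (W ((p, e) # xs))) = (if e = 0 then (Gen_a, nxt ((p, e) # xs)) else (Gen_b, e > 0))"
  by (cases xs; cases "nat \<bar>e\<bar>") auto

text \<open>Between two letters of type a with different signs there is exactly one change of sign,
  whatever run of b separates them. Between equal signs there are two if the run has the opposite
  sign, otherwise none.\<close>

lemma turns_W: "turns (W xs) = rsum (\<lambda>ys. of_bool (fst (hd ys) \<noteq> nxt ys) +
    2 * of_bool (snd (hd ys) \<noteq> 0 \<and> fst (hd ys) = nxt ys \<and> (snd (hd ys) > 0) \<noteq> fst (hd ys))) xs"
  unfolding turns_def
proof (rule rsum_W_eqI, goal_cases)
  case (1 p e xs)
  have "(\<Sum>i<nat \<bar>e\<bar>. of_bool (snd (hd (rotate1 (rot_blk p e xs i))) \<noteq> snd (hd (rot_blk p e xs i))) :: int)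
    = (\<Sum>i<nat \<bar>e\<bar>. if Suc i < nat \<bar>e\<bar> then 0 else of_bool (nxt ((p, e) # xs) \<noteq> (e > 0)))"
    by (rule sum.cong[OF refl], subst block_tail) auto
  also have "\<dots> = of_bool (e \<noteq> 0 \<and> nxt ((p, e) # xs) \<noteq> (e > 0))"
    by (subst sum_if_last) simp
  finally show ?case unfolding hd_rotate1_W by (cases "e = 0") auto
qed

lemma same_a_W: "same Gen_a (W xs) = rsum (\<lambda>ys. of_bool (fst (hd ys) = nxt ys)) xs"
  unfolding same_def
proof (rule rsum_W_eqI, goal_cases)
  case (1 p e xs)
  show ?case by (cases xs) auto
qed

lemma bad_b_W: "bad Gen_b (W xs) =
  rsum (\<lambda>ys. if fst (hd ys) = nxt ys \<and> (snd (hd ys) > 0) \<noteq> fst (hd ys) then \<bar>snd (hd ys)\<bar> else 0) xs"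
  unfolding bad_def
proof (rule rsum_W_eqI, goal_cases)
  case (1 p e xs)
  have f: "filter (\<lambda>l. fst l \<noteq> Gen_b) (tl (rot_blk p e xs i)) = map (\<lambda>x. (Gen_a, fst x)) (xs @ [(p, e)])" for i
    by simp
  have l: "last (map (\<lambda>x. (Gen_a, fst x)) (xs @ [(p, e)])) = (Gen_a, p)" by simp
  have h: "hd (map (\<lambda>x. (Gen_a, fst x)) (xs @ [(p, e)])) = (Gen_a, nxt ((p, e) # xs))" by (cases xs) auto
  show ?case unfolding f l h by auto
qed

lemma adj_a_W: "adj Gen_a (W xs) = rsum (\<lambda>ys. of_bool (snd (hd ys) = 0)) xs"
  unfolding adj_def
proof (rule rsum_W_eqI, goal_cases)
  case (1 p e xs)
  show ?case unfolding hd_rotate1_W by simp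
qed

lemma adj_b_W: "adj Gen_b (W xs) = rsum (\<lambda>ys. if snd (hd ys) = 0 then 0 else \<bar>snd (hd ys)\<bar> - 1) xs"
  unfolding adj_def
proof (rule rsum_W_eqI, goal_cases)
  case (1 p e xs)
  have "(\<Sum>i<nat \<bar>e\<bar>. of_bool (fst (hd (rot_blk p e xs i)) = Gen_b \<and> fst (hd (rotate1 (rot_blk p e xs i))) = Gen_b) :: int)
    = (\<Sum>i<nat \<bar>e\<bar>. if Suc i < nat \<bar>e\<bar> then 1 else 0)"
    by (rule sum.cong[OF refl], subst block_tail) auto
  also have "\<dots> = (if e = 0 then 0 else \<bar>e\<bar> - 1)"
    by (subst sum_if_last) auto
  finally show ?case by simp
qed

lemma cancels_W: "cancels (W xs) = rsum (\<lambda>ys. of_bool (snd (hd ys) = 0 \<and> fst (hd ys) \<noteq> nxt ys)) xs"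
  unfolding cancels_def
proof (rule rsum_W_eqI, goal_cases)
  case (1 p e xs)
  have "(\<Sum>i<nat \<bar>e\<bar>. of_bool (hd (rotate1 (rot_blk p e xs i)) = letter_inv (hd (rot_blk p e xs i))) :: int) = 0"
    by (rule sum.neutral, rule ballI, subst block_tail) auto
  then show ?case unfolding hd_rotate1_W by auto
qed

lemma last_filter_b_W:
  assumes "xs \<noteq> []" "snd (last xs) \<noteq> 0"
  shows "filter (\<lambda>l. fst l \<noteq> Gen_a) (tl (W xs)) \<noteq> [] \<and>
    last (filter (\<lambda>l. fst l \<noteq> Gen_a) (tl (W xs))) = (Gen_b, snd (last xs) > 0)"
proof -
  have "filter (\<lambda>l. fst l \<noteq> Gen_a) (tl (W xs)) = filter (\<lambda>l. fst l \<noteq> Gen_a) (W xs)"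
    using assms(1) by (cases xs) auto
  moreover obtain ys p e where "xs = ys @ [(p, e)]"
    using assms(1) by (metis append_butlast_last_id prod.exhaust)
  ultimately show ?thesis using assms(2) by simp
qed

lemma hd_filter_b_W:
  assumes "e \<noteq> 0"
  shows "filter (\<lambda>l. fst l \<noteq> Gen_a) (tl (W ((p, e) # xs))) \<noteq> [] \<and>
    hd (filter (\<lambda>l. fst l \<noteq> Gen_a) (tl (W ((p, e) # xs)))) = (Gen_b, e > 0)"
  using assms by (cases "nat \<bar>e\<bar>") auto

abbreviation "opposed e p \<equiv> e \<noteq> (0::int) \<and> (e > 0) \<noteq> p"
abbreviation "aligned e p \<equiv> e \<noteq> (0::int) \<and> (e > 0) = p"

text \<open>The letters counted by \<open>bad Gen_a\<close> depend on exponents arbitrarily far away, because zero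
  exponents are skipped. The next two lemmas enclose this number between two counts that only
  look at the two adjacent exponents; one application of \<open>sig\<close> turns the weaker condition into the
  stronger one.\<close>

lemma bad_a_W_ge: "rsum (\<lambda>ys. of_bool (opposed (snd (hd ys)) (fst (hd ys)) \<and>
    opposed (snd (last ys)) (fst (hd ys)))) xs \<le> bad Gen_a (W xs)"
  unfolding bad_def
proof (rule rsum_W_geI, goal_cases)
  case (2 p e xs)
  show ?case
  proof (cases "e \<noteq> 0 \<and> snd (last ((p, e) # xs)) \<noteq> 0")
    case True
    then show ?thesis
      using hd_filter_b_W[of e p xs] last_filter_b_W[of "(p, e) # xs"]
      by (simp del: W_simps add: W_Cons_hd)
  qed auto
qed auto

lemma bad_a_W_le: "bad Gen_a (W xs) \<le> rsum (\<lambda>ys. of_bool (\<not> aligned (snd (hd ys)) (fst (hd ys)) \<and>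
    \<not> aligned (snd (last ys)) (fst (hd ys)))) xs"
  unfolding bad_def
proof (rule rsum_W_leI, goal_cases)
  case (2 p e xs)
  show ?case
    using hd_filter_b_W[of e p xs] last_filter_b_W[of "(p, e) # xs"]
    by (cases "e = 0"; cases "snd (last ((p, e) # xs)) = 0")
      (simp_all del: W_simps add: W_Cons_hd)
qed auto

section \<open>Block form of cyclically reduced words\<close>

lemma reduced_imp_W:
  "reduced w \<Longrightarrow> \<exists>n s xs. w = replicate n (Gen_b, s) @ W xs"
proof (induction w)
  case Nil
  show ?case by (intro exI[of _ 0] exI[of _ True] exI[of _ "[]"]) simp
next
  case (Cons l w)
  then obtain n s xs where w: "w = replicate n (Gen_b, s) @ W xs" by (auto simp: reduced_Cons)
  obtain x p where l: "l = (x, p)" by (cases l)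
  show ?case
  proof (cases x)
    case Gen_a
    have "l # w = replicate 0 (Gen_b, s) @ W ((p, if s then int n else - int n) # xs)"
      unfolding w l Gen_a by (cases n) (auto simp: nat_add_distrib)
    then show ?thesis by blast
  next
    case Gen_b
    have "n = 0 \<or> p = s"
      using Cons.prems unfolding w l Gen_b by (cases n) auto
    then show ?thesis
    proof
      assume "n = 0"
      then have "l # w = replicate 1 (Gen_b, p) @ W xs" unfolding w l Gen_b by simp
      then show ?thesis by blast
    next
      assume "p = s"
      then have "l # w = replicate (Suc n) (Gen_b, s) @ W xs" unfolding w l Gen_b by simp
      then show ?thesis by blast
    qed
  qed
qed

text \<open>A word containing a letter of type a can be rotated to start with one; only the powers
  of b escape the block form.\<close>

lemma cyc_reduced_cases:
  assumes "cyc_reduced w"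
  obtains n s where "w = replicate n (Gen_b, s)"
  | k xs where "xs \<noteq> []" "rotate k w = W xs"
proof -
  obtain n s xs where w: "w = replicate n (Gen_b, s) @ W xs"
    using reduced_imp_W[of w] assms unfolding cyc_reduced_def by blast
  show ?thesis
  proof (cases xs)
    case Nil
    then show ?thesis using w that(1)[of n s] by simp
  next
    case (Cons x ys)
    let ?v = "rotate n w"
    have v: "?v = W xs @ replicate n (Gen_b, s)"
      unfolding w using rotate_append[of "replicate n (Gen_b, s)" "W xs"] by simp
    have "reduced ?v" using assms cyc_reduced_rotate[of n w] by (simp add: cyc_reduced_def)
    then obtain m t zs where z: "?v = replicate m (Gen_b, t) @ W zs" using reduced_imp_W by blast
    have "hd ?v = (Gen_a, fst x)" "?v \<noteq> []" unfolding v Cons by (cases x; simp)+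
    then have "m = 0" unfolding z by (cases m) auto
    then show ?thesis using that(2)[of zs n] z \<open>?v \<noteq> []\<close> by auto
  qed
qed


section \<open>The action of \<open>sig\<close> on blocks\<close>

text \<open>The net contribution of the two neighbours with signs \<open>p\<close> and
  \<open>q\<close>: +1 from a positive left one, -1 from a negative right one. The value 0 covers
  both the case where the two contributions cancel and the case where neither occurs.\<close>

definition twist :: "bool \<Rightarrow> bool \<Rightarrow> int" where
  "twist p q = (if p = q then if p then 1 else - 1 else 0)"

text \<open>On blocks \<open>sig\<close> only changes exponents: the letter \<open>b\<close> behind \<open>a\<close> in \<open>sig a = ab\<close> and the letter
  \<open>b\<^sup>-\<^sup>1\<close> in front of \<open>a\<^sup>-\<^sup>1\<close> in \<open>sig a\<^sup>-\<^sup>1 = b\<^sup>-\<^sup>1a\<^sup>-\<^sup>1\<close> are added to the exponent between the letters of type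
  \<open>a\<close>. The argument \<open>q\<close> is the sign of the letter that follows the last block.\<close>

fun shift_to :: "bool \<Rightarrow> block list \<Rightarrow> block list" where
  "shift_to q [] = []"
| "shift_to q ((p, e) # xs) = (p, e + twist p (if xs = [] then q else fst (hd xs))) # shift_to q xs"

definition shift :: "block list \<Rightarrow> block list" where
  "shift xs = shift_to (fst (hd xs)) xs"

lemma shift_to_append:
  "shift_to q (xs @ [(p, e)]) = shift_to p xs @ [(p, e + twist p q)]"
proof (induction xs)
  case (Cons x xs)
  then show ?case by (cases x) (auto simp: hd_append)
qed simp

lemma length_shift_to [simp]: "length (shift_to q xs) = length xs"
proof (induction xs)
  case (Cons x xs)
  then show ?case by (cases x) auto
qed simp

lemma length_shift [simp]: "length (shift xs) = length xs"
  by (simp add: shift_def)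

lemma shift_eq_Nil [simp]: "shift xs = [] \<longleftrightarrow> xs = []"
  by (metis length_0_conv length_shift)

lemma rotate1_shift: "rotate1 (shift xs) = shift (rotate1 xs)"
proof (cases xs)
  case (Cons x ys)
  obtain p e where x: "x = (p, e)" by (cases x)
  show ?thesis by (cases ys) (auto simp: Cons x shift_def shift_to_append)
qed (simp add: shift_def)

lemma rotate_shift: "rotate i (shift xs) = shift (rotate i xs)"
  by (induction i) (simp_all add: rotate1_shift)

lemma rsum_shift: "rsum H (shift xs) = rsum (\<lambda>ys. H (shift ys)) xs"
  by (simp add: rsum_def rotate_shift)

lemma hd_shift:
  assumes "xs \<noteq> []"
  shows "hd (shift xs) = (fst (hd xs), snd (hd xs) + twist (fst (hd xs)) (nxt xs))"
  using assms by (cases xs; cases "tl xs") (auto simp: shift_def)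

lemma nxt_shift: "xs \<noteq> [] \<Longrightarrow> nxt (shift xs) = nxt xs"
  using hd_shift[of "rotate1 xs"] by (simp add: rotate1_shift)

lemma last_shift:
  assumes "xs \<noteq> []"
  shows "last (shift xs) = (fst (last xs), snd (last xs) + twist (fst (last xs)) (fst (hd xs)))"
proof -
  obtain ys p e where "xs = ys @ [(p, e)]"
    using assms by (metis append_butlast_last_id prod.exhaust)
  then show ?thesis by (simp add: shift_def shift_to_append)
qed

section \<open>Powers of b and the image of a product of blocks\<close>

definition bpow :: "int \<Rightarrow> word" where
  "bpow k = replicate (nat \<bar>k\<bar>) (Gen_b, k > 0)"

lemma bpow_simps [simp]: "bpow 0 = []" "bpow 1 = [Lb]" "bpow (-1) = [LB]"
  by (simp_all add: bpow_def)

lemma bpow_Suc: "reduce (Lb # bpow k) = reduce (bpow (k + 1))"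
proof (cases "k \<ge> 0")
  case True
  then have "Lb # bpow k = bpow (k + 1)" by (cases "k = 0") (auto simp: bpow_def nat_add_distrib)
  then show ?thesis by simp
next
  case False
  then have "nat \<bar>k\<bar> = Suc (nat \<bar>k + 1\<bar>)" by simp
  then have "bpow k = LB # bpow (k + 1)" using False by (auto simp: bpow_def)
  then have "reduce (Lb # bpow k) = reduce ([Lb, LB] @ bpow (k + 1))" by simp
  also have "\<dots> = reduce (bpow (k + 1))" by (rule reduce_cancel_left) (simp add: reduce_def)
  finally show ?thesis .
qed

lemma bpow_pred: "reduce (LB # bpow k) = reduce (bpow (k - 1))"
proof -
  have "reduce (bpow k) = reduce (Lb # bpow (k - 1))"
    using bpow_Suc[of "k - 1"] by simp
  then have "reduce ([LB] @ bpow k) = reduce ([LB] @ (Lb # bpow (k - 1)))"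
    by (rule reduce_cong_append[OF refl])
  also have "\<dots> = reduce ([LB, Lb] @ bpow (k - 1))" by simp
  also have "\<dots> = reduce (bpow (k - 1))" by (rule reduce_cancel_left) (simp add: reduce_def)
  finally show ?thesis by simp
qed

lemma bpow_add: "reduce (bpow i @ bpow j) = reduce (bpow (i + j))"
proof (induction i rule: int_induct[where k = 0])
  case (step1 i)
  have "reduce (bpow (i + 1) @ bpow j) = reduce ((Lb # bpow i) @ bpow j)"
    by (rule reduce_cong_append[OF bpow_Suc[symmetric] refl])
  also have "\<dots> = reduce ([Lb] @ (bpow i @ bpow j))" by simp
  also have "\<dots> = reduce ([Lb] @ bpow (i + j))"
    by (rule reduce_cong_append[OF refl step1.IH])
  also have "\<dots> = reduce (bpow (i + j + 1))" by (simp add: bpow_Suc)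
  finally show ?case by (simp add: add_ac)
next
  case (step2 i)
  have "reduce (bpow (i - 1) @ bpow j) = reduce ((LB # bpow i) @ bpow j)"
    by (rule reduce_cong_append[OF bpow_pred[symmetric] refl])
  also have "\<dots> = reduce ([LB] @ (bpow i @ bpow j))" by simp
  also have "\<dots> = reduce ([LB] @ bpow (i + j))"
    by (rule reduce_cong_append[OF refl step2.IH])
  also have "\<dots> = reduce (bpow (i + j - 1))" by (simp add: bpow_pred)
  finally show ?case by (simp add: algebra_simps)
qed simp

lemma sig_append: "sig (u @ v) = sig u @ sig v"
  by (simp add: sig_def)

lemma sig_b [simp]: "sig (replicate n (Gen_b, s)) = replicate n (Gen_b, s)"
  by (induction n; cases s) (auto simp: sig_def)

lemma sig_blk:
  "sig (blk (p, e)) = bpow (if p then 0 else - 1) @ [(Gen_a, p)] @ bpow (if p then 1 else 0) @ bpow e"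
proof -
  have "sig (blk (p, e)) = sig [(Gen_a, p)] @ bpow e"
    using sig_append[of "[(Gen_a, p)]" "bpow e"] by (simp add: bpow_def)
  moreover have "sig [(Gen_a, p)] = bpow (if p then 0 else - 1) @ [(Gen_a, p)] @ bpow (if p then 1 else 0)"
    by (cases p) (simp_all add: sig_def)
  ultimately show ?thesis by (simp only: append_assoc)
qed

lemma blk_bpow: "blk (p, e) = [(Gen_a, p)] @ bpow e"
  by (simp add: bpow_def)

text \<open>Both sides carry a boundary term: on the left the possible b^-1 that opens the image of
  the letter after the list, on the right the one that opens the image of the first letter. With
  these terms the induction moves each b^-1 into the block before it.\<close>

lemma sig_W_aux:
  "reduce (sig (W xs) @ bpow (if q then 0 else - 1)) =
   reduce (bpow (if (if xs = [] then q else fst (hd xs)) then 0 else - 1) @ W (shift_to q xs))"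
proof (induction xs)
  case (Cons x xs)
  obtain p e where x: "x = (p, e)" by (cases x)
  let ?c = "\<lambda>p. if p then 0 else - 1 :: int" and ?d = "\<lambda>p. if p then 1 else 0 :: int"
  define r where "r = (if xs = [] then q else fst (hd xs))"
  have "reduce (sig (W (x # xs)) @ bpow (?c q)) =
     reduce ((bpow (?c p) @ [(Gen_a, p)] @ bpow (?d p) @ bpow e) @ (sig (W xs) @ bpow (?c q)))"
    by (simp only: x W_simps sig_append sig_blk append_assoc)
  also have "\<dots> = reduce ((bpow (?c p) @ [(Gen_a, p)] @ bpow (?d p) @ bpow e) @ (bpow (?c r) @ W (shift_to q xs)))"
    by (rule reduce_cong_append[OF refl]) (simp only: Cons.IH r_def)
  also have "\<dots> = reduce ((bpow (?c p) @ [(Gen_a, p)]) @ ((bpow (?d p) @ bpow e @ bpow (?c r)) @ W (shift_to q xs)))"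
    by simp
  also have "\<dots> = reduce ((bpow (?c p) @ [(Gen_a, p)]) @ (bpow (e + twist p r) @ W (shift_to q xs)))"
  proof (intro reduce_cong_append refl)
    have "reduce (bpow (?d p) @ (bpow e @ bpow (?c r))) = reduce (bpow (?d p) @ bpow (e + ?c r))"
      by (intro reduce_cong_append refl bpow_add)
    also have "\<dots> = reduce (bpow (e + twist p r))"
      by (subst bpow_add, rule arg_cong[where f = "\<lambda>k. reduce (bpow k)"]) (simp add: twist_def)
    finally show "reduce (bpow (?d p) @ bpow e @ bpow (?c r)) = reduce (bpow (e + twist p r))" .
  qed
  also have "(bpow (?c p) @ [(Gen_a, p)]) @ (bpow (e + twist p r) @ W (shift_to q xs)) =
     bpow (?c (if x # xs = [] then q else fst (hd (x # xs)))) @ W (shift_to q (x # xs))"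
    by (simp only: x shift_to.simps r_def W_simps blk_bpow) simp
  finally show ?case .
qed (simp add: sig_def)

text \<open>Cyclically the letter after the last block is the first one, so the two boundary terms
  coincide and a conjugation by a power of b removes them.\<close>

lemma sig_W: "word_conj (sig (W xs)) (W (shift xs))"
proof (cases "xs = []")
  case False
  define c where "c = (if fst (hd xs) then 0 else - 1 :: int)"
  have inv: "word_inv (bpow (- c)) = bpow c" by (simp add: c_def)
  have "reduce (sig (W xs) @ bpow c) = reduce (bpow c @ W (shift xs))"
    using sig_W_aux[of xs "fst (hd xs)"] False by (simp add: c_def shift_def)
  then have "reduce (bpow (- c) @ (sig (W xs) @ bpow c)) = reduce (bpow (- c) @ (bpow c @ W (shift xs)))"
    by (rule reduce_cong_append[OF refl])
  also have "\<dots> = reduce ((bpow (- c) @ bpow c) @ W (shift xs))" by simp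
  also have "\<dots> = reduce (W (shift xs))" by (rule reduce_cancel_left) (simp add: bpow_add)
  finally show ?thesis by (intro word_conjI[of _ "bpow (- c)"]) (simp add: inv)
qed (simp add: shift_def sig_def)

lemma same_a_0_shift:
  assumes "same Gen_a (W xs) = 0"
  shows "shift xs = xs"
proof (rule nth_equalityI)
  fix i assume "i < length (shift xs)"
  then have i: "i < length xs" by simp
  then have ne: "rotate i xs \<noteq> []" by auto
  have "fst (hd (rotate i xs)) \<noteq> nxt (rotate i xs)"
    using rsum_eq_0D[OF assms[unfolded same_a_W] _ i] by simp
  then have "hd (shift (rotate i xs)) = hd (rotate i xs)"
    using hd_shift[OF ne] by (simp add: twist_def prod_eq_iff)
  then show "shift xs ! i = xs ! i"
    using i hd_rotate_conv_nth[of xs i] hd_rotate_conv_nth[of "shift xs" i] ne by (auto simp: rotate_shift)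
qed simp

text \<open>Every claim is checked run by run. Between equal signs the exponent moves one step in
  the direction of that sign; between different signs it stays, and it is nonzero because nothing
  cancels. Runs of the opposite sign thus shrink to zero and afterwards grow with the right
  sign.\<close>

lemma sig_step_W:
  assumes "xs \<noteq> []" "cancels (W xs) = 0"
  defines "w \<equiv> W xs" and "w' \<equiv> W (shift xs)"
  shows "cancels w' = 0" "cnt Gen_a w' = cnt Gen_a w" "same Gen_a w' = same Gen_a w"
    and "bad Gen_b w > 0 \<Longrightarrow> bad Gen_b w' < bad Gen_b w"
    and "bad Gen_b w = 0 \<Longrightarrow> bad Gen_b w' = 0"
    and "bad Gen_a w' \<le> bad Gen_a w" "turns w' \<le> turns w"
    and "bad Gen_b w' = 0 \<Longrightarrow> cnt Gen_b w' + turns w = cnt Gen_b w + turns w' + same Gen_a w"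
    and "bad Gen_b w = 0 \<Longrightarrow> turns w + same Gen_a w = cnt Gen_a w"
    and "bad Gen_b w = 0 \<Longrightarrow> adj Gen_a w' = 0"
    and "adj Gen_b w = 0 \<Longrightarrow> bad Gen_b w' = 0"
    and "same Gen_a w = 0 \<Longrightarrow> bad Gen_b w = 0"
proof -
  have ne: "rotate i xs \<noteq> []" for i using assms(1) by simp
  have abs_if_nonneg: "0 \<le> (if P then \<bar>k\<bar> else 0)" for P and k :: int by simp
  note local = hd_shift[OF ne] nxt_shift[OF ne] last_shift[OF ne]
  have red: "\<not> (snd (hd (rotate i xs)) = 0 \<and> fst (hd (rotate i xs)) \<noteq> nxt (rotate i xs))"
    if "i < length xs" for i
    using rsum_eq_0D[OF assms(2)[unfolded cancels_W] _ that] by simp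
  \<comment> \<open>The condition \<open>red\<close> read at the end of a rotation, that is, for the
    run in front of its first letter; \<open>j\<close> is the cyclic predecessor of
    \<open>i\<close>.\<close>
  have red_prev: "\<not> (snd (last (rotate i xs)) = 0 \<and> fst (last (rotate i xs)) \<noteq> fst (hd (rotate i xs)))" for i
  proof -
    define j where "j = (i + length xs - 1) mod length xs"
    have len: "length xs > 0" using assms(1) by simp
    have "rotate1 (rotate j xs) = rotate (Suc j) xs" by simp
    also have "\<dots> = rotate (Suc j mod length xs) xs" by (rule rotate_conv_mod)
    also have "Suc j mod length xs = i mod length xs"
      using len unfolding j_def by (simp add: mod_Suc_eq)
    also have "rotate (i mod length xs) xs = rotate i xs" by (rule rotate_conv_mod[symmetric])
    finally have r: "rotate1 (rotate j xs) = rotate i xs" .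
    have "last (rotate1 ys) = hd ys" if "ys \<noteq> []" for ys :: "block list"
      using that by (cases ys) auto
    then have l: "last (rotate i xs) = hd (rotate j xs)" using ne[of j] r by metis
    have "j < length xs" using len by (simp add: j_def)
    from red[OF this] show ?thesis unfolding r l .
  qed
  show "cancels w' = 0"
  proof -
    have "cancels w' \<le> rsum (\<lambda>_. 0) xs"
      unfolding w'_def cancels_W rsum_shift
      apply (rule rsum_mono)
      subgoal for i using red[of i] by (auto simp: local twist_def)
      done
    moreover have "cancels w' \<ge> 0" unfolding cancels_def by (rule rsum_nonneg) simp
    ultimately show ?thesis by (simp add: rsum_def)
  qed
  show "cnt Gen_a w' = cnt Gen_a w" by (simp add: w_def w'_def cnt_a_W rsum_shift)
  show "same Gen_a w' = same Gen_a w"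
    unfolding w_def w'_def same_a_W rsum_shift by (rule rsum_cong) (simp add: local)
  have bad_le: "bad Gen_b w' \<le> bad Gen_b w"
    unfolding w_def w'_def bad_b_W rsum_shift by (rule rsum_mono) (auto simp: local twist_def)
  show "bad Gen_b w' < bad Gen_b w" if pos: "bad Gen_b w > 0"
  proof -
    obtain j where "j < length xs" "fst (hd (rotate j xs)) = nxt (rotate j xs) \<and> (snd (hd (rotate j xs)) > 0) \<noteq> fst (hd (rotate j xs))"
        "snd (hd (rotate j xs)) \<noteq> 0"
      using rsum_posD[OF pos[unfolded w_def bad_b_W]] by (auto split: if_splits)
    then show ?thesis
      unfolding w_def w'_def bad_b_W rsum_shift
      by (intro rsum_strict_mono[where j = j]) (auto simp: local twist_def)
  qed
  show "bad Gen_b w' = 0" if "bad Gen_b w = 0"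
    using bad_le that stats_nonneg(4)[of Gen_b w'] by simp
  show "bad Gen_a w' \<le> bad Gen_a w"
  proof -
    \<comment> \<open>The weak upper count after the step is at most the strong lower count before
      it. A run that was moved towards the sign of the letter and is still not aligned was opposed;
      an unmoved run is nonzero, hence opposed if it is not aligned.\<close>
    note bad_a_W_le[of "shift xs"]
    also note rsum_shift
    also have "rsum (\<lambda>ys. of_bool (\<not> aligned (snd (hd (shift ys))) (fst (hd (shift ys))) \<and>
        \<not> aligned (snd (last (shift ys))) (fst (hd (shift ys))))) xs
      \<le> rsum (\<lambda>ys. of_bool (opposed (snd (hd ys)) (fst (hd ys)) \<and> opposed (snd (last ys)) (fst (hd ys)))) xs"
      apply (rule rsum_mono)
      subgoal for i using red[of i] red_prev[of i] by (auto simp: local twist_def split: if_splits)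
      done
    also note bad_a_W_ge[of xs]
    finally show ?thesis unfolding w_def w'_def .
  qed
  show "turns w' \<le> turns w"
    unfolding w_def w'_def turns_W rsum_shift by (rule rsum_mono) (auto simp: local twist_def)
  \<comment> \<open>The identity holds term by term. The case to watch is an opposed run of length
    one between equal signs: it disappears, which costs one letter but also removes two changes of
    sign.\<close>
  show "cnt Gen_b w' + turns w = cnt Gen_b w + turns w' + same Gen_a w" if 0: "bad Gen_b w' = 0"
    unfolding w_def w'_def turns_W same_a_W cnt_b_W rsum_shift rsum_add[symmetric]
    apply (rule rsum_cong)
    subgoal for i
      using rsum_eq_0D[OF 0[unfolded w'_def bad_b_W rsum_shift] abs_if_nonneg, of i]
      by (auto simp: local twist_def split: if_splits)
    done
  have bad0: "fst (hd (rotate i xs)) = nxt (rotate i xs) \<Longrightarrow> (snd (hd (rotate i xs)) > 0) \<noteq> fst (hd (rotate i xs)) \<Longrightarrow> snd (hd (rotate i xs)) = 0"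
    if "bad Gen_b w = 0" "i < length xs" for i
    using rsum_eq_0D[OF that(1)[unfolded w_def bad_b_W] _ that(2)] by (auto split: if_splits)
  show "turns w + same Gen_a w = cnt Gen_a w" if 0: "bad Gen_b w = 0"
    unfolding w_def turns_W same_a_W cnt_a_W rsum_add[symmetric]
    apply (rule rsum_cong)
    subgoal for i using bad0[OF 0, of i] by auto
    done
  show "adj Gen_a w' = 0" if 0: "bad Gen_b w = 0"
  proof -
    have "adj Gen_a w' = rsum (\<lambda>_. 0) xs"
      unfolding w'_def adj_a_W rsum_shift
      apply (rule rsum_cong)
      subgoal for i using bad0[OF 0, of i] red[of i] by (auto simp: local twist_def split: if_splits)
      done
    then show ?thesis by (simp add: rsum_def)
  qed
  show "bad Gen_b w' = 0" if 0: "adj Gen_b w = 0"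
  proof -
    have "snd (hd (rotate i xs)) \<noteq> 0 \<Longrightarrow> \<bar>snd (hd (rotate i xs))\<bar> = 1" if "i < length xs" for i
      using rsum_eq_0D[OF 0[unfolded w_def adj_b_W] _ that] by (auto split: if_splits)
    note small = this
    have "bad Gen_b w' = rsum (\<lambda>_. 0) xs"
      unfolding w'_def bad_b_W rsum_shift
      apply (rule rsum_cong)
      subgoal for i using small[of i] by (auto simp: local twist_def split: if_splits)
      done
    then show ?thesis by (simp add: rsum_def)
  qed
  show "bad Gen_b w = 0" if 0: "same Gen_a w = 0"
  proof -
    have "bad Gen_b w = rsum (\<lambda>_. 0) xs"
      unfolding w_def bad_b_W
      apply (rule rsum_cong)
      subgoal for i using rsum_eq_0D[OF 0[unfolded w_def same_a_W], of i] by auto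
      done
    then show ?thesis by (simp add: rsum_def)
  qed
qed


section \<open>One step of the positive monoid\<close>

text \<open>Collects what later arguments use about one twist, with \<open>x = Gen_a\<close> for
  \<open>sig\<close> and \<open>x = Gen_b\<close> for \<open>tau\<close>; blocks do not appear again
  once \<open>ex_sig_step\<close> is proved. The formulation by generators makes it transportable
  along \<open>swap\<close>.\<close>

definition twist_step :: "basis \<Rightarrow> word \<Rightarrow> word \<Rightarrow> bool" where
  "twist_step x w w' \<longleftrightarrow> (let y = flip_basis x in
     cyc_reduced w' \<and> cnt x w' = cnt x w \<and> same x w' = same x w \<and>
     (bad y w > 0 \<longrightarrow> bad y w' < bad y w) \<and> (bad y w = 0 \<longrightarrow> bad y w' = 0) \<and>
     bad x w' \<le> bad x w \<and> turns w' \<le> turns w \<and>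
     (bad y w' = 0 \<longrightarrow> cnt y w' + turns w = cnt y w + turns w' + same x w) \<and>
     (bad y w = 0 \<longrightarrow> turns w + same x w = cnt x w) \<and>
     (bad y w = 0 \<longrightarrow> adj x w' = 0) \<and> (adj y w = 0 \<longrightarrow> bad y w' = 0) \<and>
     (same x w = 0 \<longrightarrow> bad y w = 0 \<and> word_conj w w'))"

lemma twist_stepD:
  assumes "twist_step x w w'"
  shows "cyc_reduced w'" "cnt x w' = cnt x w" "same x w' = same x w"
    and "bad (flip_basis x) w > 0 \<Longrightarrow> bad (flip_basis x) w' < bad (flip_basis x) w"
    and "bad (flip_basis x) w = 0 \<Longrightarrow> bad (flip_basis x) w' = 0"
    and "bad x w' \<le> bad x w" "turns w' \<le> turns w"
    and "bad (flip_basis x) w' = 0 \<Longrightarrow> cnt (flip_basis x) w' = cnt (flip_basis x) w + turns w' + same x w - turns w"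
    and "bad (flip_basis x) w = 0 \<Longrightarrow> turns w + same x w = cnt x w"
    and "bad (flip_basis x) w = 0 \<Longrightarrow> adj x w' = 0"
    and "adj (flip_basis x) w = 0 \<Longrightarrow> bad (flip_basis x) w' = 0"
    and "same x w = 0 \<Longrightarrow> bad (flip_basis x) w = 0"
    and "same x w = 0 \<Longrightarrow> word_conj w w'"
  using assms unfolding twist_step_def Let_def by auto

lemma twist_step_swap: "twist_step (flip_basis x) (swap w) (swap w') \<Longrightarrow> twist_step x w w'"
  unfolding twist_step_def Let_def swap_stats flip_basis_simps cyc_reduced_swap
  using word_conj_swap[of "swap w" "swap w'"] by simp

lemma ex_sig_step:
  assumes "cyc_reduced w"
  shows "\<exists>w'. word_conj (sig w) w' \<and> twist_step Gen_a w w'"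
proof (cases rule: cyc_reduced_cases[OF assms])
  case (1 n s)
  have r1: "rotate1 (replicate k l) = replicate k l" for k and l :: letter
    by (cases k) (simp_all add: replicate_append_same)
  have r: "rotate i (replicate k l) = replicate k l" for i k and l :: letter
    by (induction i) (simp_all add: r1)
  have "cnt Gen_a w = 0" "same Gen_a w = 0" "bad Gen_a w = 0" "bad Gen_b w = 0" "turns w = 0" "adj Gen_a w = 0"
    unfolding cnt_def same_def bad_def turns_def adj_def
    by (cases n; simp add: 1 rsum_def r r1 del: rotate1.simps replicate_Suc; simp)+
  moreover have "sig w = w" unfolding 1 by simp
  ultimately show ?thesis using assms by (intro exI[of _ w]) (simp add: twist_step_def)
next
  case (2 k xs)
  have st: "cnt x w = cnt x (W xs)" "same x w = same x (W xs)" "bad x w = bad x (W xs)"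
    "adj x w = adj x (W xs)" "turns w = turns (W xs)" for x
    unfolding 2(2)[symmetric] by (simp_all add: cnt_def same_def bad_def adj_def turns_def)
  have c: "word_conj w (W xs)" using word_conj_rotate'[of w k] 2(2) by simp
  have red: "cancels (W xs) = 0"
    using assms cyc_reduced_rotate[of k w] 2(2) by (simp add: cyc_reduced_iff_cancels)
  have "word_conj (sig w) (W (shift xs))"
    using word_conj_trans[OF word_conj_sig[OF c] sig_W] .
  moreover have "word_conj w (W (shift xs))" if "same Gen_a (W xs) = 0"
    using same_a_0_shift[OF that] c by simp
  ultimately show ?thesis
    using sig_step_W[OF 2(1) red]
    by (intro exI[of _ "W (shift xs)"]) (auto simp: twist_step_def st cyc_reduced_iff_cancels)
qed

lemma ex_tau_step:
  assumes "cyc_reduced w"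
  shows "\<exists>w'. word_conj (tau w) w' \<and> twist_step Gen_b w w'"
proof -
  obtain v where v: "word_conj (sig (swap w)) v" "twist_step Gen_a (swap w) v"
    using ex_sig_step[of "swap w"] assms by auto
  have "word_conj (tau w) (swap v)"
    using word_conj_swap[OF v(1)] by (simp add: tau_def)
  moreover have "twist_step Gen_b w (swap v)" using twist_step_swap[of Gen_b w "swap v"] v(2) by simp
  ultimately show ?thesis by blast
qed

lemma rsum_of_bool_le: "rsum (\<lambda>w. of_bool (P w)) w \<le> int (length w)"
proof -
  have "rsum (\<lambda>w. of_bool (P w)) w \<le> rsum (\<lambda>_. 1) w" by (rule rsum_mono) simp
  then show ?thesis by (simp add: rsum_one)
qed

lemma clen_eq_0_iff: "clen w = 0 \<longleftrightarrow> reduce w = []"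
proof
  assume "reduce w = []"
  then have "clen w = clen []" by (intro clen_cong word_conj_reduce_eq) simp
  then show "clen w = 0" by (simp add: clen_cyc_reduced cyc_reduced_def)
qed (use clen_pos[of w] in auto)

lemma clen_subst_eq_0: "clen w = 0 \<Longrightarrow> clen (subst s w) = 0"
  unfolding clen_eq_0_iff by (metis reduce_Nil reduce_subst_cong subst_simps(1))

lemma clen_sig_eq_0_iff [simp]: "clen (sig w) = 0 \<longleftrightarrow> clen w = 0"
proof
  assume "clen (sig w) = 0"
  then have "clen (sig (iota (sig w))) = 0" by (simp add: sig_def clen_subst_eq_0)
  then show "clen w = 0" using clen_cong[OF sig_iota_sig[of w]] by simp
qed (simp add: sig_def clen_subst_eq_0)

lemma clen_tau_eq_0_iff [simp]: "clen (tau w) = 0 \<longleftrightarrow> clen w = 0"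
  by (simp add: tau_def)

section \<open>Elliptic words\<close>

definition elliptic :: "word \<Rightarrow> bool" where
  "elliptic w \<longleftrightarrow> word_conj (sig w) w"

lemma elliptic_cong: "word_conj u v \<Longrightarrow> elliptic u = elliptic v"
  unfolding elliptic_def by (meson word_conj_sig word_conj_sym word_conj_trans)

lemma elliptic_funpow: "elliptic w \<Longrightarrow> word_conj ((sig ^^ n) w) w"
proof (induction n)
  case (Suc n)
  then show ?case using word_conj_trans[OF word_conj_sig[OF Suc.IH]] by (simp add: elliptic_def)
qed simp

text \<open>Without opposed runs of b, each \<open>sig\<close> raises
  \<open>cnt Gen_b - turns\<close> by exactly the invariant \<open>same Gen_a\<close>.\<close>

lemma funpow_sig_length:
  assumes "cyc_reduced w" "bad Gen_b w = 0"
  shows "int n * same Gen_a w + cnt Gen_b w - turns w \<le> int (clen ((sig ^^ n) w))"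
  using assms
proof (induction n arbitrary: w)
  case 0
  then show ?case using length_eq_cnt[of w] stats_nonneg(1)[of Gen_a w] stats_nonneg(2)[of w]
    by (simp add: clen_cyc_reduced)
next
  case (Suc n)
  obtain w' where w': "word_conj (sig w) w'" "twist_step Gen_a w w'"
    using ex_sig_step[OF Suc.prems(1)] by blast
  have "word_conj ((sig ^^ n) u) ((sig ^^ n) v)" if "word_conj u v" for u v
    using that by (induction n) (auto intro: word_conj_sig)
  then have "clen ((sig ^^ Suc n) w) = clen ((sig ^^ n) w')"
    using w'(1) by (simp only: funpow_Suc_right comp_apply) (rule clen_cong, blast)
  moreover have "cyc_reduced w'" "bad Gen_b w' = 0" "same Gen_a w' = same Gen_a w"
    "cnt Gen_b w' = cnt Gen_b w + turns w' + same Gen_a w - turns w"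
    using twist_stepD[OF w'(2)] Suc.prems(2) by simp_all
  ultimately show ?case using Suc.IH[of w'] by (simp add: algebra_simps)
qed

lemma funpow_sig_cong: "word_conj u v \<Longrightarrow> word_conj ((sig ^^ n) u) ((sig ^^ n) v)"
  by (induction n) (auto intro: word_conj_sig)

text \<open>While opposed runs exist, each step lowers \<open>bad Gen_b\<close>, which pays for the
  waiting time; afterwards the growth is linear with slope at least one, and \<open>turns\<close>
  pays for the initial deficit.\<close>

lemma funpow_sig_length_ge:
  assumes "cyc_reduced w" "same Gen_a w > 0"
  shows "int n \<le> int (clen ((sig ^^ n) w)) + turns w + bad Gen_b w"
  using assms
proof (induction n arbitrary: w)
  case 0
  then show ?case using stats_nonneg(4)[of Gen_b w] stats_nonneg(2)[of w] by simp
next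
  case (Suc n)
  show ?case
  proof (cases "bad Gen_b w = 0")
    case True
    define k where "k = int (Suc n)"
    have "k * 1 \<le> k * same Gen_a w"
      using Suc.prems(2) by (intro mult_left_mono) (auto simp: k_def)
    then show ?thesis
      using funpow_sig_length[OF Suc.prems(1) True, of "Suc n"] stats_nonneg(1)[of Gen_b w] True
      unfolding k_def[symmetric] by linarith
  next
    case False
    then have pos: "bad Gen_b w > 0" using stats_nonneg(4)[of Gen_b w] by simp
    obtain w' where w': "word_conj (sig w) w'" "twist_step Gen_a w w'"
      using ex_sig_step[OF Suc.prems(1)] by blast
    have "clen ((sig ^^ Suc n) w) = clen ((sig ^^ n) w')"
      using funpow_sig_cong[OF w'(1), of n] by (simp only: funpow_Suc_right comp_apply clen_cong)
    then show ?thesis using Suc.IH[of w'] w'(2) Suc.prems(2) pos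
      by (simp add: twist_step_def del: funpow.simps)
  qed
qed

text \<open>Iterates of constant length exclude a positive slope; conversely, with alternating signs
  no exponent changes.\<close>

lemma elliptic_iff_same:
  assumes "cyc_reduced w" shows "elliptic w \<longleftrightarrow> same Gen_a w = 0"
proof
  assume ell: "elliptic w"
  define n where "n = Suc (clen w + nat (turns w) + nat (bad Gen_b w))"
  have "\<not> same Gen_a w > 0"
    using funpow_sig_length_ge[OF assms, of n] clen_cong[OF elliptic_funpow[OF ell, of n]]
      stats_nonneg(4)[of Gen_b w] stats_nonneg(2)[of w] by (auto simp: n_def)
  then show "same Gen_a w = 0" using stats_nonneg(3)[of Gen_a w] by simp
next
  assume "same Gen_a w = 0"
  then show "elliptic w" using ex_sig_step[OF assms]
    unfolding elliptic_def twist_step_def Let_def by (meson word_conj_sym word_conj_trans)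
qed

lemma elliptic_swap_iff_same:
  "cyc_reduced w \<Longrightarrow> elliptic (swap w) \<longleftrightarrow> same Gen_b w = 0"
  using elliptic_iff_same[of "swap w"] by (simp add: swap_stats)

text \<open>Of the three multiples of \<open>clen w\<close>, one bounds the length of the iterate,
  one \<open>turns\<close> and one \<open>bad Gen_b\<close>; one more iteration contradicts
  \<open>funpow_sig_length_ge\<close>.\<close>

lemma elliptic_test: "elliptic w \<longleftrightarrow> clen ((sig ^^ Suc (3 * clen w)) w) \<le> clen w"
proof
  assume le: "clen ((sig ^^ Suc (3 * clen w)) w) \<le> clen w"
  obtain c where c: "cyc_reduced c" "word_conj w c" using ex_cyc_reduced_word_conj by blast
  have len: "length c = clen w" using clen_eqI[OF c] by simp
  have "turns c \<le> int (length c)" "bad Gen_b c \<le> int (length c)"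
    unfolding turns_def bad_def by (rule rsum_of_bool_le)+
  then have "\<not> same Gen_a c > 0"
    using funpow_sig_length_ge[OF c(1), of "Suc (3 * clen w)"] le len
      clen_cong[OF funpow_sig_cong[OF c(2), of "Suc (3 * clen w)"]] by auto
  then have "elliptic c" using elliptic_iff_same[OF c(1)] stats_nonneg(3)[of Gen_a c] by simp
  then show "elliptic w" using elliptic_cong[OF c(2)] by simp
next
  assume "elliptic w"
  then show "clen ((sig ^^ Suc (3 * clen w)) w) \<le> clen w"
    using clen_cong[OF elliptic_funpow[of w "Suc (3 * clen w)"]] by simp
qed

section \<open>Length growth along the positive monoid\<close>

text \<open>\<open>True\<close> stands for \<open>sig\<close> and \<open>False\<close> for \<open>tau\<close>; the head of the list is applied first.\<close>

fun mapp :: "bool list \<Rightarrow> word \<Rightarrow> word" where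
  "mapp [] w = w"
| "mapp (s # m) w = mapp m (if s then sig w else tau w)"

lemma mapp_append: "mapp (m @ m') w = mapp m' (mapp m w)"
  by (induction m arbitrary: w) auto

lemma word_conj_mapp: "word_conj u v \<Longrightarrow> word_conj (mapp m u) (mapp m v)"
  by (induction m arbitrary: u v) (auto intro: word_conj_sig word_conj_tau)

lemma swap_mapp: "swap (mapp m w) = mapp (map Not m) (swap w)"
  by (induction m arbitrary: w) auto

lemma mapp_replicate_True: "mapp (replicate n True) w = (sig ^^ n) w"
  by (induction n arbitrary: w) (simp_all del: funpow.simps add: funpow_Suc_right)

lemma clen_mapp_eq_0_iff [simp]: "clen (mapp m w) = 0 \<longleftrightarrow> clen w = 0"
  by (induction m arbitrary: w) auto

text \<open>\<open>growth m\<close> consists of the lengths of the positive words \<open>mapp m [La]\<close> and \<open>mapp m [Lb]\<close>.\<close>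

fun growth :: "bool list \<Rightarrow> int \<times> int" where
  "growth [] = (1, 1)"
| "growth (s # m) = (let (p, q) = growth m in if s then (p + q, q) else (p, p + q))"

abbreviation "ga m \<equiv> fst (growth m)"
abbreviation "gb m \<equiv> snd (growth m)"

lemma growth_simps [simp]:
  "ga (True # m) = ga m + gb m" "gb (True # m) = gb m"
  "ga (False # m) = ga m" "gb (False # m) = ga m + gb m"
  by (simp_all add: split_beta)

declare growth.simps(2) [simp del]

lemma growth_pos: "ga m \<ge> 1" "gb m \<ge> 1"
proof -
  have "ga m \<ge> 1 \<and> gb m \<ge> 1"
  proof (induction m)
    case (Cons s m)
    then show ?case by (cases s) auto
  qed simp
  then show "ga m \<ge> 1" "gb m \<ge> 1" by auto
qed

lemma growth_replicate: "ga (replicate n True @ m) = ga m + int n * gb m" "gb (replicate n True @ m) = gb m"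
  by (induction n) (auto simp: algebra_simps)

definition occ :: "basis \<Rightarrow> word \<Rightarrow> int" where
  "occ x w = int (length (filter (\<lambda>l. fst l = x) w))"

lemma occ_nonneg: "0 \<le> occ x w" by (simp add: occ_def)

lemma occ_length: "int (length w) = occ Gen_a w + occ Gen_b w"
  unfolding occ_def by (induction w) (auto, metis basis.exhaust)

lemma occ_swap: "occ x (swap w) = occ (flip_basis x) w"
  unfolding occ_def swap_def by (induction w) auto

lemma occ_sig: "occ Gen_a (sig w) = occ Gen_a w" "occ Gen_b (sig w) = occ Gen_a w + occ Gen_b w"
proof -
  have "occ Gen_a (sig w) = occ Gen_a w \<and> occ Gen_b (sig w) = occ Gen_a w + occ Gen_b w"
  proof (induction w)
    case (Cons l w)
    obtain x p where l: "l = (x, p)" by (cases l)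
    show ?case using Cons unfolding l by (cases x; cases p) (auto simp: sig_def occ_def)
  qed (simp add: sig_def occ_def)
  then show "occ Gen_a (sig w) = occ Gen_a w" "occ Gen_b (sig w) = occ Gen_a w + occ Gen_b w" by auto
qed

text \<open>Counts the letters of the image before any cancellation.\<close>

lemma clen_mapp_le: "int (clen (mapp m w)) \<le> occ Gen_a w * ga m + occ Gen_b w * gb m"
proof (induction m arbitrary: w)
  case Nil
  then show ?case using clen_le_length[of w] occ_length[of w] by simp
next
  case (Cons s m)
  show ?case
  proof (cases s)
    case True
    then show ?thesis using Cons[of "sig w"] by (simp add: occ_sig algebra_simps)
  next
    case False
    have "occ Gen_a (tau w) = occ Gen_a w + occ Gen_b w" "occ Gen_b (tau w) = occ Gen_b w"
      by (simp_all add: tau_def occ_swap occ_sig)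
    then show ?thesis using False Cons[of "tau w"] by (simp add: algebra_simps)
  qed
qed

lemma clen_mapp_le_sum: "int (clen (mapp m w)) \<le> int (length w) * (ga m + gb m)"
proof -
  have "occ Gen_a w * ga m \<le> occ Gen_a w * (ga m + gb m)" "occ Gen_b w * gb m \<le> occ Gen_b w * (ga m + gb m)"
    using growth_pos[of m] by (intro mult_left_mono; simp add: occ_nonneg)+
  then show ?thesis using clen_mapp_le[of m w] by (simp add: occ_length algebra_simps)
qed

text \<open>Without bad letters \<open>sig\<close> sends the pair (A, B) of the numbers
  \<open>cnt - turns\<close> to (A, A + B), and \<open>tau\<close> sends it to (A + B, B). The
  weights in \<open>growth\<close> obey the transposed recursion, so the weighted sum is carried
  along unchanged.\<close>

lemma stable_clen_ge:
  assumes "cyc_reduced w" "bad Gen_a w = 0" "bad Gen_b w = 0"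
  shows "(cnt Gen_a w - turns w) * ga m + (cnt Gen_b w - turns w) * gb m \<le> int (clen (mapp m w))"
  using assms
proof (induction m arbitrary: w)
  case Nil
  then show ?case using length_eq_cnt[of w] stats_nonneg(2)[of w] by (simp add: clen_cyc_reduced)
next
  case (Cons s m)
  have nn: "bad Gen_a v \<ge> 0" "bad Gen_b v \<ge> 0" for v by (rule stats_nonneg)+
  obtain v where v: "word_conj (if s then sig w else tau w) v" "twist_step (if s then Gen_a else Gen_b) w v"
    using ex_sig_step[OF Cons.prems(1)] ex_tau_step[OF Cons.prems(1)] by (cases s) auto
  have red: "cyc_reduced v" and bad: "bad Gen_a v = 0" "bad Gen_b v = 0"
    using v(2) Cons.prems nn[of v] by (cases s; simp add: twist_step_def Let_def)+
  \<comment> \<open>A further twist, taken only to have the relation between \<open>turns\<close>,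
    \<open>same\<close> and \<open>cnt\<close> for \<open>v\<close> as well as for \<open>w\<close>;
    comparing the two shows that \<open>turns\<close> is constant.\<close>
  obtain v' where v': "twist_step (if s then Gen_a else Gen_b) v v'"
    using ex_sig_step[OF red] ex_tau_step[OF red] by (cases s) auto
  have "clen (mapp (s # m) w) = clen (mapp m v)"
    using clen_cong[OF word_conj_mapp[OF v(1), of m]] by simp
  moreover have t: "turns v = turns w"
    using twist_stepD[OF v(2)] twist_stepD[OF v'] Cons.prems bad by (cases s) auto
  moreover have "cnt (if s then Gen_a else Gen_b) v = cnt (if s then Gen_a else Gen_b) w"
    "cnt (if s then Gen_b else Gen_a) v = cnt Gen_a w + cnt Gen_b w - turns w"
    using t twist_stepD[OF v(2)] twist_stepD[OF v'] Cons.prems bad by (cases s; simp)+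
  ultimately have "(if s then (cnt Gen_a w - turns w) * ga m + (cnt Gen_a w + cnt Gen_b w - turns w - turns w) * gb m
      else (cnt Gen_a w + cnt Gen_b w - turns w - turns w) * ga m + (cnt Gen_b w - turns w) * gb m)
      \<le> int (clen (mapp (s # m) w))"
    using Cons.IH[OF red bad] by (cases s) simp_all
  then show ?case by (cases s) (simp_all add: algebra_simps)
qed

lemma elliptic_mapp_True: "elliptic w \<Longrightarrow> clen (mapp (True # m) w) = clen (mapp m w)"
  using clen_cong[OF word_conj_mapp, of "sig w" w] by (simp add: elliptic_def)

text \<open>Leading occurrences of \<open>sig\<close> do nothing, and from the first
  \<open>tau\<close> on the weight of a is at most that of b.\<close>

lemma elliptic_clen_le:
  assumes "elliptic w" shows "int (clen (mapp m w)) \<le> int (length w) * gb m"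
proof (induction m)
  case Nil
  show ?case using clen_le_length[of w] by simp
next
  case (Cons s m)
  show ?case
  proof (cases s)
    case True
    then show ?thesis using Cons elliptic_mapp_True[OF assms, of m] by simp
  next
    case False
    have "occ Gen_a w * ga (False # m) \<le> occ Gen_a w * gb (False # m)"
      using growth_pos[of m] by (intro mult_left_mono) (auto simp: occ_nonneg)
    then show ?thesis using clen_mapp_le[of "False # m" w] False
      by (simp add: occ_length algebra_simps)
  qed
qed

text \<open>Leading occurrences of \<open>sig\<close> do nothing. After the first \<open>tau\<close>
  there is a representative without bad letters, both of whose coefficients equal the positive
  number \<open>same Gen_b\<close>.\<close>

lemma elliptic_clen_ge:
  assumes "elliptic w" "\<not> elliptic (swap w)"
  shows "gb m \<le> int (clen (mapp m w))"
proof (induction m)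
  case Nil
  have "clen w \<noteq> 0"
  proof
    assume "clen w = 0"
    then have "word_conj (swap w) []" using clen_eq_0_iff[of "swap w"] by (simp add: word_conj_reduce_eq)
    then show False using elliptic_cong[of "swap w" "[]"] assms(2) by (simp add: elliptic_def sig_def)
  qed
  then show ?case by simp
next
  case (Cons s m)
  show ?case
  proof (cases s)
    case True
    then show ?thesis using Cons elliptic_mapp_True[OF assms(1), of m] by simp
  next
    case False
    obtain c where c: "cyc_reduced c" "word_conj w c" using ex_cyc_reduced_word_conj by blast
    have same_c: "same Gen_a c = 0" using elliptic_iff_same[OF c(1)] elliptic_cong[OF c(2)] assms(1) by simp
    \<comment> \<open>An extra \<open>sig\<close> leaves the conjugacy class of an elliptic word
      alone, but yields a representative for which \<open>adj Gen_a\<close> is zero, so that the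
      following \<open>tau\<close> leaves no bad letters.\<close>
    obtain d where d: "twist_step Gen_a c d" using ex_sig_step[OF c(1)] by blast
    note D = twist_stepD[OF d, simplified]
    obtain d' where d': "twist_step Gen_a d d'" using ex_sig_step[OF D(1)] by blast
    obtain e where e: "word_conj (tau d) e" "twist_step Gen_b d e"
      using ex_tau_step[OF D(1)] by blast
    note E = twist_stepD[OF e(2), simplified]
    obtain e' where e': "twist_step Gen_b e e'" using ex_tau_step[OF E(1)] by blast
    note D' = twist_stepD[OF d', simplified] and E' = twist_stepD[OF e', simplified]
    have wd: "word_conj w d" using word_conj_trans[OF c(2)] D(13) same_c by simp
    have badc: "bad Gen_b c = 0" using D(12) same_c by simp
    have nn: "bad Gen_a v \<ge> 0" "bad Gen_b v \<ge> 0" "same Gen_b v \<ge> 0" for v by (rule stats_nonneg)+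
    have same_d: "same Gen_b d \<noteq> 0"
      using elliptic_swap_iff_same[OF D(1)] elliptic_cong[OF word_conj_swap[OF wd]] assms(2) by simp
    have bad_e: "bad Gen_a e = 0" "bad Gen_b e = 0"
      using D(5,10) E(6,11) badc nn[of e] by auto
    have "cnt Gen_b e - turns e = same Gen_b d" using E'(9) E(3) bad_e by simp
    moreover have "cnt Gen_a e - turns e = same Gen_b d"
      using E(8) bad_e D'(9) D(3,5) badc same_c by simp
    moreover have "clen (mapp (False # m) w) = clen (mapp m e)"
      using clen_cong[OF word_conj_mapp[OF word_conj_trans[OF word_conj_tau[OF wd] e(1)], of m]] by simp
    ultimately have "same Gen_b d * (ga m + gb m) \<le> int (clen (mapp (False # m) w))"
      using stable_clen_ge[OF E(1) bad_e, of m] by (simp add: algebra_simps)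
    moreover have "1 * (ga m + gb m) \<le> same Gen_b d * (ga m + gb m)"
      using same_d nn(3)[of d] growth_pos[of m] by (intro mult_right_mono) auto
    ultimately show ?thesis using False by simp
  qed
qed


section \<open>Comparison of lengths along the positive monoid\<close>

text \<open>\<open>elliptic (swap w)\<close> expresses that \<open>tau w\<close> is conjugate to
  \<open>w\<close>, so both twists are covered.\<close>

definition elliptic_le :: "word \<Rightarrow> word \<Rightarrow> bool" where
  "elliptic_le v u \<longleftrightarrow> (\<forall>m. (elliptic (mapp m v) \<longrightarrow> elliptic (mapp m u)) \<and>
     (elliptic (swap (mapp m v)) \<longrightarrow> elliptic (swap (mapp m u))))"

definition length_bounded :: "word \<Rightarrow> word \<Rightarrow> bool" where
  "length_bounded u v \<longleftrightarrow> (\<exists>C. \<forall>m. int (clen (mapp m u)) \<le> C * int (clen (mapp m v)))"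

lemma length_boundedI:
  "(\<And>m. int (clen (mapp m u)) \<le> C * int (clen (mapp m v))) \<Longrightarrow> length_bounded u v"
  by (auto simp: length_bounded_def)

lemma elliptic_le_mapp: "elliptic_le v u \<Longrightarrow> elliptic_le (mapp m v) (mapp m u)"
  unfolding elliptic_le_def by (metis mapp_append)

lemma elliptic_le_cong:
  assumes "word_conj v v'" "elliptic_le v u" shows "elliptic_le v' u"
  using assms(2) elliptic_cong[OF word_conj_mapp[OF assms(1)]]
    elliptic_cong[OF word_conj_swap[OF word_conj_mapp[OF assms(1)]]]
  by (simp add: elliptic_le_def)

lemma map_Not_Not [simp]: "map Not (map Not m) = m"
  by (simp add: comp_def)

lemma elliptic_le_swap: "elliptic_le v u \<Longrightarrow> elliptic_le (swap v) (swap u)"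
  unfolding elliptic_le_def by (metis map_Not_Not swap_mapp swap_swap)

lemma length_bounded_swap: "length_bounded (swap u) (swap v) \<Longrightarrow> length_bounded u v"
  unfolding length_bounded_def by (metis clen_swap swap_mapp)

lemma length_bounded_cong:
  assumes "word_conj v v'" "length_bounded u v'" shows "length_bounded u v"
  using assms(2) clen_cong[OF word_conj_mapp[OF assms(1)]] by (simp add: length_bounded_def)

lemma elliptic_both_mapp:
  assumes "elliptic w" "elliptic (swap w)" shows "word_conj (mapp m w) w"
proof (induction m)
  case (Cons s m)
  have "word_conj (tau w) w"
    using word_conj_swap[of "sig (swap w)" "swap w"] assms(2) by (simp add: elliptic_def tau_def)
  then have "word_conj (if s then sig w else tau w) w" using assms(1) by (simp add: elliptic_def)
  then show ?case using word_conj_trans[OF word_conj_mapp Cons] by simp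
qed simp

text \<open>If \<open>v\<close> is fixed by both twists, so is \<open>u\<close> and the lengths are
  constant; otherwise \<open>gb m\<close> bounds the length of \<open>v\<close> from below and, up
  to a factor, that of \<open>u\<close> from above.\<close>

lemma length_bounded_elliptic:
  assumes "elliptic_le v u" "elliptic v" "clen v > 0"
  shows "length_bounded u v"
proof (rule length_boundedI)
  fix m
  have u: "elliptic u" using assms(1,2) unfolding elliptic_le_def by (metis mapp.simps(1))
  have pos: "int (clen (mapp m v)) \<ge> 1" using assms(3) clen_mapp_eq_0_iff[of m v] by linarith
  show "int (clen (mapp m u)) \<le> int (length u) * int (clen (mapp m v))"
  proof (cases "elliptic (swap v)")
    case True
    then have "elliptic (swap u)" using assms(1) unfolding elliptic_le_def by (metis mapp.simps(1))
    then have "clen (mapp m u) = clen u" using clen_cong[OF elliptic_both_mapp] u by simp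
    moreover have "int (length u) * 1 \<le> int (length u) * int (clen (mapp m v))"
      using pos by (intro mult_left_mono) auto
    ultimately show ?thesis using clen_le_length[of u] by simp
  next
    case False
    have "int (length u) * gb m \<le> int (length u) * int (clen (mapp m v))"
      using elliptic_clen_ge[OF assms(2) False, of m] by (intro mult_left_mono) auto
    then show ?thesis using elliptic_clen_le[OF u, of m] by linarith
  qed
qed

lemma length_bounded_stable:
  assumes "cyc_reduced v" "bad Gen_a v = 0" "bad Gen_b v = 0" "same Gen_a v > 0" "same Gen_b v > 0"
  shows "length_bounded u v"
proof (rule length_boundedI)
  fix m
  obtain v' v'' where "twist_step Gen_a v v'" "twist_step Gen_b v v''"
    using ex_sig_step[OF assms(1)] ex_tau_step[OF assms(1)] by blast
  then have eq: "cnt Gen_a v - turns v = same Gen_a v" "cnt Gen_b v - turns v = same Gen_b v"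
    using twist_stepD(9)[of Gen_a v v'] twist_stepD(9)[of Gen_b v v''] assms by auto
  have "1 * ga m \<le> same Gen_a v * ga m" "1 * gb m \<le> same Gen_b v * gb m"
    using assms(4,5) growth_pos[of m] by (intro mult_right_mono; simp)+
  then have "ga m + gb m \<le> int (clen (mapp m v))"
    using stable_clen_ge[OF assms(1-3), of m] unfolding eq by linarith
  then have "int (length u) * (ga m + gb m) \<le> int (length u) * int (clen (mapp m v))"
    by (intro mult_left_mono) auto
  then show "int (clen (mapp m u)) \<le> int (length u) * int (clen (mapp m v))"
    using clen_mapp_le_sum[of m u] by linarith
qed

lemma mapp_replicate_Cons: "mapp (replicate n True @ False # m) w = mapp m (tau ((sig ^^ n) w))"
  by (simp add: mapp_append mapp_replicate_True)

lemma bool_list_cases: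
  obtains n where "m = replicate n True" | n m' where "m = replicate n True @ False # m'"
proof (induction m arbitrary: thesis)
  case Nil
  then show ?case by (metis replicate_0)
next
  case (Cons s m)
  show ?case
  proof (cases s)
    case True
    show ?thesis
    proof (rule Cons.IH)
      fix n assume "m = replicate n True"
      then show thesis using Cons.prems(1)[of "Suc n"] True by simp
    next
      fix n m' assume "m = replicate n True @ False # m'"
      then show thesis using Cons.prems(2)[of "Suc n" m'] True by simp
    qed
  next
    case False
    then show ?thesis using Cons.prems(2)[of 0 m] by simp
  qed
qed

lemma sig_iterate:
  assumes "cyc_reduced v" "bad Gen_b v = 0"
  shows "\<exists>w. word_conj ((sig ^^ n) v) w \<and> cyc_reduced w \<and> bad Gen_b w = 0 \<and>
    bad Gen_a w \<le> bad Gen_a v \<and> turns w \<le> turns v \<and>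
    cnt Gen_b w - turns w = cnt Gen_b v - turns v + int n * same Gen_a v \<and>
    same Gen_a w = same Gen_a v \<and> (n > 0 \<longrightarrow> adj Gen_a w = 0)"
proof (induction n)
  case 0
  show ?case using assms by (intro exI[of _ v]) simp
next
  case (Suc n)
  then obtain w where w: "word_conj ((sig ^^ n) v) w" "cyc_reduced w" "bad Gen_b w = 0"
    "bad Gen_a w \<le> bad Gen_a v" "turns w \<le> turns v"
    "cnt Gen_b w - turns w = cnt Gen_b v - turns v + int n * same Gen_a v" "same Gen_a w = same Gen_a v"
    by blast
  obtain w' where w': "word_conj (sig w) w'" "twist_step Gen_a w w'" using ex_sig_step[OF w(2)] by blast
  note D = twist_stepD[OF w'(2), simplified]
  have "word_conj ((sig ^^ Suc n) v) w'"
    using word_conj_trans[OF word_conj_sig[OF w(1)] w'(1)] by simp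
  moreover have "cnt Gen_b w' - turns w' = cnt Gen_b v - turns v + int (Suc n) * same Gen_a v"
    using D(8) D(5) w by (simp add: algebra_simps)
  ultimately show ?case using D w by (intro exI[of _ w']) auto
qed

text \<open>One \<open>sig\<close> already puts a letter of type b between consecutive letters of
  type a. Runs of a then have length one, and a single \<open>tau\<close> removes or reverses every
  opposed one.\<close>

lemma tau_sig_iterate:
  assumes "cyc_reduced v" "bad Gen_b v = 0" "n > 0"
  shows "\<exists>z. word_conj (tau ((sig ^^ n) v)) z \<and> cyc_reduced z \<and> bad Gen_a z = 0 \<and> bad Gen_b z = 0 \<and>
    cnt Gen_b v - turns v + int n * same Gen_a v \<le> cnt Gen_a z - turns z \<and>
    cnt Gen_b v - turns v + int n * same Gen_a v \<le> cnt Gen_b z - turns z"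
proof -
  obtain w where w: "word_conj ((sig ^^ n) v) w" "cyc_reduced w" "bad Gen_b w = 0"
    "bad Gen_a w \<le> bad Gen_a v" "turns w \<le> turns v"
    "cnt Gen_b w - turns w = cnt Gen_b v - turns v + int n * same Gen_a v" "same Gen_a w = same Gen_a v"
    "adj Gen_a w = 0"
    using sig_iterate[OF assms(1,2), of n] assms(3) by blast
  obtain w' where w': "twist_step Gen_a w w'" using ex_sig_step[OF w(2)] by blast
  obtain z where z: "word_conj (tau w) z" "twist_step Gen_b w z" using ex_tau_step[OF w(2)] by blast
  note Z = twist_stepD[OF z(2), simplified]
  obtain z' where z': "twist_step Gen_b z z'" using ex_tau_step[OF Z(1)] by blast
  have bad: "bad Gen_a z = 0" "bad Gen_b z = 0"
    using Z(6,11) w stats_nonneg(4)[of Gen_b z] by auto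
  have "cnt Gen_b z - turns z \<ge> cnt Gen_b w - turns w" using Z(2,7) by simp
  moreover have "cnt Gen_a z - turns z \<ge> cnt Gen_b w - turns w"
  proof -
    have "cnt Gen_a z - turns z = same Gen_a w + same Gen_b w"
      using Z(8) bad twist_stepD(9)[OF w'] w(3) by simp
    moreover have "same Gen_b w = cnt Gen_b w - turns z"
      using twist_stepD(9)[OF z'] bad Z(2,3) by simp
    ultimately show ?thesis using Z(7) stats_nonneg(3)[of Gen_a w] by simp
  qed
  moreover have "word_conj (tau ((sig ^^ n) v)) z"
    using word_conj_trans[OF word_conj_tau[OF w(1)] z(1)] .
  ultimately show ?thesis using Z(1) bad w(6) by (intro exI[of _ z]) auto
qed

text \<open>A product is split at its first \<open>tau\<close>. The constants belonging to at most
  \<open>turns v\<close> leading occurrences of \<open>sig\<close> have a maximum; for longer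
  beginnings both lengths are of order \<open>n\<close> times \<open>ga m' + gb m'\<close>, with
  factors independent of \<open>n\<close>.\<close>

lemma length_bounded_unstable:
  assumes v: "cyc_reduced v" "bad Gen_b v = 0" "same Gen_a v > 0"
    and IH: "\<And>n. length_bounded (tau ((sig ^^ n) u)) (tau ((sig ^^ n) v))"
    and pos: "clen v > 0"
  shows "length_bounded u v"
proof -
  define T where "T = nat (turns v)"
  have T: "turns v = int T" using stats_nonneg(2)[of v] by (simp add: T_def)
  obtain C where C: "\<And>n m. int (clen (mapp m (tau ((sig ^^ n) u)))) \<le> C n * int (clen (mapp m (tau ((sig ^^ n) v))))"
    using IH unfolding length_bounded_def by metis
  define D where "D = Max ((\<lambda>n. \<bar>C n\<bar>) ` {..T})"
  have D: "C n \<le> D" if "n \<le> T" for n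
  proof -
    have "\<bar>C n\<bar> \<le> D" unfolding D_def using that by (intro Max_ge) auto
    then show ?thesis by simp
  qed
  have D0: "D \<ge> 0"
  proof -
    have "\<bar>C 0\<bar> \<le> D" unfolding D_def by (intro Max_ge) auto
    then show ?thesis by simp
  qed
  have lin: "int n - int T \<le> cnt Gen_b v - turns v + int n * same Gen_a v" for n
  proof -
    have "int n * 1 \<le> int n * same Gen_a v" using v(3) by (intro mult_left_mono) auto
    then show ?thesis using stats_nonneg(1)[of Gen_b v] T by linarith
  qed
  \<comment> \<open>The general upper bound grows like \<open>n + 2\<close>, the lower bound for
    \<open>v\<close> like \<open>n - T\<close>. The worst ratio occurs at \<open>n = T + 1\<close>
    and equals \<open>T + 3\<close>.\<close>
  have frac: "int n + 2 \<le> (int T + 3) * (int n - int T)" if "n > T" for n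
  proof -
    obtain k where k: "n = T + Suc k" using \<open>n > T\<close> less_iff_Suc_add by auto
    have "int n - int T = int k + 1" unfolding k by simp
    then show ?thesis unfolding k by (simp add: algebra_simps)
  qed
  define E where "E = D + int (length u) * (int T + 3)"
  have E0: "D \<le> E" "int (length u) * (int T + 3) \<le> E" using D0 by (auto simp: E_def)
  show ?thesis
  proof (rule length_boundedI)
    fix m
    have vpos: "int (clen (mapp m v)) \<ge> 1" using pos clen_mapp_eq_0_iff[of m v] by linarith
    have fin: "int (clen (mapp m u)) \<le> E * int (clen (mapp m v))"
      if "int (clen (mapp m u)) \<le> F * int (clen (mapp m v))" "F \<le> E" for F
      using that mult_right_mono[of F E "int (clen (mapp m v))"] by simp
    show "int (clen (mapp m u)) \<le> E * int (clen (mapp m v))"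
    proof (cases m rule: bool_list_cases)
      case (1 n)
      have gr: "ga m + gb m = int n + 2" using growth_replicate[of n "[]"] unfolding 1 by simp
      have "int n + 2 \<le> (int T + 3) * int (clen (mapp m v))"
      proof (cases "n \<le> T")
        case True
        have "(int T + 3) * 1 \<le> (int T + 3) * int (clen (mapp m v))" using vpos by (intro mult_left_mono) auto
        then show ?thesis using True unfolding mult_1_right by linarith
      next
        case False
        have "int n - int T \<le> int (clen (mapp m v))"
          using funpow_sig_length[OF v(1,2), of n] lin[of n] unfolding 1 mapp_replicate_True by linarith
        then have "(int T + 3) * (int n - int T) \<le> (int T + 3) * int (clen (mapp m v))"
          by (intro mult_left_mono) auto
        then show ?thesis using frac[of n] False by linarith
      qed
      then have "int (length u) * (int n + 2) \<le> int (length u) * ((int T + 3) * int (clen (mapp m v)))"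
        by (intro mult_left_mono) auto
      then show ?thesis using clen_mapp_le_sum[of m u] unfolding gr
        by (intro fin[OF _ E0(2)]) (simp add: mult.assoc)
    next
      case (2 n m')
      show ?thesis
      proof (cases "n \<le> T")
        case True
        have "int (clen (mapp m u)) \<le> C n * int (clen (mapp m v))"
          using C[of m' n] unfolding 2 mapp_replicate_Cons .
        then show ?thesis using D[OF True] E0(1) by (intro fin[of "C n"]) auto
      next
        case False
        then have "n > 0" by simp
        then obtain z where z: "word_conj (tau ((sig ^^ n) v)) z" "cyc_reduced z" "bad Gen_a z = 0" "bad Gen_b z = 0"
          "cnt Gen_b v - turns v + int n * same Gen_a v \<le> cnt Gen_a z - turns z"
          "cnt Gen_b v - turns v + int n * same Gen_a v \<le> cnt Gen_b z - turns z"
          using tau_sig_iterate[OF v(1,2)] by blast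
        define p q L where "p = ga m'" and "q = gb m'" and "L = int (clen (mapp m v))"
        have pq: "p \<ge> 1" "q \<ge> 1" using growth_pos[of m'] by (auto simp: p_def q_def)
        have "L = int (clen (mapp m' z))"
          using clen_cong[OF word_conj_mapp[OF z(1), of m']] unfolding L_def 2 mapp_replicate_Cons by simp
        then have "(cnt Gen_a z - turns z) * p + (cnt Gen_b z - turns z) * q \<le> L"
          using stable_clen_ge[OF z(2-4), of m'] by (simp add: p_def q_def)
        moreover have "(int n - int T) * p \<le> (cnt Gen_a z - turns z) * p" "(int n - int T) * q \<le> (cnt Gen_b z - turns z) * q"
          using z(5,6) lin[of n] pq by (intro mult_right_mono; simp)+
        ultimately have Lge: "(int n - int T) * (p + q) \<le> L" by (simp add: algebra_simps)
        have "ga m + gb m \<le> (int n + 2) * (p + q)"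
          using pq unfolding 2 growth_replicate growth_simps p_def[symmetric] q_def[symmetric] by (simp add: algebra_simps)
        also have "\<dots> \<le> ((int T + 3) * (int n - int T)) * (p + q)"
          using frac[of n] False pq by (intro mult_right_mono) auto
        also have "\<dots> = (int T + 3) * ((int n - int T) * (p + q))" by (rule mult.assoc)
        also have "\<dots> \<le> (int T + 3) * L" using Lge by (intro mult_left_mono) auto
        finally have "int (length u) * (ga m + gb m) \<le> int (length u) * ((int T + 3) * L)"
          by (intro mult_left_mono) auto
        then show ?thesis using clen_mapp_le_sum[of m u]
          by (intro fin[OF _ E0(2)]) (simp add: mult.assoc L_def)
      qed
    qed
  qed
qed

lemma length_bounded_Cons:
  assumes "length_bounded (sig u) (sig v)" "length_bounded (tau u) (tau v)" "clen v > 0"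
  shows "length_bounded u v"
proof -
  obtain C D where C: "\<And>m. int (clen (mapp m (sig u))) \<le> C * int (clen (mapp m (sig v)))"
    and D: "\<And>m. int (clen (mapp m (tau u))) \<le> D * int (clen (mapp m (tau v)))"
    using assms unfolding length_bounded_def by blast
  define E where "E = \<bar>C\<bar> + \<bar>D\<bar> + int (clen u)"
  show ?thesis
  proof (rule length_boundedI)
    fix m
    have fin: "x \<le> E * int y" if "x \<le> F * int y" "F \<le> E" for x F y
      using that mult_right_mono[of F E "int y"] by simp
    show "int (clen (mapp m u)) \<le> E * int (clen (mapp m v))"
    proof (cases m)
      case Nil
      have "int (clen u) * 1 \<le> int (clen u) * int (clen v)" using assms(3) by (intro mult_left_mono) auto
      then show ?thesis using Nil by (intro fin[of _ "int (clen u)"]) (auto simp: E_def)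
    next
      case (Cons s m')
      show ?thesis
        using fin[OF C[of m']] fin[OF D[of m']] Cons by (cases s) (auto simp: E_def)
    qed
  qed
qed

text \<open>Packages the induction hypothesis of the main comparison: it is applied to a cyclically
  reduced representative of \<open>mapp m v\<close> of smaller potential.\<close>

lemma length_bounded_descent:
  assumes hyp: "\<And>u w. cyc_reduced w \<Longrightarrow> bad Gen_a w + bad Gen_b w < bad Gen_a v + bad Gen_b v \<Longrightarrow>
      elliptic_le w u \<Longrightarrow> clen w > 0 \<Longrightarrow> length_bounded u w"
    and v: "elliptic_le v u" "clen v > 0"
    and w: "word_conj (mapp m v) w" "cyc_reduced w" "bad Gen_a w + bad Gen_b w < bad Gen_a v + bad Gen_b v"
  shows "length_bounded (mapp m u) (mapp m v)"
proof -
  have "clen w > 0" using clen_cong[OF w(1)] clen_mapp_eq_0_iff[of m v] v(2) by auto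
  then have "length_bounded (mapp m u) w"
    using hyp w elliptic_le_cong[OF w(1) elliptic_le_mapp[OF v(1)]] by blast
  then show ?thesis by (rule length_bounded_cong[OF w(1)])
qed

lemma length_bounded_half_stable:
  assumes hyp: "\<And>u w. cyc_reduced w \<Longrightarrow> bad Gen_a w + bad Gen_b w < bad Gen_a v + bad Gen_b v \<Longrightarrow>
      elliptic_le w u \<Longrightarrow> clen w > 0 \<Longrightarrow> length_bounded u w"
    and v: "cyc_reduced v" "elliptic_le v u" "clen v > 0"
    and bad: "bad Gen_a v > 0" "bad Gen_b v = 0" "same Gen_a v > 0"
  shows "length_bounded u v"
proof (rule length_bounded_unstable[OF v(1) bad(2,3) _ v(3)])
  fix n
  note descent = length_bounded_descent[OF hyp v(2,3)]
  show "length_bounded (tau ((sig ^^ n) u)) (tau ((sig ^^ n) v))"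
  proof (cases "n = 0")
    \<comment> \<open>Without a preceding \<open>sig\<close> the letters of type a may be adjacent,
      so \<open>tau\<close> only lowers the potential; for \<open>n > 0\<close> it becomes
      zero.\<close>
    case True
    obtain t where t: "word_conj (tau v) t" "twist_step Gen_b v t" using ex_tau_step[OF v(1)] by blast
    then show ?thesis using descent[of "[False]" t] twist_stepD(1,4,6)[OF t(2)] bad True by simp
  next
    case False
    then obtain z where "word_conj (tau ((sig ^^ n) v)) z" "cyc_reduced z" "bad Gen_a z = 0" "bad Gen_b z = 0"
      using tau_sig_iterate[OF v(1) bad(2)] by blast
    then show ?thesis
      using descent[of "replicate n True @ [False]" z] bad by (simp add: mapp_append mapp_replicate_True)
  qed
qed

text \<open>If \<open>v\<close> is elliptic for one of the twists, the comparison is direct.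
  Otherwise both slopes are positive, and the potential decides between the stable bound, one step
  of each twist, and the splitting at the first twist that cancels.\<close>

theorem length_bounded_if_elliptic_le:
  assumes "elliptic_le v u" "clen v > 0"
  shows "length_bounded u v"
proof -
  have "length_bounded u v" if "cyc_reduced v" "elliptic_le v u" "clen v > 0" for u v
    using that
  proof (induction "nat (bad Gen_a v + bad Gen_b v)" arbitrary: u v rule: less_induct)
    case less
    note nn = stats_nonneg(4)[of Gen_a] stats_nonneg(4)[of Gen_b]
    have hyp: "length_bounded u w"
      if "cyc_reduced w" "bad Gen_a w + bad Gen_b w < bad Gen_a v + bad Gen_b v" "elliptic_le w u" "clen w > 0" for u w
    proof (rule less.hyps[OF _ that(1,3,4)])
      show "nat (bad Gen_a w + bad Gen_b w) < nat (bad Gen_a v + bad Gen_b v)"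
        using that(2) nn[of w] nn[of v] by linarith
    qed
    consider "elliptic v" | "elliptic (swap v)" | "same Gen_a v > 0" "same Gen_b v > 0"
      using elliptic_iff_same[OF less.prems(1)] elliptic_swap_iff_same[OF less.prems(1)]
        stats_nonneg(3)[of Gen_a v] stats_nonneg(3)[of Gen_b v] by fastforce
    then show ?case
    proof cases
      case 1
      then show ?thesis using length_bounded_elliptic less.prems by blast
    next
      case 2
      then have "length_bounded (swap u) (swap v)"
        using length_bounded_elliptic[of "swap v" "swap u"] elliptic_le_swap less.prems by simp
      then show ?thesis by (rule length_bounded_swap)
    next
      case same: 3
      consider "bad Gen_a v = 0" "bad Gen_b v = 0" | "bad Gen_a v > 0" "bad Gen_b v > 0"
        | "bad Gen_a v > 0" "bad Gen_b v = 0" | "bad Gen_a v = 0" "bad Gen_b v > 0"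
        using nn[of v] by fastforce
      then show ?thesis
      proof cases
        case 1
        then show ?thesis using length_bounded_stable[OF less.prems(1)] same by blast
      next
        case 2
        note descent = length_bounded_descent[OF hyp less.prems(2,3)]
        obtain s t where s: "word_conj (sig v) s" "twist_step Gen_a v s" and t: "word_conj (tau v) t" "twist_step Gen_b v t"
          using ex_sig_step[OF less.prems(1)] ex_tau_step[OF less.prems(1)] by blast
        have "length_bounded (sig u) (sig v)"
          using descent[of "[True]" s] twist_stepD(1,4,6)[OF s(2)] s(1) 2 by simp
        moreover have "length_bounded (tau u) (tau v)"
          using descent[of "[False]" t] twist_stepD(1,4,6)[OF t(2)] t(1) 2 by simp
        ultimately show ?thesis by (rule length_bounded_Cons[OF _ _ less.prems(3)])
      next
        case 3
        show ?thesis by (rule length_bounded_half_stable[OF hyp less.prems]) (use 3 same in simp_all)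
      next
        case 4
        have "length_bounded (swap u) (swap v)"
        proof (rule length_bounded_half_stable)
          show "length_bounded u' w"
            if "cyc_reduced w" "bad Gen_a w + bad Gen_b w < bad Gen_a (swap v) + bad Gen_b (swap v)"
              "elliptic_le w u'" "clen w > 0" for u' w
            using hyp[OF that(1) _ that(3,4)] that(2) by (simp add: swap_stats)
        qed (use 4 same less.prems(1,3) elliptic_le_swap[OF less.prems(2)] in \<open>simp_all add: swap_stats\<close>)
        then show ?thesis by (rule length_bounded_swap)
      qed
    qed
  qed
  moreover obtain c where c: "cyc_reduced c" "word_conj v c" using ex_cyc_reduced_word_conj by blast
  ultimately have "length_bounded u c"
    using elliptic_le_cong[OF c(2) assms(1)] clen_cong[OF c(2)] assms(2) by simp
  then show ?thesis by (rule length_bounded_cong[OF c(2)])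
qed

section \<open>Bounding the search\<close>

text \<open>Conjugation by \<open>iota\<close> inverts both twists, so that the inverse of a positive product is again given
  by a positive product.\<close>

lemma mapp_rev_iota: "word_conj (mapp (rev m) (iota (mapp m w))) (iota w)"
proof (induction m arbitrary: w)
  case (Cons s m)
  let ?g = "\<lambda>w. if s then sig w else tau w"
  have "mapp (rev (s # m)) (iota (mapp (s # m) w)) = ?g (mapp (rev m) (iota (mapp m (?g w))))"
    by (simp add: mapp_append)
  moreover have "word_conj (?g (mapp (rev m) (iota (mapp m (?g w))))) (?g (iota (?g w)))"
    using Cons[of "?g w"] by (auto intro: word_conj_sig word_conj_tau)
  moreover have "word_conj (?g (iota (?g w))) (iota w)" by (simp add: sig_iota_sig tau_iota_tau)
  ultimately show ?case using word_conj_trans by simp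
qed simp

lemma elliptic_neg: "elliptic w \<Longrightarrow> elliptic (neg w)"
  unfolding elliptic_def using word_conj_trans[OF sig_neg word_conj_neg] .

lemma elliptic_iota: "elliptic w \<Longrightarrow> elliptic (iota w)"
proof -
  assume "elliptic w"
  then have "word_conj (sig (iota (sig w))) (sig (iota w))"
    unfolding elliptic_def by (intro word_conj_sig word_conj_iota)
  then show ?thesis unfolding elliptic_def using sig_iota_sig word_conj_sym word_conj_trans by meson
qed

lemma elliptic_iota_iff [simp]: "elliptic (iota w) = elliptic w"
  using elliptic_iota[of w] elliptic_iota[of "iota w"] by auto

lemma elliptic_neg_iff [simp]: "elliptic (neg w) = elliptic w"
  using elliptic_neg[of w] elliptic_neg[of "neg w"] by auto

lemma elliptic_swap_iota_iff [simp]: "elliptic (swap (iota w)) = elliptic (swap w)"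
  by (simp add: swap_iota)

lemma gb_ge_length: "gb (False # m) \<ge> int (length m) + 2"
proof -
  have "ga m + gb m \<ge> int (length m) + 2"
  proof (induction m)
    case (Cons s m)
    then show ?case using growth_pos[of m] by (cases s) auto
  qed simp
  then show ?thesis by simp
qed

text \<open>The product is run backwards: after \<open>iota\<close> the image is still elliptic, and
  the reversed product leads back to \<open>iota v\<close>. The reversed product begins with
  \<open>tau\<close>, which makes \<open>gb\<close> exceed its length, and \<open>gb\<close> is a
  lower bound for \<open>clen v\<close>.\<close>

lemma elliptic_depth:
  assumes "elliptic (mapp (m @ [False]) v)" "\<not> elliptic (swap (mapp (m @ [False]) v))"
  shows "length m < clen v"
proof -
  let ?w = "iota (mapp (m @ [False]) v)"
  have "clen (mapp (rev (m @ [False])) ?w) = clen v"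
    using clen_cong[OF mapp_rev_iota[of "m @ [False]" v]] by simp
  moreover have "gb (rev (m @ [False])) \<le> int (clen (mapp (rev (m @ [False])) ?w))"
    by (rule elliptic_clen_ge) (use assms in simp_all)
  ultimately show ?thesis using gb_ge_length[of "rev m"] by simp
qed

text \<open>A class fixed by both twists is fixed by every positive product, and up to
  \<open>iota\<close> the way back is a positive product too.\<close>

lemma elliptic_both_mapp_iff:
  "elliptic (mapp m v) \<and> elliptic (swap (mapp m v)) \<longleftrightarrow> elliptic v \<and> elliptic (swap v)"
proof
  assume "elliptic v \<and> elliptic (swap v)"
  then have c: "word_conj (mapp m v) v" using elliptic_both_mapp by blast
  then show "elliptic (mapp m v) \<and> elliptic (swap (mapp m v))"
    using elliptic_cong[OF c] elliptic_cong[OF word_conj_swap[OF c]] \<open>elliptic v \<and> elliptic (swap v)\<close> by simp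
next
  assume "elliptic (mapp m v) \<and> elliptic (swap (mapp m v))"
  then have "word_conj (mapp (rev m) (iota (mapp m v))) (iota (mapp m v))"
    by (intro elliptic_both_mapp) simp_all
  then have c: "word_conj (iota v) (iota (mapp m v))"
    using mapp_rev_iota[of m v] word_conj_sym word_conj_trans by blast
  then show "elliptic v \<and> elliptic (swap v)"
    using elliptic_cong[OF c] elliptic_cong[OF word_conj_swap[OF c]] \<open>elliptic (mapp m v) \<and> elliptic (swap (mapp m v))\<close> by simp
qed

lemma elliptic_mapp_snoc_True: "elliptic (mapp (m @ [True]) v) = elliptic (mapp m v)"
proof -
  let ?w = "mapp m v"
  have 1: "elliptic (sig w)" if "elliptic w" for w
    using that elliptic_cong[of "sig w" w] by (simp add: elliptic_def)
  have "elliptic w" if "elliptic (sig w)" for w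
    using 1[of "iota (sig w)"] that elliptic_cong[OF sig_iota_sig[of w]] by simp
  with 1 have "elliptic (sig w) = elliptic w" for w by blast
  then show ?thesis by (simp add: mapp_append)
qed

text \<open>A final \<open>sig\<close> does not affect ellipticity, so only products ending in
  \<open>tau\<close> matter. These are short by \<open>elliptic_depth\<close>, unless the image is
  fixed by both twists; in that case \<open>v\<close> is so already, and the empty product is the
  test.\<close>

lemma elliptic_le_bounded:
  assumes "\<And>m. length m \<le> clen v \<Longrightarrow> (elliptic (mapp m v) \<longrightarrow> elliptic (mapp m u)) \<and>
     (elliptic (swap (mapp m v)) \<longrightarrow> elliptic (swap (mapp m u)))"
  shows "elliptic_le v u"
proof -
  have both: "elliptic (mapp m u) \<and> elliptic (swap (mapp m u))"
    if "elliptic (mapp m v)" "elliptic (swap (mapp m v))" for m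
    using that elliptic_both_mapp_iff[of m v] elliptic_both_mapp_iff[of m u] assms[of "[]"] by simp
  \<comment> \<open>General in \<open>u\<close> and \<open>v\<close>, because it is used again for
    the swapped pair.\<close>
  have main: "elliptic (mapp m u)"
    if "elliptic (mapp m v)"
      "\<And>m. length m \<le> clen v \<Longrightarrow> elliptic (mapp m v) \<Longrightarrow> elliptic (mapp m u)"
      "\<And>m. elliptic (mapp m v) \<Longrightarrow> elliptic (swap (mapp m v)) \<Longrightarrow> elliptic (mapp m u)"
    for m u v
    using that(1)
  proof (induction m rule: rev_induct)
    case Nil
    then show ?case using that(2)[of "[]"] by simp
  next
    case (snoc s m)
    show ?case
    proof (cases s)
      case True
      then show ?thesis using snoc by (simp add: elliptic_mapp_snoc_True)
    next
      case False
      show ?thesis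
      proof (cases "elliptic (swap (mapp (m @ [s]) v))")
        case True
        then show ?thesis using that(3) snoc.prems by blast
      next
        case False
        then have "length m < clen v" using elliptic_depth[of m v] snoc.prems \<open>\<not> s\<close> by simp
        then show ?thesis using that(2)[of "m @ [s]"] snoc.prems by simp
      qed
    qed
  qed
  have sw: "elliptic (mapp m (swap w)) = elliptic (swap (mapp (map Not m) w))"
    "elliptic (swap (mapp m (swap w))) = elliptic (mapp (map Not m) w)" for m w
    by (simp_all add: swap_mapp comp_def)
  have "elliptic (mapp m u)" if "elliptic (mapp m v)" for m
  proof (rule main[OF that])
    show "elliptic (mapp m u)" if "length m \<le> clen v" "elliptic (mapp m v)" for m
      using assms[OF that(1)] that(2) by simp
    show "elliptic (mapp m u)" if "elliptic (mapp m v)" "elliptic (swap (mapp m v))" for m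
      using both[OF that] by simp
  qed
  moreover have "elliptic (swap (mapp m u))" if "elliptic (swap (mapp m v))" for m
  proof -
    have "elliptic (mapp (map Not m) (swap v))" using that by (simp add: sw comp_def)
    then have "elliptic (mapp (map Not m) (swap u))"
    proof (rule main)
      show "elliptic (mapp m (swap u))" if "length m \<le> clen (swap v)" "elliptic (mapp m (swap v))" for m
        using assms[of "map Not m"] that by (simp add: sw)
      show "elliptic (mapp m (swap u))" if "elliptic (mapp m (swap v))" "elliptic (swap (mapp m (swap v)))" for m
        using both[of "map Not m"] that by (simp add: sw)
    qed
    then show ?thesis by (simp add: sw comp_def)
  qed
  ultimately show ?thesis by (simp add: elliptic_le_def)
qed


section \<open>Nielsen reduction in rank two\<close>

definition positive_length :: "(word \<Rightarrow> word) \<Rightarrow> bool" where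
  "positive_length F \<longleftrightarrow> (\<exists>m i. \<forall>w. clen (F w) = clen (mapp m (if i then iota w else w)))"

lemma word_conj_mapp_neg: "word_conj (mapp m (neg w)) (neg (mapp m w))"
proof (induction m arbitrary: w)
  case (Cons s m)
  have "word_conj (mapp (s # m) (neg w)) (mapp m (neg (if s then sig w else tau w)))"
    using word_conj_mapp[OF sig_neg] word_conj_mapp[OF tau_neg] by simp
  then show ?case using word_conj_trans[OF _ Cons] by simp
qed simp

lemma clen_mapp_neg: "clen (mapp m (neg w)) = clen (mapp m w)"
  using clen_cong[OF word_conj_mapp_neg] by simp

lemma clen_mapp_swap: "clen (mapp m (swap w)) = clen (mapp (map Not m) w)"
  by (metis clen_swap map_Not_Not swap_mapp)

lemma iota_swap: "iota (swap w) = neg (swap (iota w))"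
  using swap_iota[of w] by simp

lemma positive_length_cong:
  "(\<And>w. clen (F w) = clen (G w)) \<Longrightarrow> positive_length F \<Longrightarrow> positive_length G"
  by (simp add: positive_length_def)

lemma positive_length_iota: "positive_length F \<Longrightarrow> positive_length (\<lambda>w. F (iota w))"
proof -
  assume "positive_length F"
  then obtain m i where F: "\<And>w. clen (F w) = clen (mapp m (if i then iota w else w))"
    unfolding positive_length_def by blast
  show ?thesis unfolding positive_length_def F
    by (rule exI[of _ m], rule exI[of _ "\<not> i"]) simp
qed

lemma positive_length_swap: "positive_length F \<Longrightarrow> positive_length (\<lambda>w. F (swap w))"
proof -
  assume "positive_length F"
  then obtain m i where F: "\<And>w. clen (F w) = clen (mapp m (if i then iota w else w))"
    unfolding positive_length_def by blast
  have "clen (F (swap w)) = clen (mapp (map Not m) (if i then iota w else w))" for w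
    by (simp add: F iota_swap clen_mapp_neg clen_mapp_swap)
  then show ?thesis unfolding positive_length_def by blast
qed

text \<open>The difficulty is a \<open>sig\<close> in front of \<open>iota\<close>, which amounts to
  an inverse twist. It has to be absorbed by the next twist of \<open>m\<close>: it cancels against
  \<open>sig\<close>, and merges with \<open>tau\<close> into one twist by
  \<open>tau_iota_sig\<close>.\<close>

lemma positive_length_sig: "positive_length F \<Longrightarrow> positive_length (\<lambda>w. F (sig w))"
proof -
  assume "positive_length F"
  then obtain m i where F: "\<And>w. clen (F w) = clen (mapp m (if i then iota w else w))"
    unfolding positive_length_def by blast
  show ?thesis
  proof (cases i)
    case False
    then show ?thesis unfolding positive_length_def F
      by (intro exI[of _ "True # m"] exI[of _ False]) simp
  next
    case i: True
    show ?thesis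
    proof (cases m)
      case Nil
      then show ?thesis unfolding positive_length_def F using i
        by (intro exI[of _ "[True]"] exI[of _ False]) simp
    next
      case (Cons s m')
      show ?thesis
      proof (cases s)
        case True
        have "clen (F (sig w)) = clen (mapp m' (iota w))" for w
          using clen_cong[OF word_conj_mapp[OF sig_iota_sig[of w], of m']] i True Cons by (simp add: F)
        then show ?thesis unfolding positive_length_def by (intro exI[of _ m'] exI[of _ True]) simp
      next
        case False
        have "clen (F (sig w)) = clen (mapp m' (neg (sig (swap w))))" for w
          using clen_cong[OF word_conj_mapp[OF tau_iota_sig[of w], of m']] i False Cons by (simp add: F)
        also have "clen (mapp m' (neg (sig (swap w)))) = clen (mapp (map Not (True # m')) w)" for w
          using clen_mapp_swap[of "True # m'" w] by (simp add: clen_mapp_neg)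
        finally show ?thesis unfolding positive_length_def
          by (intro exI[of _ "map Not (True # m')"] exI[of _ False]) simp
      qed
    qed
  qed
qed

section \<open>Pairs of words as images of the basis\<close>

definition ev :: "word \<Rightarrow> word \<Rightarrow> word \<Rightarrow> word" where
  "ev x y = subst (\<lambda>g. case g of Gen_a \<Rightarrow> x | Gen_b \<Rightarrow> y)"

lemma ev_simps [simp]:
  "ev x y [] = []" "ev x y [La] = x" "ev x y [Lb] = y" "ev x y [LA] = word_inv x" "ev x y [LB] = word_inv y"
  "ev x y (u @ v) = ev x y u @ ev x y v"
  by (simp_all add: ev_def)

lemma ev_subst: "ev x y (subst s w) = ev (ev x y (s Gen_a)) (ev x y (s Gen_b)) w"
  unfolding ev_def subst_subst
  by (rule arg_cong[where f = "\<lambda>s. subst s w"]) (auto split: basis.splits)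

lemma ev_sig: "ev x y (sig w) = ev (x @ y) y w"
  by (simp add: sig_def ev_subst) (simp add: ev_def)

lemma ev_swap: "ev x y (swap w) = ev y x w"
  by (simp add: swap_subst ev_subst)

lemma ev_iota: "ev x y (iota w) = ev x (word_inv y) w"
  by (simp add: iota_subst ev_subst)

lemma ev_letters: "ev [La] [Lb] w = w"
proof -
  have "(\<lambda>g. case g of Gen_a \<Rightarrow> [La] | Gen_b \<Rightarrow> [Lb]) = (\<lambda>x. [(x, True)])"
    by (auto split: basis.splits)
  then show ?thesis by (simp add: ev_def subst_id)
qed

lemma reduce_ev_conj:
  assumes "reduce x' = reduce (g @ x @ word_inv g)" "reduce y' = reduce (g @ y @ word_inv g)"
  shows "reduce (ev x' y' w) = reduce (g @ ev x y w @ word_inv g)"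
  unfolding ev_def by (rule reduce_subst_conj) (use assms in \<open>auto split: basis.splits\<close>)

definition generates :: "word \<Rightarrow> word \<Rightarrow> bool" where
  "generates x y \<longleftrightarrow> (\<forall>v. \<exists>w. reduce (ev x y w) = reduce v)"

text \<open>Pairs may be conjugated simultaneously. This disposes of the ties of Nielsen reduction, in which a
  word cancels exactly by halves on both sides, without an auxiliary order on words.\<close>

definition counterexample :: "word \<Rightarrow> word \<Rightarrow> bool" where
  "counterexample x y \<longleftrightarrow> generates x y \<and> \<not> positive_length (ev x y)"

lemma counterexample_conj:
  assumes "counterexample x y" "reduce x' = reduce (g @ x @ word_inv g)" "reduce y' = reduce (g @ y @ word_inv g)"
  shows "counterexample x' y'"
proof -
  have conj: "reduce (ev x' y' w) = reduce (g @ ev x y w @ word_inv g)" for w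
    by (rule reduce_ev_conj) fact+
  have "clen (ev x' y' w) = clen (ev x y w)" for w
    using clen_cong[OF word_conjI[OF conj]] by simp
  then have "\<not> positive_length (ev x' y')"
    using assms(1) positive_length_cong[of "ev x' y'" "ev x y"] by (auto simp: counterexample_def)
  moreover have "generates x' y'"
    unfolding generates_def
  proof
    fix v
    obtain w where w: "reduce (ev x y w) = reduce (word_inv g @ v @ g)"
      using assms(1) by (auto simp: counterexample_def generates_def)
    have "reduce (ev x' y' w) = reduce (g @ (ev x y w @ word_inv g))" by (simp add: conj)
    also have "\<dots> = reduce (g @ ((word_inv g @ v @ g) @ word_inv g))"
      by (intro reduce_cong_append[OF refl] reduce_cong_append[OF w refl])
    also have "\<dots> = reduce ((g @ word_inv g) @ (v @ g @ word_inv g))" by simp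
    also have "\<dots> = reduce (v @ (g @ word_inv g))" by (rule reduce_cancel_left) simp
    also have "\<dots> = reduce v" using reduce_cancel_mid[of "g @ word_inv g" v "[]"] by simp
    finally show "\<exists>w. reduce (ev x' y' w) = reduce v" by blast
  qed
  ultimately show ?thesis by (simp add: counterexample_def)
qed

lemma counterexample_reduce:
  "counterexample x y \<Longrightarrow> reduce x' = reduce x \<Longrightarrow> reduce y' = reduce y \<Longrightarrow> counterexample x' y'"
  using counterexample_conj[of x y x' "[]" y'] by simp

lemma counterexample_swap: "counterexample x y \<Longrightarrow> counterexample y x"
proof -
  assume c: "counterexample x y"
  have "positive_length (ev x y)" if "positive_length (ev y x)"
    using positive_length_swap[OF that] by (simp add: ev_swap)
  then show ?thesis using c unfolding counterexample_def generates_def by (metis ev_swap)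
qed

lemma counterexample_inv: "counterexample x y \<Longrightarrow> counterexample x (word_inv y)"
proof -
  assume c: "counterexample x y"
  have "positive_length (ev x y)" if "positive_length (ev x (word_inv y))"
    using positive_length_iota[OF that] by (simp add: ev_iota)
  then show ?thesis using c unfolding counterexample_def generates_def by (metis ev_iota word_inv_simps(4))
qed

text \<open>A Nielsen move. Conjugating \<open>sig\<close> by \<open>iota\<close> gives its inverse,
  so precomposition with it undoes the move and carries positivity back to the old pair.\<close>

lemma counterexample_mult: "counterexample x y \<Longrightarrow> counterexample (x @ y) y"
proof -
  assume c: "counterexample x y"
  have red: "reduce ((x @ y) @ word_inv y) = reduce x"
    using reduce_cancel_mid[of "y @ word_inv y" x "[]"] by simp
  have expand: "ev (x @ y) y (iota (sig (iota w))) = ev ((x @ y) @ word_inv y) y w" for w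
    by (simp add: ev_iota ev_sig)
  have eq: "reduce (ev (x @ y) y (iota (sig (iota w)))) = reduce (ev x y w)" for w
    unfolding expand using reduce_ev_conj[of "(x @ y) @ word_inv y" "[]" x y y w] red by simp
  have "positive_length (ev x y)" if "positive_length (ev (x @ y) y)"
  proof (rule positive_length_cong)
    show "positive_length (\<lambda>w. ev (x @ y) y (iota (sig (iota w))))"
      by (rule positive_length_iota, rule positive_length_sig, rule positive_length_iota, rule that)
    show "clen (ev (x @ y) y (iota (sig (iota w)))) = clen (ev x y w)" for w
      by (rule clen_cong[OF word_conj_reduce_eq[OF eq]])
  qed
  moreover have "generates (x @ y) y"
    using c unfolding counterexample_def generates_def by (metis eq)
  ultimately show ?thesis using c by (auto simp: counterexample_def)
qed

subsection \<open>Cancellation\<close>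

fun lcp :: "'a list \<Rightarrow> 'a list \<Rightarrow> nat" where
  "lcp (x # xs) (y # ys) = (if x = y then Suc (lcp xs ys) else 0)"
| "lcp _ _ = 0"

lemma lcp_le: "lcp u v \<le> length u" "lcp u v \<le> length v"
  by (induction u v rule: lcp.induct) auto

lemma take_lcp: "n \<le> lcp u v \<Longrightarrow> take n u = take n v"
  by (induction u v arbitrary: n rule: lcp.induct) (auto simp: take_Cons split: nat.splits if_splits)

lemma nth_lcp: "lcp u v < length u \<Longrightarrow> lcp u v < length v \<Longrightarrow> u ! lcp u v \<noteq> v ! lcp u v"
  by (induction u v rule: lcp.induct) auto

lemma lcp_ge: "take n u = take n v \<Longrightarrow> n \<le> length u \<Longrightarrow> n \<le> length v \<Longrightarrow> n \<le> lcp u v"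
  by (induction u v arbitrary: n rule: lcp.induct) (auto simp: take_Cons split: nat.splits)

lemma lcp_take_append: "lcp u v < k \<Longrightarrow> k \<le> length v \<Longrightarrow> lcp u (take k v @ r) = lcp u v"
  by (induction u v arbitrary: k rule: lcp.induct) (auto simp: take_Cons split: nat.splits if_splits)

text \<open>For reduced words, the number of letters that each factor loses in the product.\<close>

definition canc :: "word \<Rightarrow> word \<Rightarrow> nat" where
  "canc p q = lcp (word_inv p) q"

lemma canc_le: "canc p q \<le> length p" "canc p q \<le> length q"
  using lcp_le[of "word_inv p" q] by (auto simp: canc_def)

lemma reduced_word_inv: "reduced w \<Longrightarrow> reduced (word_inv w)"
proof (induction w)
  case (Cons x w)
  then show ?case by (cases w) (auto simp: reduced_append reduced_Cons)
qed simp

lemma length_reduce_word_inv: "length (reduce (word_inv w)) = length (reduce w)"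
proof -
  have "reduce (word_inv w) = reduce (word_inv (reduce w))" by (rule reduce_eq_word_inv) simp
  then show ?thesis by (simp add: reduced_word_inv)
qed

lemma take_word_inv: "n \<le> length w \<Longrightarrow> take n (word_inv w) = word_inv (drop (length w - n) w)"
  by (simp add: word_inv_def take_rev drop_map)

lemma reduce_append_canc:
  assumes "reduced p" "reduced q"
  shows "reduce (p @ q) = take (length p - canc p q) p @ drop (canc p q) q"
proof -
  define c where "c = canc p q"
  define p1 s q1 where "p1 = take (length p - c) p" and "s = drop (length p - c) p" and "q1 = drop c q"
  have le: "c \<le> length p" "c \<le> length q" using canc_le by (auto simp: c_def)
  have "take c q = word_inv s"
    using take_lcp[of c "word_inv p" q] take_word_inv[OF le(1)] by (simp add: c_def canc_def s_def)
  then have q: "q = word_inv s @ q1" by (metis append_take_drop_id q1_def)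
  have p: "p = p1 @ s" by (simp add: p1_def s_def)
  have "reduce (p @ q) = reduce (p1 @ (s @ word_inv s) @ q1)" unfolding p q by simp
  also have "\<dots> = reduce (p1 @ q1)" by (rule reduce_cancel_mid) simp
  also have "reduced (p1 @ q1)"
    unfolding reduced_append
  proof (intro conjI)
    show "reduced p1" "reduced q1" using assms unfolding p q reduced_append by auto
    have "hd q1 \<noteq> letter_inv (last p1)" if "q1 \<noteq> []" "p1 \<noteq> []"
    proof -
    from that have lt: "c < length p" "c < length q" by (auto simp: q1_def p1_def)
    then have "word_inv p ! c \<noteq> q ! c"
      using nth_lcp[of "word_inv p" q] by (simp add: c_def canc_def)
    moreover have "word_inv p ! c = letter_inv (last p1)"
      using lt last_conv_nth[OF that(2)] by (simp add: word_inv_def rev_nth p1_def)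
    moreover have "q ! c = hd q1" using lt by (simp add: q1_def hd_drop_conv_nth)
    ultimately show "hd q1 \<noteq> letter_inv (last p1)" by simp
    qed
    then show "p1 = [] \<or> q1 = [] \<or> hd q1 \<noteq> letter_inv (last p1)" by blast
  qed
  then have "reduce (p1 @ q1) = p1 @ q1" by simp
  finally show ?thesis by (simp add: p1_def q1_def c_def)
qed

lemma length_reduce_append_canc:
  "reduced p \<Longrightarrow> reduced q \<Longrightarrow> length (reduce (p @ q)) + 2 * canc p q = length p + length q"
  using canc_le[of p q] by (simp add: reduce_append_canc)

text \<open>Otherwise \<open>z\<close> would be inverse to itself under reflection in its midpoint:
  the two middle letters would cancel, or the middle letter would be its own inverse.\<close>

lemma canc_self:
  assumes "reduced z" "z \<noteq> []" shows "2 * canc z z < length z"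
proof (rule ccontr)
  define n where "n = length z"
  assume "\<not> ?thesis"
  then have big: "n \<le> 2 * canc z z" by (simp add: n_def)
  have sym: "z ! i = letter_inv (z ! (n - 1 - i))" if "i < canc z z" for i
  proof -
    have "take (canc z z) (word_inv z) ! i = take (canc z z) z ! i"
      using take_lcp[of "canc z z" "word_inv z" z] by (simp add: canc_def)
    then show ?thesis using that canc_le[of z z] by (simp add: word_inv_def rev_nth n_def)
  qed
  have n: "n > 0" using assms by (simp add: n_def)
  show False
  proof (cases "even n")
    case True
    then obtain k where k: "n = 2 * k" by blast
    then have "z ! (k - 1) = letter_inv (z ! k)" using sym[of "k - 1"] big n by (simp add: Suc_diff_Suc mult_2)
    moreover have "z ! Suc (k - 1) \<noteq> letter_inv (z ! (k - 1))"
      using assms(1) k n unfolding reduced_iff_nth n_def[symmetric] by (metis One_nat_def Suc_pred diff_Suc_1 less_add_same_cancel1 mult_2 nat_0_less_mult_iff zero_less_Suc)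
    ultimately show False using k n by simp
  next
    case False
    then obtain k where k: "n = 2 * k + 1" using oddE by blast
    then show False using sym[of k] big by simp
  qed
qed

text \<open>Nielsen's condition: if no image of a letter is consumed by its two neighbours together,
  some letter of every image survives.\<close>

lemma length_le_reduce_subst:
  assumes z: "\<And>l. reduced (subst s [l])" "\<And>l. subst s [l] \<noteq> []"
    and c2: "\<And>l l'. l' \<noteq> letter_inv l \<Longrightarrow> 2 * canc (subst s [l]) (subst s [l']) \<le> length (subst s [l]) \<and>
       2 * canc (subst s [l]) (subst s [l']) \<le> length (subst s [l'])"
    and c3: "\<And>l l' l''. l' \<noteq> letter_inv l \<Longrightarrow> l'' \<noteq> letter_inv l' \<Longrightarrow>
       canc (subst s [l]) (subst s [l']) + canc (subst s [l']) (subst s [l'']) < length (subst s [l'])"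
    and w: "reduced w"
  shows "length w \<le> length (reduce (subst s w))"
proof -
  define z where "z l = subst s [l]" for l
  define d where "d l w = (if w = [] then 0 else canc (z l) (z (hd w)))" for l w
  have z_ne: "length (z l) > 0" for l using z(2) by (simp add: z_def)
  \<comment> \<open>The invariant shows the first image explicitly up to its cancellation with the
    next one and leaves in \<open>R\<close> at least one letter for each later letter of the
    word.\<close>
  have "\<exists>R. reduce (subst s (l # w)) = take (length (z l) - d l w) (z l) @ R \<and> length w \<le> length R"
    if "reduced (l # w)" for l w
    using that
  proof (induction w arbitrary: l)
    case Nil
    then show ?case using z(1)[of l] by (simp add: d_def z_def)
  next
    case (Cons l' w)
    obtain R where R: "reduce (subst s (l' # w)) = take (length (z l') - d l' w) (z l') @ R" "length w \<le> length R"
      using Cons.IH[of l'] Cons.prems by auto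
    define V where "V = take (length (z l') - d l' w) (z l') @ R"
    define c where "c = canc (z l) (z l')"
    have ll: "l' \<noteq> letter_inv l" using Cons.prems by simp
    \<comment> \<open>What is left of \<open>z l'\<close> after cancellation on its right is longer
      than what \<open>z l\<close> cancels, so \<open>z l\<close> meets \<open>V\<close> exactly as
      it meets \<open>z l'\<close>.\<close>
    have lt: "c < length (z l') - d l' w"
    proof (cases w)
      case Nil
      have "2 * canc (z l) (z l') \<le> length (z l')" using c2[OF ll] by (simp add: z_def)
      then show ?thesis using z_ne[of l'] Nil
        by (simp add: d_def c_def del: length_greater_0_conv)
    next
      case (Cons l'' v)
      then have "l'' \<noteq> letter_inv l'" using \<open>reduced (l # l' # w)\<close> by simp
      from c3[OF ll this] show ?thesis by (simp add: Cons d_def c_def z_def)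
    qed
    have cV: "canc (z l) V = c"
      unfolding canc_def V_def c_def by (rule lcp_take_append) (use lt in \<open>auto simp: c_def canc_def\<close>)
    have "reduced V" unfolding V_def R(1)[symmetric] by simp
    have "reduce (subst s (l # l' # w)) = reduce (z l @ reduce (subst s (l' # w)))"
      by (simp add: z_def flip: subst_Cons)
    also have "\<dots> = take (length (z l) - c) (z l) @ drop c V"
      unfolding R(1) V_def[symmetric] using reduce_append_canc[of "z l" V] z(1)[of l] \<open>reduced V\<close> cV
      by (simp add: z_def)
    finally have "reduce (subst s (l # l' # w)) = take (length (z l) - d l (l' # w)) (z l) @ drop c V"
      by (simp add: d_def c_def)
    moreover have "length (l' # w) \<le> length (drop c V)" using lt R(2) by (simp add: V_def)
    ultimately show ?case by blast
  qed
  note main = this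
  show ?thesis
  proof (cases w)
    case (Cons l v)
    obtain R where R: "reduce (subst s (l # v)) = take (length (z l) - d l v) (z l) @ R" "length v \<le> length R"
      using main[of l v] w Cons by auto
    have "d l v < length (z l)"
    proof (cases v)
      case (Cons l' v')
      then have "l' \<noteq> letter_inv l" using w \<open>w = l # v\<close> by simp
      from c2[OF this] have "2 * canc (z l) (z l') \<le> length (z l)" by (simp add: z_def)
      then show ?thesis using z_ne[of l] Cons by (simp add: d_def del: length_greater_0_conv)
    qed (use z_ne[of l] in \<open>simp add: d_def\<close>)
    then show ?thesis using R Cons by simp
  qed simp
qed

lemma commute_subst:
  assumes "\<And>x. reduce (s x @ t) = reduce (t @ s x)"
  shows "reduce (subst s w @ t) = reduce (t @ subst s w)"
proof (induction w)
  case (Cons l w)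
  obtain x p where l: "l = (x, p)" by (cases l)
  have 1: "reduce (subst s [l] @ t) = reduce (t @ subst s [l])"
  proof (cases p)
    case False
    let ?u = "s x"
    have "reduce (word_inv ?u @ t) = reduce ((word_inv ?u @ t) @ (?u @ word_inv ?u))"
      using reduce_cancel_mid[of "?u @ word_inv ?u" "word_inv ?u @ t" "[]"] by simp
    also have "\<dots> = reduce (word_inv ?u @ ((t @ ?u) @ word_inv ?u))" by (simp only: append_assoc)
    also have "\<dots> = reduce (word_inv ?u @ ((?u @ t) @ word_inv ?u))"
      by (intro reduce_cong_append[OF refl] reduce_cong_append[OF assms[symmetric] refl])
    also have "\<dots> = reduce ((word_inv ?u @ ?u) @ (t @ word_inv ?u))" by (simp only: append_assoc)
    also have "\<dots> = reduce (t @ word_inv ?u)" by (rule reduce_cancel_left) simp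
    finally show ?thesis using l False by simp
  qed (use assms l in simp)
  have "reduce (subst s (l # w) @ t) = reduce (subst s [l] @ (subst s w @ t))" by (simp add: subst_Cons[of s l w])
  also have "\<dots> = reduce (subst s [l] @ (t @ subst s w))" by (rule reduce_cong_append[OF refl Cons])
  also have "\<dots> = reduce ((subst s [l] @ t) @ subst s w)" by simp
  also have "\<dots> = reduce ((t @ subst s [l]) @ subst s w)" by (rule reduce_cong_append[OF 1 refl])
  finally show ?case by (simp add: subst_Cons[of s l w])
qed simp

text \<open>With one entry trivial all images lie in the cyclic subgroup of \<open>y\<close> and
  commute, whereas a and b do not.\<close>

lemma not_generates_Nil: "\<not> generates [] y"
proof
  assume g: "generates [] y"
  let ?s = "\<lambda>g. case g of Gen_a \<Rightarrow> [] | Gen_b \<Rightarrow> y"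
  have 1: "reduce (ev [] y w @ y) = reduce (y @ ev [] y w)" for w
    unfolding ev_def by (rule commute_subst) (auto split: basis.splits)
  have "reduce (?s g @ ev [] y w) = reduce (ev [] y w @ ?s g)" for g w
    using 1[of w] by (cases g) simp_all
  then have 2: "reduce (ev [] y v @ ev [] y w) = reduce (ev [] y w @ ev [] y v)" for v w
    unfolding ev_def[of "[]" y, THEN fun_cong, of v] by (rule commute_subst)
  obtain v where v: "reduce (ev [] y v) = reduce [La]" using g unfolding generates_def by blast
  obtain w where w: "reduce (ev [] y w) = reduce [Lb]" using g unfolding generates_def by blast
  have "reduce ([La] @ [Lb]) = reduce (ev [] y v @ ev [] y w)"
    by (rule reduce_cong_append[OF v[symmetric] w[symmetric]])
  also have "\<dots> = reduce (ev [] y w @ ev [] y v)" by (rule 2)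
  also have "\<dots> = reduce ([Lb] @ [La])" by (rule reduce_cong_append[OF w v])
  finally have "reduce ([La] @ [Lb]) = reduce ([Lb] @ [La])" .
  then show False by (simp add: reduce_def)
qed

text \<open>In a pair of least total length the hypotheses of \<open>length_le_reduce_subst\<close>
  hold. As the pair generates, it then consists of letters, and for the basis itself the empty
  product serves.\<close>

lemma no_counterexample: "\<not> counterexample x y"
proof
  assume "counterexample x y"
  then obtain n where ex: "\<exists>x y. counterexample x y \<and> length (reduce x) + length (reduce y) = n" by blast
  define N where "N = (LEAST n. \<exists>x y. counterexample x y \<and> length (reduce x) + length (reduce y) = n)"
  have "\<exists>x y. counterexample x y \<and> length (reduce x) + length (reduce y) = N"
    unfolding N_def by (rule LeastI_ex) (use ex in blast)
  then obtain x0 y0 where xy0: "counterexample x0 y0" "length (reduce x0) + length (reduce y0) = N" by blast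
  have min: "N \<le> length (reduce p) + length (reduce q)" if "counterexample p q" for p q
    unfolding N_def by (rule Least_le) (use that in blast)
  define x y where "x = reduce x0" and "y = reduce y0"
  have xy: "counterexample x y" "reduced x" "reduced y" "length x + length y = N"
    using xy0 counterexample_reduce[OF xy0(1)] by (simp_all add: x_def y_def)
  define z where "z l = ev x y [l]" for l
  have z_simps: "z La = x" "z LA = word_inv x" "z Lb = y" "z LB = word_inv y" by (simp_all add: z_def)
  have z_inv: "z (letter_inv l) = word_inv (z l)" for l
    unfolding z_def ev_def by (rule subst_letter_inv)
  have z_red: "reduced (z l)" for l
    using xy reduced_word_inv[of x] reduced_word_inv[of y] by (cases l; cases "fst l"; cases "snd l") (auto simp: z_simps)
  have gen: "generates x y" using xy by (simp add: counterexample_def)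
  have "x \<noteq> []" "y \<noteq> []"
    using not_generates_Nil xy(1) counterexample_swap[OF xy(1)] by (auto simp: counterexample_def)
  then have z_ne: "z l \<noteq> []" for l
    by (cases l; cases "fst l"; cases "snd l") (auto simp: z_simps)
  have z_ce: "counterexample (z l) (z l') \<and> length (z l) + length (z l') = N" if "fst l \<noteq> fst l'" for l l'
  proof -
    have 1: "counterexample x y" "counterexample x (word_inv y)" "counterexample (word_inv x) y" "counterexample (word_inv x) (word_inv y)"
      using xy(1) counterexample_inv counterexample_swap by blast+
    have 2: "counterexample p q \<and> length p + length q = N"
      if "counterexample q p" "length q + length p = N" for p q using that counterexample_swap by auto
    obtain g s g' s' where l: "l = (g, s)" "l' = (g', s')" by (cases l; cases l')
    show ?thesis
      using that 1 xy(4) 1[THEN 2] unfolding l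
      by (cases g; cases g'; cases s; cases s') (simp_all add: z_simps)
  qed
  have fst_inv: "fst (letter_inv l) = fst l" for l by (simp add: letter_inv_def)
  \<comment> \<open>By minimality, replacing either factor by the product does not shorten the pair.
    As \<open>counterexample_mult\<close> changes the left entry, the right factor is replaced after
    passing to inverses.\<close>
  have c2_ne: "2 * canc (z l) (z l') \<le> length (z l) \<and> 2 * canc (z l) (z l') \<le> length (z l')"
    if ne: "fst l \<noteq> fst l'" for l l'
  proof -
    have "N \<le> length (reduce (z l @ z l')) + length (reduce (z l'))"
      using min[OF counterexample_mult] z_ce[OF ne] by blast
    moreover have "N \<le> length (reduce (z l @ z l')) + length (reduce (z l))"
    proof -
      have "counterexample (word_inv (z l')) (word_inv (z l))"
        using z_ce[of "letter_inv l'" "letter_inv l"] ne unfolding fst_inv z_inv by simp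
      then have "N \<le> length (reduce (word_inv (z l') @ word_inv (z l))) + length (reduce (word_inv (z l)))"
        using min[OF counterexample_mult] by blast
      then show ?thesis using length_reduce_word_inv[of "z l @ z l'"] by (simp add: length_reduce_word_inv)
    qed
    ultimately show ?thesis
      using length_reduce_append_canc[OF z_red z_red, of l l'] z_ce[OF ne] z_red[of l] z_red[of l'] by simp
  qed
  have c_self: "2 * canc (z l) (z l) < length (z l)" for l by (rule canc_self[OF z_red z_ne])
  have same_or_ne: "l' = l \<or> fst l \<noteq> fst l'" if "l' \<noteq> letter_inv l" for l l'
    using that by (cases l; cases l') auto
  have c2: "2 * canc (z l) (z l') \<le> length (z l) \<and> 2 * canc (z l) (z l') \<le> length (z l')"
    if "l' \<noteq> letter_inv l" for l l'
    using same_or_ne[OF that] c_self[of l] c2_ne[of l l'] by auto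
  \<comment> \<open>Each of the two cancellations takes at most half of \<open>z l'\<close>, so
    failure means that both take exactly half.\<close>
  have c3: "canc (z l) (z l') + canc (z l') (z l'') < length (z l')"
    if n1: "l' \<noteq> letter_inv l" and n2: "l'' \<noteq> letter_inv l'" for l l' l''
  proof (rule ccontr)
    define h where "h = canc (z l) (z l')"
    assume "\<not> ?thesis"
    then have h: "2 * h = length (z l')" "canc (z l') (z l'') = h" "2 * h \<le> length (z l)" "2 * h \<le> length (z l'')"
      using c2[OF n1] c2[OF n2] by (auto simp: h_def)
    have "fst l \<noteq> fst l'" "fst l' \<noteq> fst l''"
      using same_or_ne[OF n1] same_or_ne[OF n2] c_self[of l'] h by (auto simp: h_def)
    moreover from this have "fst l = fst l''" by (metis basis.exhaust)
    ultimately have cases: "l'' = l \<or> l'' = letter_inv l" using same_or_ne[of l'' l] by blast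
    define q where "q = z l'"
    define s t where "s = take h q" and "t = drop h q"
    have len: "length s = h" "length t = h" "q = s @ t" using h(1) by (auto simp: s_def t_def q_def)
    have s1: "take h (word_inv (z l)) = s"
      using take_lcp[of h "word_inv (z l)" q] by (simp add: h_def canc_def q_def s_def)
    have t1: "take h (z l'') = word_inv t"
      using take_lcp[of h "word_inv q" "z l''"] h(2) len by (simp add: canc_def q_def)
    from cases show False
    proof
      \<comment> \<open>Here the second half of \<open>q\<close> is the inverse of the first, so
        that \<open>q\<close> would cancel against itself.\<close>
      assume "l'' = letter_inv l"
      then have "take h (word_inv q) = take h q" using s1 t1 len by (simp add: z_inv)
      then have "h \<le> canc q q" unfolding canc_def using len by (intro lcp_ge) auto
      then show False using c_self[of l'] h(1) by (simp add: q_def)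
    next
      \<comment> \<open>Here \<open>z l\<close> is t^-1 r s^-1 and \<open>q\<close> is s t.
        Conjugating the pair of \<open>z l\<close> times \<open>q\<close> and \<open>q\<close> by t
        gives the pair of r and t s, whose total length is at most that of \<open>z l\<close>
        alone.\<close>
      assume l: "l'' = l"
      define r where "r = take (length (z l) - 2 * h) (drop h (z l))"
      have "word_inv s = drop (length (z l) - h) (z l)"
        using s1 take_word_inv[of h "z l"] h(3) by auto
      also have "\<dots> = drop (length (z l) - 2 * h) (drop h (z l))"
        using h(3) by (simp add: drop_drop)
      finally have "drop h (z l) = r @ word_inv s" unfolding r_def by (simp only: append_take_drop_id)
      then have "z l = word_inv t @ r @ word_inv s"
        using t1 unfolding l by (metis append_take_drop_id)
      then have zl: "z l @ q = word_inv t @ r @ word_inv s @ s @ t" using len by simp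
      have ce: "counterexample (z l @ q) q"
        using counterexample_mult z_ce[OF \<open>fst l \<noteq> fst l'\<close>] by (simp add: q_def)
      have "counterexample r (t @ s)"
      proof (rule counterexample_conj[OF ce, of _ t])
        have "reduce (t @ (z l @ q) @ word_inv t) = reduce ((t @ word_inv t) @ (r @ word_inv s @ s @ t @ word_inv t))"
          by (simp add: zl)
        also have "\<dots> = reduce (r @ word_inv s @ s @ t @ word_inv t)" by (rule reduce_cancel_left) simp
        also have "\<dots> = reduce (r @ (word_inv s @ s) @ (t @ word_inv t))" by simp
        also have "\<dots> = reduce (r @ (t @ word_inv t))" by (rule reduce_cancel_mid) simp
        also have "\<dots> = reduce r" using reduce_cancel_mid[of "t @ word_inv t" r "[]"] by simp
        finally show "reduce r = reduce (t @ (z l @ q) @ word_inv t)" by simp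
        show "reduce (t @ s) = reduce (t @ q @ word_inv t)"
          using reduce_cancel_mid[of "t @ word_inv t" "t @ s" "[]"] by (simp add: len)
      qed
      then have "N \<le> length (reduce r) + length (reduce (t @ s))" by (rule min)
      also have "\<dots> \<le> length r + length (t @ s)" by (intro add_mono length_reduce_le)
      also have "\<dots> \<le> (length (z l) - 2 * h) + 2 * h" using len by (simp add: r_def)
      also have "\<dots> < N" using z_ce[OF \<open>fst l \<noteq> fst l'\<close>] z_ne[of l'] h(3) by (cases "z l'") auto
      finally show False by simp
    qed
  qed
  have letter: "\<exists>l. z l = [k]" for k
  proof -
    obtain w where w: "reduce (ev x y w) = [k]" using gen unfolding generates_def by (metis reduce_reduced reduced.simps(3))
    have "length (reduce w) \<le> length (reduce (ev x y (reduce w)))"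
      unfolding ev_def
      by (rule length_le_reduce_subst)
        (use z_red[unfolded z_def ev_def] z_ne[unfolded z_def ev_def] in simp_all, use c2[unfolded z_def ev_def] in blast,
          use c3[unfolded z_def ev_def] in blast)
    moreover have eq: "reduce (ev x y (reduce w)) = [k]"
      using w by (simp add: ev_def reduce_subst_reduce)
    ultimately have "length (reduce w) \<le> 1" by simp
    moreover have "reduce w \<noteq> []" using eq by auto
    ultimately obtain l where "reduce w = [l]" by (cases "reduce w") auto
    then have "z l = [k]" using eq z_red[of l] by (simp add: z_def)
    then show ?thesis by blast
  qed
  obtain la lb where lab: "z la = [La]" "z lb = [Lb]" using letter by blast
  have "la \<noteq> lb" using lab by auto
  moreover have "lb \<noteq> letter_inv la" using lab z_inv[of la] by auto
  ultimately have "fst la \<noteq> fst lb" using same_or_ne by blast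
  then have "counterexample [La] [Lb]" using z_ce[of la lb] lab by simp
  moreover have "positive_length (ev [La] [Lb])"
    unfolding positive_length_def by (intro exI[of _ "[]"] exI[of _ False]) (simp add: ev_letters)
  ultimately show False by (simp add: counterexample_def)
qed

subsection \<open>Automorphisms\<close>

lemma auto_reduce_ev:
  assumes "\<phi> \<in> auto F2"
  shows "\<phi> (reduce w) = reduce (ev (\<phi> [La]) (\<phi> [Lb]) w)"
proof -
  interpret group F2 by (rule group_F2)
  have hom: "\<phi> \<in> hom F2 F2" using assms by (simp add: auto_def)
  have car: "\<phi> w \<in> carrier F2" if "reduced w" for w
    using hom that by (auto simp: hom_def)
  have mult: "\<phi> (reduce (u @ v)) = reduce (\<phi> (reduce u) @ \<phi> (reduce v))" for u v
    using hom_mult[OF hom, of "reduce u" "reduce v"] by (simp add: F2_def)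
  have one: "\<phi> [] = []" using hom_one[OF hom is_group is_group] by (simp add: F2_def)
  have letter: "\<phi> [l] = reduce (ev (\<phi> [La]) (\<phi> [Lb]) [l])" for l
  proof -
    obtain x p where l: "l = (x, p)" by (cases l)
    have neg: "\<phi> [(x, False)] = reduce (word_inv (\<phi> [(x, True)]))" for x
    proof -
      have "inv\<^bsub>F2\<^esub> [(x, True)] = [(x, False)]" by (simp add: inv_F2)
      moreover have "\<phi> (inv\<^bsub>F2\<^esub> [(x, True)]) = inv\<^bsub>F2\<^esub> (\<phi> [(x, True)])"
        using group_hom.hom_inv[of F2 F2 \<phi> "[(x, True)]"] hom
        by (simp add: group_hom_def group_hom_axioms_def is_group)
      ultimately show ?thesis using car[of "[(x, True)]"] by (simp add: inv_F2)
    qed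
    show ?thesis unfolding l
      using car[of "[La]"] car[of "[Lb]"] by (cases x; cases p) (auto simp: neg)
  qed
  show ?thesis
  proof (induction w)
    case (Cons l w)
    have "\<phi> (reduce ([l] @ w)) = reduce (\<phi> [l] @ \<phi> (reduce w))" using mult[of "[l]" w] by simp
    also have "\<dots> = reduce (ev (\<phi> [La]) (\<phi> [Lb]) ([l] @ w))"
      unfolding ev_simps by (intro reduce_cong_append) (use letter[of l] Cons in simp_all)
    finally show ?case by simp
  qed (simp add: one)
qed

lemma auto_positive_length:
  assumes "\<phi> \<in> auto F2"
  shows "\<exists>m i. \<forall>w. cyc_length (\<phi> (reduce w)) = clen (mapp m (if i then iota w else w))"
proof -
  let ?x = "\<phi> [La]" and ?y = "\<phi> [Lb]"
  have "generates ?x ?y"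
    unfolding generates_def
  proof
    fix v
    have "reduce v \<in> \<phi> ` carrier F2"
      using assms by (auto simp: auto_def Bij_def bij_betw_def)
    then obtain w where "reduced w" "\<phi> w = reduce v" by auto
    then show "\<exists>w. reduce (ev ?x ?y w) = reduce v" using auto_reduce_ev[OF assms, of w] by auto
  qed
  then have "positive_length (ev ?x ?y)" using no_counterexample[of ?x ?y] by (simp add: counterexample_def)
  then show ?thesis by (simp add: positive_length_def auto_reduce_ev[OF assms] clen_def)
qed


section \<open>A library of computable functions\<close>

definition computable :: "nat \<Rightarrow> (nat list \<Rightarrow> nat) \<Rightarrow> bool" where
  "computable n F \<longleftrightarrow> (\<exists>r. \<forall>xs. length xs = n \<longrightarrow> rec_eval r xs (F xs))"

lemma computable_cong:
  "computable n F \<Longrightarrow> (\<And>xs. length xs = n \<Longrightarrow> F xs = G xs) \<Longrightarrow> computable n G"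
  unfolding computable_def by metis

lemma computable_zero: "computable n (\<lambda>_. 0)"
  unfolding computable_def by (auto intro: rec_eval.Zero)

lemma computable_nth: "i < n \<Longrightarrow> computable n (\<lambda>xs. xs ! i)"
  unfolding computable_def by (auto intro!: exI[of _ "Proj i"] rec_eval.Proj)

lemma computable_comp1:
  assumes "computable 1 (\<lambda>ys. f (ys ! 0))" "computable n G"
  shows "computable n (\<lambda>xs. f (G xs))"
proof -
  obtain r where r: "\<And>ys. length ys = 1 \<Longrightarrow> rec_eval r ys (f (ys ! 0))"
    using assms(1) unfolding computable_def by blast
  obtain s where s: "\<And>xs. length xs = n \<Longrightarrow> rec_eval s xs (G xs)" using assms(2) unfolding computable_def by blast
  have "rec_eval (Comp r [s]) xs (f (G xs))" if "length xs = n" for xs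
    by (rule rec_eval.Comp[where ys = "[G xs]"]) (use r[of "[G xs]"] s that in auto)
  then show ?thesis unfolding computable_def by blast
qed

lemma computable_comp2:
  assumes "computable 2 (\<lambda>ys. f (ys ! 0) (ys ! 1))" "computable n G" "computable n H"
  shows "computable n (\<lambda>xs. f (G xs) (H xs))"
proof -
  obtain r where r: "\<And>ys. length ys = 2 \<Longrightarrow> rec_eval r ys (f (ys ! 0) (ys ! 1))"
    using assms(1) unfolding computable_def by blast
  obtain s where s: "\<And>xs. length xs = n \<Longrightarrow> rec_eval s xs (G xs)" using assms(2) unfolding computable_def by blast
  obtain t where t: "\<And>xs. length xs = n \<Longrightarrow> rec_eval t xs (H xs)" using assms(3) unfolding computable_def by blast
  have "rec_eval (Comp r [s, t]) xs (f (G xs) (H xs))" if "length xs = n" for xs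
    by (rule rec_eval.Comp[where ys = "[G xs, H xs]"]) (use r[of "[G xs, H xs]"] s t that in auto)
  then show ?thesis unfolding computable_def by blast
qed

lemma computable_Suc: "computable n G \<Longrightarrow> computable n (\<lambda>xs. Suc (G xs))"
proof (rule computable_comp1[where f = Suc])
  have "rec_eval Succ ys (Suc (ys ! 0))" if "length ys = 1" for ys
    using that rec_eval.Succ[of "ys ! 0"] by (cases ys) auto
  then show "computable 1 (\<lambda>ys. Suc (ys ! 0))" unfolding computable_def by blast
qed

lemma computable_rec_nat:
  assumes "computable n F" "computable (Suc (Suc n)) G"
  shows "computable (Suc n) (\<lambda>xs. rec_nat (F (tl xs)) (\<lambda>k a. G (k # a # tl xs)) (hd xs))"
proof -
  obtain r where r: "\<And>xs. length xs = n \<Longrightarrow> rec_eval r xs (F xs)" using assms(1) unfolding computable_def by blast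
  obtain s where s: "\<And>xs. length xs = Suc (Suc n) \<Longrightarrow> rec_eval s xs (G xs)" using assms(2) unfolding computable_def by blast
  have "rec_eval (Prim_Rec r s) (k # xs) (rec_nat (F xs) (\<lambda>k a. G (k # a # xs)) k)" if "length xs = n" for k xs
  proof (induction k)
    case 0
    show ?case using rec_eval.Prim_Rec_0[OF r[OF that]] by simp
  next
    case (Suc k)
    show ?case using rec_eval.Prim_Rec_Suc[OF Suc s] that by simp
  qed
  then have "rec_eval (Prim_Rec r s) xs (rec_nat (F (tl xs)) (\<lambda>k a. G (k # a # tl xs)) (hd xs))"
    if "length xs = Suc n" for xs
    using that by (cases xs) auto
  then show ?thesis unfolding computable_def by blast
qed

text \<open>Unbounded search, total because a zero exists for every argument list. It serves to
  invert the pairing function.\<close>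

lemma computable_Least:
  assumes "computable (Suc n) F" "\<And>xs. length xs = n \<Longrightarrow> \<exists>k. F (k # xs) = 0"
  shows "computable n (\<lambda>xs. LEAST k. F (k # xs) = 0)"
proof -
  obtain r where r: "\<And>xs. length xs = Suc n \<Longrightarrow> rec_eval r xs (F xs)" using assms(1) unfolding computable_def by blast
  have "rec_eval (Mu r) xs (LEAST k. F (k # xs) = 0)" if xs: "length xs = n" for xs
  proof (rule rec_eval.Mu)
    have "F ((LEAST k. F (k # xs) = 0) # xs) = 0" using LeastI_ex[OF assms(2)[OF xs]] .
    then show "rec_eval r ((LEAST k. F (k # xs) = 0) # xs) 0" using r[of "(LEAST k. F (k # xs) = 0) # xs"] xs by simp
    show "\<forall>m<LEAST k. F (k # xs) = 0. \<exists>k. rec_eval r (m # xs) (Suc k)"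
    proof (intro allI impI)
      fix m assume "m < (LEAST k. F (k # xs) = 0)"
      then have "F (m # xs) \<noteq> 0" by (rule not_less_Least)
      then obtain k where "F (m # xs) = Suc k" by (cases "F (m # xs)") auto
      then show "\<exists>k. rec_eval r (m # xs) (Suc k)" using r[of "m # xs"] xs by auto
    qed
  qed
  then show ?thesis unfolding computable_def by blast
qed

lemma computable_rec2:
  assumes "computable 1 (\<lambda>xs. f (xs ! 0))" "computable 3 (\<lambda>xs. g (xs ! 0) (xs ! 1) (xs ! 2))"
    and "\<And>y. h 0 y = f y" "\<And>x y. h (Suc x) y = g x (h x y) y"
  shows "computable 2 (\<lambda>xs. h (xs ! 0) (xs ! 1))"
proof -
  have rec: "rec_nat (f y) (\<lambda>k a. g k a y) x = h x y" for x y
    by (induction x) (simp_all add: assms(3,4))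
  have "computable (Suc 1) (\<lambda>xs. rec_nat (f (tl xs ! 0))
      (\<lambda>k a. g ((k # a # tl xs) ! 0) ((k # a # tl xs) ! 1) ((k # a # tl xs) ! 2)) (hd xs))"
    using assms(2) by (intro computable_rec_nat[OF assms(1)]) (simp add: eval_nat_numeral)
  then show ?thesis
    unfolding Suc_1
  proof (rule computable_cong)
    fix xs :: "nat list" assume "length xs = 2"
    then obtain x y where xs: "xs = [x, y]" by (auto simp: numeral_2_eq_2 length_Suc_conv)
    show "rec_nat (f (tl xs ! 0)) (\<lambda>k a. g ((k # a # tl xs) ! 0) ((k # a # tl xs) ! 1) ((k # a # tl xs) ! 2)) (hd xs)
        = h (xs ! 0) (xs ! 1)"
      by (simp add: xs rec)
  qed
qed

lemma computable_rec1:
  assumes "computable 3 (\<lambda>xs. g (xs ! 0) (xs ! 1))" "h 0 = 0" "\<And>x. h (Suc x) = g x (h x)" "computable n G"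
  shows "computable n (\<lambda>xs. h (G xs))"
proof -
  have "computable 2 (\<lambda>xs. h (xs ! 0))"
    by (rule computable_rec2[where h = "\<lambda>x _. h x"]) (rule computable_zero, rule assms(1), simp_all add: assms)
  then show ?thesis by (rule computable_comp2[where f = "\<lambda>x _. h x"]) (rule assms(4))+
qed

lemma computable_add: "computable n G \<Longrightarrow> computable n H \<Longrightarrow> computable n (\<lambda>xs. G xs + H xs)"
proof (rule computable_comp2[where f = "(+)"])
  show "computable 2 (\<lambda>xs. xs ! 0 + xs ! 1)"
    by (rule computable_rec2[where f = "\<lambda>y. y" and g = "\<lambda>_ a _. Suc a"];
        (intro computable_Suc computable_nth)?; simp)
qed

lemma computable_pred: "computable n G \<Longrightarrow> computable n (\<lambda>xs. G xs - 1)"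
  by (rule computable_rec1[where g = "\<lambda>k _. k"]) (auto intro: computable_nth)

lemma computable_diff: "computable n G \<Longrightarrow> computable n H \<Longrightarrow> computable n (\<lambda>xs. G xs - H xs)"
proof (rule computable_comp2[where f = "\<lambda>x y. y - x" and G = H and H = G])
  show "computable 2 (\<lambda>xs. xs ! 1 - xs ! 0)"
    by (rule computable_rec2[where f = "\<lambda>y. y" and g = "\<lambda>_ a _. a - 1" and h = "\<lambda>x y. y - x"];
        (intro computable_pred computable_nth)?; simp)
qed

lemma computable_triangle: "computable n G \<Longrightarrow> computable n (\<lambda>xs. triangle (G xs))"
  by (rule computable_rec1[where g = "\<lambda>k a. a + Suc k"]) (auto intro!: computable_add computable_Suc computable_nth)

lemma computable_prod_encode:
  "computable n G \<Longrightarrow> computable n H \<Longrightarrow> computable n (\<lambda>xs. prod_encode (G xs, H xs))"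
  by (simp add: prod_encode_def) (intro computable_add computable_triangle)

lemma triangle_mono: "i \<le> j \<Longrightarrow> triangle i \<le> triangle j"
  by (induction j) (auto simp: le_Suc_eq)

text \<open>The pair lies on the diagonal numbered a + b, whose codes are those from
  \<open>triangle (a + b)\<close> up to, but excluding, the next triangular number.\<close>

lemma Least_triangle: "(LEAST k. Suc (prod_encode (a, b)) - triangle (Suc k) = 0) = a + b"
proof (rule Least_equality)
  show "Suc (prod_encode (a, b)) - triangle (Suc (a + b)) = 0" by (simp add: prod_encode_def)
  fix k assume k: "Suc (prod_encode (a, b)) - triangle (Suc k) = 0"
  show "a + b \<le> k"
  proof (rule ccontr)
    assume "\<not> a + b \<le> k"
    then have "triangle (Suc k) \<le> triangle (a + b)" by (intro triangle_mono) simp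
    then show False using k by (simp add: prod_encode_def)
  qed
qed

lemma computable_root: "computable n G \<Longrightarrow> computable n (\<lambda>xs. fst (prod_decode (G xs)) + snd (prod_decode (G xs)))"
proof (rule computable_comp1[where f = "\<lambda>x. fst (prod_decode x) + snd (prod_decode x)"])
  have "computable 1 (\<lambda>xs. LEAST k. Suc ((k # xs) ! 1) - triangle (Suc ((k # xs) ! 0)) = 0)"
  proof (rule computable_Least[where F = "\<lambda>ys. Suc (ys ! 1) - triangle (Suc (ys ! 0))"])
    show "computable (Suc 1) (\<lambda>ys. Suc (ys ! 1) - triangle (Suc (ys ! 0)))"
      by (intro computable_diff computable_Suc computable_triangle computable_nth) auto
    fix xs :: "nat list" assume "length xs = 1"
    obtain a b where "xs ! 0 = prod_encode (a, b)" by (metis prod_decode_inverse surj_pair)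
    then show "\<exists>k. Suc ((k # xs) ! 1) - triangle (Suc ((k # xs) ! 0)) = 0"
      by (intro exI[of _ "a + b"]) (simp add: prod_encode_def)
  qed
  then show "computable 1 (\<lambda>ys. fst (prod_decode (ys ! 0)) + snd (prod_decode (ys ! 0)))"
  proof (rule computable_cong)
    fix xs :: "nat list"
    obtain a b where ab: "xs ! 0 = prod_encode (a, b)" by (metis prod_decode_inverse surj_pair)
    show "(LEAST k. Suc ((k # xs) ! 1) - triangle (Suc ((k # xs) ! 0)) = 0) =
        fst (prod_decode (xs ! 0)) + snd (prod_decode (xs ! 0))"
      using Least_triangle[of a b] by (simp add: ab)
  qed
qed

lemma computable_fst_decode:
  assumes "computable n G" shows "computable n (\<lambda>xs. fst (prod_decode (G xs)))"
proof (rule computable_cong[OF computable_diff[OF assms computable_triangle[OF computable_root[OF assms]]]])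
  fix xs
  obtain a b where ab: "G xs = prod_encode (a, b)" by (metis prod_decode_inverse surj_pair)
  show "G xs - triangle (fst (prod_decode (G xs)) + snd (prod_decode (G xs))) = fst (prod_decode (G xs))"
    by (simp add: ab) (simp add: prod_encode_def)
qed

lemma computable_snd_decode:
  assumes "computable n G" shows "computable n (\<lambda>xs. snd (prod_decode (G xs)))"
  by (rule computable_cong[OF computable_diff[OF computable_root[OF assms] computable_fst_decode[OF assms]]]) simp

lemma computable_if:
  assumes "computable n C" "computable n F" "computable n G"
  shows "computable n (\<lambda>xs. if C xs = 0 then F xs else G xs)"
proof -
  have "computable 2 (\<lambda>xs. if xs ! 0 = 0 then xs ! 1 else 0)"
    by (rule computable_rec2[where g = "\<lambda>_ _ _. 0"]) (auto intro: computable_zero computable_nth)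
  then have guard: "computable n (\<lambda>xs. if D xs = 0 then F xs else 0)"
    if "computable n D" "computable n F" for D F
    using computable_comp2[of "\<lambda>x y. if x = 0 then y else 0" n D F] that by simp
  have "computable n (\<lambda>xs. 1 - C xs)"
    by (intro computable_diff computable_cong[OF computable_Suc[OF computable_zero]] assms) simp
  then have "computable n (\<lambda>xs. (if C xs = 0 then F xs else 0) + (if 1 - C xs = 0 then G xs else 0))"
    by (intro computable_add guard assms)
  then show ?thesis by (rule computable_cong) auto
qed

lemma computable_funpow:
  assumes "computable 1 (\<lambda>ys. f (ys ! 0))" "computable n G" "computable n H"
  shows "computable n (\<lambda>xs. (f ^^ G xs) (H xs))"
proof (rule computable_comp2[OF _ assms(2,3)])
  show "computable 2 (\<lambda>xs. (f ^^ (xs ! 0)) (xs ! 1))"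
    by (rule computable_rec2[where f = "\<lambda>y. y" and g = "\<lambda>_ a _. f a"];
        (intro computable_comp1[OF assms(1)] computable_nth)?; simp)
qed

section \<open>Computability on coded data types\<close>

class coded =
  fixes code :: "'a \<Rightarrow> nat"

instantiation nat :: coded
begin
definition code_nat :: "nat \<Rightarrow> nat" where "code_nat n = n"
instance ..
end

instantiation bool :: coded
begin
definition code_bool :: "bool \<Rightarrow> nat" where "code_bool b = of_bool b"
instance ..
end

instantiation prod :: (coded, coded) coded
begin
definition code_prod :: "'a \<times> 'b \<Rightarrow> nat" where "code_prod p = prod_encode (code (fst p), code (snd p))"
instance ..
end

instantiation list :: (coded) coded
begin
definition code_list :: "'a list \<Rightarrow> nat" where "code_list xs = list_encode (map code xs)"
instance ..
end

text \<open>The numerical function is total and constrained only on codes, so that no test whether a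
  number is a code is ever required.\<close>

definition cpt :: "('a::coded \<Rightarrow> 'b::coded) \<Rightarrow> bool" where
  "cpt f \<longleftrightarrow> (\<exists>g. computable 1 (\<lambda>xs. g (xs ! 0)) \<and> (\<forall>x. g (code x) = code (f x)))"

lemma cptI: "computable 1 (\<lambda>xs. g (xs ! 0)) \<Longrightarrow> (\<And>x. g (code x) = code (f x)) \<Longrightarrow> cpt f"
  by (auto simp: cpt_def)

lemma cptI1:
  assumes "\<And>n G. computable n G \<Longrightarrow> computable n (\<lambda>xs. h (G xs))"
    and "cpt f" "\<And>x. h (code (f x)) = code (k x)"
  shows "cpt k"
proof -
  obtain f' where f: "computable 1 (\<lambda>xs. f' (xs ! 0))" "\<And>x. f' (code x) = code (f x)"
    using assms(2) unfolding cpt_def by blast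
  show ?thesis by (rule cptI[OF assms(1)[OF f(1)]]) (simp add: f(2) assms(3))
qed

lemma cptI2:
  assumes "\<And>n G H. computable n G \<Longrightarrow> computable n H \<Longrightarrow> computable n (\<lambda>xs. h (G xs) (H xs))"
    and "cpt f" "cpt g" "\<And>x. h (code (f x)) (code (g x)) = code (k x)"
  shows "cpt k"
proof -
  obtain f' where f: "computable 1 (\<lambda>xs. f' (xs ! 0))" "\<And>x. f' (code x) = code (f x)"
    using assms(2) unfolding cpt_def by blast
  obtain g' where g: "computable 1 (\<lambda>xs. g' (xs ! 0))" "\<And>x. g' (code x) = code (g x)"
    using assms(3) unfolding cpt_def by blast
  show ?thesis by (rule cptI[OF assms(1)[OF f(1) g(1)]]) (simp add: f(2) g(2) assms(4))
qed

lemma cpt_id: "cpt (\<lambda>x. x)"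
  by (rule cptI[OF computable_nth]) auto

lemma cpt_comp:
  assumes "cpt g" "cpt f" shows "cpt (\<lambda>x. g (f x))"
proof -
  obtain g' where g: "computable 1 (\<lambda>xs. g' (xs ! 0))" "\<And>x. g' (code x) = code (g x)"
    using assms(1) unfolding cpt_def by blast
  show ?thesis
    by (rule cptI1[where h = g' and f = f]) (rule computable_comp1[OF g(1)], simp_all add: assms g(2))
qed

lemma cpt_const: "cpt (\<lambda>_. c)"
proof (rule cptI)
  have "computable 1 (\<lambda>_. k)" for k
    by (induction k) (auto intro: computable_zero computable_Suc)
  then show "computable 1 (\<lambda>xs. (\<lambda>_. code c) (xs ! 0))" by simp
qed simp

lemma cpt_Pair: "cpt f \<Longrightarrow> cpt g \<Longrightarrow> cpt (\<lambda>x. (f x, g x))"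
  by (rule cptI2[OF computable_prod_encode, where f = f and g = g]) (simp_all add: code_prod_def)

lemma cpt_fst: assumes "cpt f" shows "cpt (\<lambda>x. fst (f x))"
  by (rule cptI1[where h = "\<lambda>n. fst (prod_decode n)", OF computable_fst_decode assms]) (simp_all add: code_prod_def)

lemma cpt_snd: assumes "cpt f" shows "cpt (\<lambda>x. snd (f x))"
  by (rule cptI1[where h = "\<lambda>n. snd (prod_decode n)", OF computable_snd_decode assms]) (simp_all add: code_prod_def)

lemma cpt_comp2:
  assumes "cpt (\<lambda>p. F (fst p) (snd p))" "cpt f" "cpt g" shows "cpt (\<lambda>x. F (f x) (g x))"
  using cpt_comp[OF assms(1) cpt_Pair[OF assms(2,3)]] by simp

lemma cpt_Suc: "cpt f \<Longrightarrow> cpt (\<lambda>x. Suc (f x))"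
  by (rule cptI1[OF computable_Suc, where f = f]) (simp_all add: code_nat_def)

lemma cpt_add: "cpt f \<Longrightarrow> cpt g \<Longrightarrow> cpt (\<lambda>x. f x + g x :: nat)"
  by (rule cptI2[OF computable_add, where f = f and g = g]) (simp_all add: code_nat_def)

lemma cpt_diff: "cpt f \<Longrightarrow> cpt g \<Longrightarrow> cpt (\<lambda>x. f x - g x :: nat)"
  by (rule cptI2[OF computable_diff, where f = f and g = g]) (simp_all add: code_nat_def)

lemma cpt_if:
  assumes "cpt b" "cpt f" "cpt g"
  shows "cpt (\<lambda>x. if b x then f x else g x)"
proof -
  obtain b' where b: "computable 1 (\<lambda>xs. b' (xs ! 0))" "\<And>x. b' (code x) = code (b x)" using assms(1) unfolding cpt_def by blast
  obtain f' where f: "computable 1 (\<lambda>xs. f' (xs ! 0))" "\<And>x. f' (code x) = code (f x)" using assms(2) unfolding cpt_def by blast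
  obtain g' where g: "computable 1 (\<lambda>xs. g' (xs ! 0))" "\<And>x. g' (code x) = code (g x)" using assms(3) unfolding cpt_def by blast
  show ?thesis
    by (rule cptI[where g = "\<lambda>x. if b' x = 0 then g' x else f' x"])
      (rule computable_if[OF b(1) g(1) f(1)], simp add: b(2) f(2) g(2) code_bool_def)
qed

lemma cpt_le:
  assumes "cpt f" "cpt g" shows "cpt (\<lambda>x. f x \<le> (g x :: nat))"
proof -
  \<comment> \<open>Truncated subtraction yields 1 or 0, which is already the code of the truth
    value.\<close>
  have "cpt (\<lambda>x. 1 - (f x - g x))" by (intro cpt_diff cpt_const assms)
  moreover have "code (1 - (f x - g x)) = code (f x \<le> g x)" for x
    by (auto simp: code_bool_def code_nat_def)
  ultimately show ?thesis unfolding cpt_def by simp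
qed

lemma cpt_conj: assumes "cpt f" "cpt g" shows "cpt (\<lambda>x. f x \<and> g x)"
proof -
  have "cpt (\<lambda>x. if f x then g x else False)" by (intro cpt_if cpt_const assms)
  moreover have "(\<lambda>x. if f x then g x else False) = (\<lambda>x. f x \<and> g x)" by auto
  ultimately show ?thesis by simp
qed

lemma cpt_eq_bool: "cpt f \<Longrightarrow> cpt g \<Longrightarrow> cpt (\<lambda>x. f x = (g x :: bool))"
proof -
  assume f: "cpt f" and g: "cpt g"
  have "cpt (\<lambda>x. if f x then g x else if g x then False else True)"
    by (intro cpt_if f g cpt_const)
  moreover have "(\<lambda>x. if f x then g x else if g x then False else True) = (\<lambda>x. f x = g x)" by auto
  ultimately show ?thesis by simp
qed

lemma cpt_eq: "cpt f \<Longrightarrow> cpt g \<Longrightarrow> cpt (\<lambda>x. f x = (g x :: nat))"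
proof -
  assume f: "cpt f" and g: "cpt g"
  have "cpt (\<lambda>x. f x \<le> g x \<and> g x \<le> f x)" by (intro cpt_conj cpt_le f g)
  then show ?thesis by (simp add: eq_iff)
qed

lemma code_Nil: "code [] = 0"
  by (simp add: code_list_def)

lemma code_Cons: "code (x # xs) = Suc (prod_encode (code x, code xs))"
  by (simp add: code_list_def)

lemma cpt_Cons: "cpt f \<Longrightarrow> cpt g \<Longrightarrow> cpt (\<lambda>x. f x # g x)"
  by (rule cptI2[OF computable_Suc[OF computable_prod_encode], where f = f and g = g]) (simp_all add: code_Cons)

lemma cpt_case_list:
  assumes "cpt l" "cpt n" "cpt (\<lambda>p. c (fst p) (fst (snd p)) (snd (snd p)))"
  shows "cpt (\<lambda>x. case l x of [] \<Rightarrow> n x | y # ys \<Rightarrow> c x y ys)"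
proof -
  obtain l' where l: "computable 1 (\<lambda>xs. l' (xs ! 0))" "\<And>x. l' (code x) = code (l x)" using assms(1) unfolding cpt_def by blast
  obtain n' where n: "computable 1 (\<lambda>xs. n' (xs ! 0))" "\<And>x. n' (code x) = code (n x)" using assms(2) unfolding cpt_def by blast
  obtain c' where c: "computable 1 (\<lambda>xs. c' (xs ! 0))"
      "\<And>x. c' (code x) = code (c (fst x) (fst (snd x)) (snd (snd x)))"
    using assms(3) unfolding cpt_def by blast
  have c_code: "c' (prod_encode (code x, prod_encode (code y, code ys))) = code (c x y ys)" for x y ys
    using c(2)[of "(x, y, ys)"] by (simp add: code_prod_def)
  show ?thesis
  proof (rule cptI[where g = "\<lambda>x. if l' x = 0 then n' x else c' (prod_encode (x, l' x - 1))"])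
    show "computable 1 (\<lambda>xs. if l' (xs ! 0) = 0 then n' (xs ! 0) else c' (prod_encode (xs ! 0, l' (xs ! 0) - 1)))"
      by (intro computable_if l n computable_comp1[OF c(1)] computable_prod_encode computable_pred computable_nth) simp
    fix x
    show "(if l' (code x) = 0 then n' (code x) else c' (prod_encode (code x, l' (code x) - 1)))
        = code (case l x of [] \<Rightarrow> n x | y # ys \<Rightarrow> c x y ys)"
      by (cases "l x") (simp_all add: l n code_Nil code_Cons c_code)
  qed
qed

lemma cpt_funpow:
  fixes F :: "'a::coded \<Rightarrow> 'a"
  assumes "cpt F" "cpt n" "cpt s"
  shows "cpt (\<lambda>x. (F ^^ n x) (s x))"
proof -
  obtain F' where F: "computable 1 (\<lambda>xs. F' (xs ! 0))" "\<And>x. F' (code x) = code (F x)" using assms(1) unfolding cpt_def by blast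
  obtain n' where n: "computable 1 (\<lambda>xs. n' (xs ! 0))" "\<And>x. n' (code x) = code (n x)" using assms(2) unfolding cpt_def by blast
  obtain s' where s: "computable 1 (\<lambda>xs. s' (xs ! 0))" "\<And>x. s' (code x) = code (s x)" using assms(3) unfolding cpt_def by blast
  have "(F' ^^ k) (code x) = code ((F ^^ k) x)" for k x by (induction k) (simp_all add: F)
  then show ?thesis
    by (intro cptI[where g = "\<lambda>x. (F' ^^ n' x) (s' x)"] computable_funpow[OF F(1) n(1) s(1)])
      (simp add: n s code_nat_def)
qed

lemma length_le_code: "length xs \<le> code xs"
proof (induction xs)
  case (Cons x xs)
  have "code xs \<le> prod_encode (code x, code xs)" by (rule le_prod_encode_2)
  then show ?case using Cons by (simp add: code_Cons)
qed simp

lemma cpt_code: "cpt (\<lambda>x. code x)"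
  by (rule cptI[OF computable_nth[of 0 1]]) (simp_all add: code_nat_def)

text \<open>The fold over a list is iterated as often as the code of the list says, which is at least
  its length; superfluous iterations do nothing.\<close>

lemma cpt_fold:
  assumes F: "cpt (\<lambda>p. F (fst p) (snd p))" and l: "cpt l" and s: "cpt s"
  shows "cpt (\<lambda>x. fold F (l x) (s x))"
proof -
  define G where "G = (\<lambda>p. case fst p of [] \<Rightarrow> p | y # ys \<Rightarrow> (ys, F y (snd p)))"
  have "cpt G"
    unfolding G_def
    by (intro cpt_case_list cpt_id cpt_fst cpt_Pair cpt_snd cpt_comp2[OF F])
  have run: "length xs \<le> n \<Longrightarrow> (G ^^ n) (xs, a) = ([], fold F xs a)" for n xs a
  proof (induction n arbitrary: xs a)
    case (Suc n)
    then show ?case by (cases xs) (simp_all del: funpow.simps add: funpow_Suc_right G_def)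
  qed simp
  have "cpt (\<lambda>x. snd ((G ^^ code (l x)) (l x, s x)))"
    by (intro cpt_snd cpt_funpow \<open>cpt G\<close> cpt_comp[OF cpt_code l] cpt_Pair l s)
  then show ?thesis by (simp add: run length_le_code)
qed

lemma cpt_foldr:
  assumes F: "cpt (\<lambda>p. F (fst p) (snd p))" and l: "cpt l" and s: "cpt s"
  shows "cpt (\<lambda>x. foldr F (l x) (s x))"
proof -
  have "cpt (\<lambda>x. fold (#) (l x) [])"
    by (intro cpt_fold cpt_Cons cpt_fst cpt_snd cpt_id l cpt_const)
  then have "cpt (\<lambda>x. fold F (fold (#) (l x) []) (s x))" by (rule cpt_fold[OF F _ s])
  then show ?thesis by (simp add: fold_Cons_rev foldr_conv_fold)
qed

lemma cpt_append: "cpt f \<Longrightarrow> cpt g \<Longrightarrow> cpt (\<lambda>x. f x @ g x)"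
proof -
  assume "cpt f" "cpt g"
  then have "cpt (\<lambda>x. foldr (#) (f x) (g x))" by (intro cpt_foldr cpt_Cons cpt_fst cpt_snd cpt_id)
  moreover have "foldr (#) xs ys = xs @ ys" for xs ys :: "'b list" by (induction xs) auto
  ultimately show ?thesis by simp
qed

lemma cpt_length: "cpt f \<Longrightarrow> cpt (\<lambda>x. length (f x))"
proof -
  assume "cpt f"
  then have "cpt (\<lambda>x. foldr (\<lambda>_ n. Suc n) (f x) 0)" by (intro cpt_foldr cpt_Suc cpt_snd cpt_id cpt_const)
  moreover have "foldr (\<lambda>_ n. Suc n) xs 0 = length xs" for xs :: "'b list" by (induction xs) auto
  ultimately show ?thesis by simp
qed

lemma cpt_concat_map:
  assumes g: "cpt g" and f: "cpt f"
  shows "cpt (\<lambda>x. concat (map g (f x)))"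
proof -
  have "cpt (\<lambda>x. foldr (\<lambda>y acc. g y @ acc) (f x) [])"
    by (intro cpt_foldr cpt_append cpt_comp[OF g] cpt_fst cpt_snd cpt_id cpt_const f)
  moreover have "foldr (\<lambda>y acc. g y @ acc) xs [] = concat (map g xs)" for xs by (induction xs) auto
  ultimately show ?thesis by simp
qed

lemma cpt_map:
  assumes g: "cpt g" and f: "cpt f"
  shows "cpt (\<lambda>x. map g (f x))"
proof -
  have "cpt (\<lambda>x. concat (map (\<lambda>y. [g y]) (f x)))"
    by (intro cpt_concat_map cpt_Cons g f cpt_const)
  then show ?thesis by (simp add: concat_map_singleton)
qed

lemma cpt_list_all:
  assumes P: "cpt P" and f: "cpt f"
  shows "cpt (\<lambda>x. list_all P (f x))"
proof -
  have "cpt (\<lambda>x. foldr (\<lambda>y acc. P y \<and> acc) (f x) True)"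
    by (intro cpt_foldr cpt_conj cpt_comp[OF P] cpt_fst cpt_snd cpt_id cpt_const f)
  moreover have "foldr (\<lambda>y acc. P y \<and> acc) xs True = list_all P xs" for xs by (induction xs) auto
  ultimately show ?thesis by simp
qed

lemma cpt_imp_recf2:
  assumes "cpt (\<lambda>p :: nat list \<times> nat list. D (fst p) (snd p) :: bool)"
  shows "\<exists>r. \<forall>u v. rec_eval r [list_encode u, list_encode v] (if D u v then 1 else 0)"
proof -
  obtain g where g: "computable 1 (\<lambda>xs. g (xs ! 0))" "\<And>p :: nat list \<times> nat list. g (code p) = code (D (fst p) (snd p))"
    using assms unfolding cpt_def by blast
  have "computable 2 (\<lambda>xs. g (prod_encode (xs ! 0, xs ! 1)))"
    by (intro computable_comp1[OF g(1)] computable_prod_encode computable_nth) auto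
  then obtain r where r: "\<And>xs. length xs = 2 \<Longrightarrow> rec_eval r xs (g (prod_encode (xs ! 0, xs ! 1)))"
    unfolding computable_def by blast
  have "rec_eval r [list_encode u, list_encode v] (if D u v then 1 else 0)" for u v
  proof -
    have "map code w = w" for w :: "nat list" by (simp add: code_nat_def map_idI)
    then have "g (prod_encode (list_encode u, list_encode v)) = (if D u v then 1 else 0)"
      using g(2)[of "(u, v)"] by (simp add: code_prod_def code_list_def code_bool_def)
    then show ?thesis using r[of "[list_encode u, list_encode v]"] by simp
  qed
  then show ?thesis by blast
qed


section \<open>Substitutions realised by automorphisms\<close>

definition realised :: "(word \<Rightarrow> word) \<Rightarrow> bool" where
  "realised F \<longleftrightarrow> (\<exists>\<phi>\<in>auto F2. \<forall>w. \<phi> (reduce w) = reduce (F w))"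

lemma realised_subst:
  assumes st: "\<And>x. reduce (subst s (t x)) = [(x, True)]" and ts: "\<And>x. reduce (subst t (s x)) = [(x, True)]"
  shows "realised (subst s)"
proof -
  \<comment> \<open>Members of \<open>auto\<close> are extensional, hence the restriction to reduced
    words.\<close>
  define \<phi> where "\<phi> = restrict (\<lambda>w. reduce (subst s w)) (carrier F2)"
  have inv: "reduce (subst s (subst t w)) = reduce w"
    if "\<And>x. reduce (subst s (t x)) = [(x, True)]" for s t w
    unfolding subst_subst
    using reduce_subst_cong_fun[of "\<lambda>x. subst s (t x)" "\<lambda>x. [(x, True)]" w] that by (simp add: subst_id)
  have "\<phi> \<in> hom F2 F2"
  proof (rule homI)
    fix u v assume "u \<in> carrier F2" "v \<in> carrier F2"
    then show "\<phi> (u \<otimes>\<^bsub>F2\<^esub> v) = \<phi> u \<otimes>\<^bsub>F2\<^esub> \<phi> v"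
      by (simp add: \<phi>_def) (simp add: F2_def reduce_subst_reduce)
  qed (simp add: \<phi>_def)
  moreover have "bij_betw \<phi> (carrier F2) (carrier F2)"
  proof (rule bij_betwI)
    show "\<phi> \<in> carrier F2 \<rightarrow> carrier F2" "(\<lambda>w. reduce (subst t w)) \<in> carrier F2 \<rightarrow> carrier F2"
      by (auto simp: \<phi>_def)
    show "reduce (subst t (\<phi> w)) = w" if "w \<in> carrier F2" for w
      using that inv[OF ts, of w] by (simp add: \<phi>_def reduce_subst_reduce)
    show "\<phi> (reduce (subst t w)) = w" if "w \<in> carrier F2" for w
      using that inv[OF st, of w] by (simp add: \<phi>_def reduce_subst_reduce)
  qed
  moreover have "\<phi> \<in> extensional (carrier F2)" by (simp add: \<phi>_def)
  ultimately have "\<phi> \<in> auto F2" by (simp add: auto_def Bij_def)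
  then show ?thesis unfolding realised_def
    by (rule bexI[rotated]) (simp add: \<phi>_def reduce_subst_reduce)
qed

lemma realised_comp:
  assumes "realised F" "realised G" shows "realised (\<lambda>w. F (G w))"
proof -
  obtain \<phi> \<psi> where \<phi>: "\<phi> \<in> auto F2" "\<And>w. \<phi> (reduce w) = reduce (F w)"
    and \<psi>: "\<psi> \<in> auto F2" "\<And>w. \<psi> (reduce w) = reduce (G w)"
    using assms unfolding realised_def by blast
  have "compose (carrier F2) \<phi> \<psi> \<in> auto F2"
    using subgroup.m_closed[OF group.subgroup_auto[OF group_F2] \<phi>(1) \<psi>(1)] \<phi>(1) \<psi>(1)
    by (simp add: BijGroup_def auto_def)
  moreover have "compose (carrier F2) \<phi> \<psi> (reduce w) = reduce (F (G w))" for w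
    by (simp add: compose_def \<phi>(2) \<psi>(2))
  ultimately show ?thesis unfolding realised_def by blast
qed

lemma realised_id: "realised (\<lambda>w. w)"
proof -
  have "realised (subst (\<lambda>x. [(x, True)]))" by (rule realised_subst[where t = "\<lambda>x. [(x, True)]"]) simp_all
  then show ?thesis by (simp add: realised_def subst_id)
qed

lemma realised_sig: "realised sig"
  unfolding sig_def
  by (rule realised_subst[where t = "\<lambda>x. case x of Gen_a \<Rightarrow> [La, LB] | Gen_b \<Rightarrow> [Lb]"])
    (auto simp: reduce_def split: basis.splits)

lemma realised_swap: "realised swap"
  unfolding swap_subst
  by (rule realised_subst[where t = "\<lambda>x. [(flip_basis x, True)]"]) (simp_all add: reduce_def)

lemma realised_iota: "realised iota"
  unfolding iota_subst
  by (rule realised_subst[where t = "\<lambda>x. [(x, x \<noteq> Gen_b)]"]; case_tac x) (simp_all add: reduce_def)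

lemma realised_funpow_sig: "realised (\<lambda>w. (sig ^^ n) w)"
  by (induction n) (simp_all add: realised_id realised_comp[OF realised_sig])

section \<open>The orbit of a pair of words\<close>

text \<open>Keeping \<open>P\<close> makes the orbits increase with the number of steps, so that all
  compositions of bounded length occur.\<close>

definition orbit_step :: "(word \<times> word) list \<Rightarrow> (word \<times> word) list" where
  "orbit_step P = P @ map (\<lambda>p. (sig (fst p), sig (snd p))) P @
     map (\<lambda>p. (swap (fst p), swap (snd p))) P @ map (\<lambda>p. (iota (fst p), iota (snd p))) P"

definition orbit :: "nat \<Rightarrow> word \<Rightarrow> word \<Rightarrow> (word \<times> word) set" where
  "orbit n u v = set ((orbit_step ^^ n) [(u, v)])"

lemma orbit_0: "(u, v) \<in> orbit n u v"
  by (induction n) (auto simp: orbit_def orbit_step_def)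

lemma orbit_Suc:
  assumes "(p, q) \<in> orbit n u v"
  shows "(p, q) \<in> orbit (Suc n) u v" "(sig p, sig q) \<in> orbit (Suc n) u v"
    "(swap p, swap q) \<in> orbit (Suc n) u v" "(iota p, iota q) \<in> orbit (Suc n) u v"
  using assms by (auto simp: orbit_def orbit_step_def image_iff intro: bexI[of _ "(p, q)"])

lemma orbit_mono: "(p, q) \<in> orbit n u v \<Longrightarrow> n \<le> k \<Longrightarrow> (p, q) \<in> orbit k u v"
proof (induction k)
  case (Suc k)
  then show ?case using orbit_Suc(1) by (cases "n = Suc k") auto
qed simp

lemma orbit_mapp:
  "(p, q) \<in> orbit n u v \<Longrightarrow> (mapp m p, mapp m q) \<in> orbit (n + 3 * length m) u v"
proof (induction m arbitrary: n p q)
  case (Cons s m)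
  have "((if s then sig p else tau p), (if s then sig q else tau q)) \<in> orbit (n + 3) u v"
  proof (cases s)
    case True
    then show ?thesis using orbit_mono[OF orbit_Suc(2)[OF Cons.prems], of "n + 3"] by simp
  next
    case False
    then show ?thesis
      using orbit_Suc(3)[OF orbit_Suc(2)[OF orbit_Suc(3)[OF Cons.prems]]]
      by (simp add: tau_def eval_nat_numeral)
  qed
  from Cons.IH[OF this] show ?case by (simp add: algebra_simps)
qed simp

lemma orbit_realised:
  "(p, q) \<in> orbit n u v \<Longrightarrow> \<exists>F. realised F \<and> p = F u \<and> q = F v"
proof (induction n arbitrary: p q)
  case 0
  then show ?case using realised_id by (auto simp: orbit_def)
next
  case (Suc n)
  then obtain p' q' where pq: "(p', q') \<in> orbit n u v"
    "(p, q) \<in> {(p', q'), (sig p', sig q'), (swap p', swap q'), (iota p', iota q')}"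
    by (auto simp: orbit_def orbit_step_def)
  obtain F where F: "realised F" "p' = F u" "q' = F v" using Suc.IH[OF pq(1)] by blast
  from pq(2) obtain G where "realised G" "p = G p'" "q = G q'"
    using realised_id realised_sig realised_swap realised_iota by auto
  then show ?case using realised_comp[OF \<open>realised G\<close> F(1)] F by auto
qed

section \<open>The criterion\<close>

lemma clen_mapp_pos_iff [simp]: "0 < clen (mapp m w) \<longleftrightarrow> 0 < clen w"
  using clen_mapp_eq_0_iff[of m w] by linarith

text \<open>The number of steps suffices for \<open>iota\<close>, followed by \<open>clen u + clen v\<close> twists (of which \<open>tau\<close> takes
  three steps), followed by \<open>swap\<close>.\<close>

definition criterion :: "word \<Rightarrow> word \<Rightarrow> bool" where
  "criterion u v \<longleftrightarrow>
     list_all (\<lambda>p. elliptic (fst p) = elliptic (snd p)) ((orbit_step ^^ (3 * (clen u + clen v) + 2)) [(u, v)])"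

lemma criterion_iff: "criterion u v \<longleftrightarrow> (\<forall>(p, q) \<in> orbit (3 * (clen u + clen v) + 2) u v. elliptic p = elliptic q)"
  by (auto simp: criterion_def list_all_iff orbit_def)

text \<open>Applying powers of \<open>sig\<close> after \<open>F\<close> keeps the length of
  \<open>F v\<close> constant, while that of \<open>F u\<close> would be unbounded if
  \<open>F u\<close> were not elliptic.\<close>

lemma elliptic_if_ratio_bounded:
  assumes bound: "\<And>F. realised F \<Longrightarrow> real (clen (F u)) \<le> C * real (clen (F v))"
    and F: "realised F" and ell: "elliptic (F v)"
  shows "elliptic (F u)"
proof (rule ccontr)
  assume not_ell: "\<not> elliptic (F u)"
  obtain c where c: "cyc_reduced c" "word_conj (F u) c" using ex_cyc_reduced_word_conj by blast
  have "same Gen_a c > 0"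
    using elliptic_iff_same[OF c(1)] elliptic_cong[OF c(2)] not_ell stats_nonneg(3)[of Gen_a c] by auto
  then have len: "int n \<le> int (clen ((sig ^^ n) (F u))) + turns c + bad Gen_b c" for n
    using funpow_sig_length_ge[OF c(1), of n] clen_cong[OF funpow_sig_cong[OF c(2), of n]] by simp
  define K where "K = \<bar>C\<bar> * real (clen (F v)) + real_of_int (turns c + bad Gen_b c)"
  obtain n :: nat where n: "real n > K" using reals_Archimedean2 by blast
  have "realised (\<lambda>w. (sig ^^ n) (F w))" by (rule realised_comp[OF realised_funpow_sig F])
  then have "real (clen ((sig ^^ n) (F u))) \<le> C * real (clen ((sig ^^ n) (F v)))" by (rule bound)
  also have "clen ((sig ^^ n) (F v)) = clen (F v)" by (rule clen_cong[OF elliptic_funpow[OF ell]])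
  also have "C * real (clen (F v)) \<le> \<bar>C\<bar> * real (clen (F v))" by (intro mult_right_mono) auto
  finally have "real (clen ((sig ^^ n) (F u))) + real_of_int (turns c + bad Gen_b c) \<le> K" by (simp add: K_def)
  moreover have "real_of_int (int n) \<le> real_of_int (int (clen ((sig ^^ n) (F u))) + turns c + bad Gen_b c)"
    using len[of n] by (rule of_int_le_iff[THEN iffD2])
  ultimately show False using n by simp
qed

lemma elliptic_le_if_criterion:
  assumes cr: "\<And>p q. (p, q) \<in> orbit (3 * N + 2) u v \<Longrightarrow> elliptic q \<Longrightarrow> elliptic p" and N: "clen v \<le> N"
  shows "elliptic_le (if i then iota v else v) (if i then iota u else u)"
proof (rule elliptic_le_bounded)
  fix m :: "bool list"
  let ?u = "if i then iota u else u" and ?v = "if i then iota v else v"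
  assume "length m \<le> clen ?v"
  then have len: "length m \<le> N" using N by (simp split: if_splits)
  have "(?u, ?v) \<in> orbit 1 u v" using orbit_Suc[OF orbit_0[of u v 0]] by simp
  then have o: "(mapp m ?u, mapp m ?v) \<in> orbit (1 + 3 * length m) u v" by (rule orbit_mapp)
  have "(mapp m ?u, mapp m ?v) \<in> orbit (3 * N + 2) u v" using orbit_mono[OF o] len by simp
  moreover have "(swap (mapp m ?u), swap (mapp m ?v)) \<in> orbit (3 * N + 2) u v"
    using orbit_mono[OF orbit_Suc(3)[OF o], of "3 * N + 2"] len by simp
  ultimately show "(elliptic (mapp m ?v) \<longrightarrow> elliptic (mapp m ?u)) \<and>
      (elliptic (swap (mapp m ?v)) \<longrightarrow> elliptic (swap (mapp m ?u)))"
    using cr by blast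
qed

lemma orbit_flip: "(p, q) \<in> orbit n u v \<longleftrightarrow> (q, p) \<in> orbit n v u"
proof -
  have "(orbit_step ^^ n) (map prod.swap P) = map prod.swap ((orbit_step ^^ n) P)" for P
    by (induction n) (simp_all add: orbit_step_def comp_def)
  from this[of "[(u, v)]"] have "orbit n v u = prod.swap ` orbit n u v" by (simp add: orbit_def)
  then show ?thesis by force
qed

abbreviation len_at :: "bool list \<Rightarrow> bool \<Rightarrow> word \<Rightarrow> nat" where
  "len_at m i w \<equiv> clen (mapp m (if i then iota w else w))"

text \<open>By Nielsen reduction the length function of each automorphism is
  \<open>len_at m i\<close> for some \<open>m\<close> and \<open>i\<close>, so this bound covers all
  of them.\<close>

lemma length_bounds_if_criterion:
  assumes "criterion u v" "clen v > 0"
  shows "\<exists>C. \<forall>m i. int (len_at m i u) \<le> C * int (len_at m i v)"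
proof -
  have "elliptic_le (if i then iota v else v) (if i then iota u else u)" for i
    by (rule elliptic_le_if_criterion[where N = "clen u + clen v"]) (use assms(1) in \<open>auto simp: criterion_iff\<close>)
  then have "length_bounded (if i then iota u else u) (if i then iota v else v)" for i
    by (rule length_bounded_if_elliptic_le) (use assms(2) in simp)
  then obtain C where C: "\<And>i m. int (len_at m i u) \<le> C i * int (len_at m i v)"
    unfolding length_bounded_def by metis
  have "int (len_at m i u) \<le> (\<bar>C True\<bar> + \<bar>C False\<bar>) * int (len_at m i v)" for m i
  proof -
    have "C i \<le> \<bar>C True\<bar> + \<bar>C False\<bar>" by (cases i) auto
    then have "C i * int (len_at m i v) \<le> (\<bar>C True\<bar> + \<bar>C False\<bar>) * int (len_at m i v)"
      by (intro mult_right_mono) auto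
    then show ?thesis using C[of m i] by linarith
  qed
  then show ?thesis by blast
qed

lemma criterion_sym: assumes "criterion u v" shows "criterion v u"
proof -
  have "elliptic p = elliptic q" if "(p, q) \<in> orbit (3 * (clen v + clen u) + 2) v u" for p q
  proof -
    have "(q, p) \<in> orbit (3 * (clen u + clen v) + 2) u v"
      using that orbit_flip[of p q _ v u] by (simp add: add.commute)
    then show ?thesis using assms unfolding criterion_iff by fastforce
  qed
  then show ?thesis unfolding criterion_iff by blast
qed

theorem bdd_trans_equiv_iff_criterion:
  assumes u: "reduce u \<noteq> []" and v: "reduce v \<noteq> []"
  shows "bdd_trans_equiv (reduce u) (reduce v) \<longleftrightarrow> criterion u v"
proof
  assume "bdd_trans_equiv (reduce u) (reduce v)"
  then obtain C where C: "C > 0"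
    "\<And>\<phi>. \<phi> \<in> auto F2 \<Longrightarrow> 1 / C \<le> real (cyc_length (\<phi> (reduce u))) / real (cyc_length (\<phi> (reduce v))) \<and>
       real (cyc_length (\<phi> (reduce u))) / real (cyc_length (\<phi> (reduce v))) \<le> C"
    unfolding bdd_trans_equiv_def by blast
  \<comment> \<open>Positive denominators allow the bounds on the quotient to be multiplied
    out.\<close>
  have pos: "clen (F w) > 0" if F: "realised F" and w: "reduce w \<noteq> []" for F w
  proof -
    obtain \<phi> where "\<phi> \<in> auto F2" "\<And>w. \<phi> (reduce w) = reduce (F w)" using F unfolding realised_def by blast
    then obtain m i where "clen (F w) = len_at m i w"
      using auto_positive_length[of \<phi>] by (auto simp: clen_def)
    then show ?thesis using clen_pos[OF w] by (auto split: if_splits)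
  qed
  have both: "real (clen (F u)) \<le> C * real (clen (F v)) \<and> real (clen (F v)) \<le> C * real (clen (F u))" if F: "realised F" for F
  proof -
    obtain \<phi> where \<phi>: "\<phi> \<in> auto F2" "\<And>w. \<phi> (reduce w) = reduce (F w)" using F unfolding realised_def by blast
    have "1 / C \<le> real (clen (F u)) / real (clen (F v))" "real (clen (F u)) / real (clen (F v)) \<le> C"
      using C(2)[OF \<phi>(1)] by (simp_all add: \<phi>(2) clen_def)
    then show ?thesis using C(1) pos[OF F v] by (simp add: field_simps)
  qed
  show "criterion u v"
    unfolding criterion_iff
  proof safe
    fix p q assume "(p, q) \<in> orbit (3 * (clen u + clen v) + 2) u v"
    then obtain F where F: "realised F" "p = F u" "q = F v" using orbit_realised by blast
    show "elliptic q" if "elliptic p"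
      using elliptic_if_ratio_bounded[of v C u F] both F that by blast
    show "elliptic p" if "elliptic q"
      using elliptic_if_ratio_bounded[of u C v F] both F that by blast
  qed
next
  assume cr: "criterion u v"
  obtain C where C: "\<And>m i. int (len_at m i u) \<le> C * int (len_at m i v)"
    using length_bounds_if_criterion[OF cr clen_pos[OF v]] by blast
  obtain D where D: "\<And>m i. int (len_at m i v) \<le> D * int (len_at m i u)"
    using length_bounds_if_criterion[OF criterion_sym[OF cr] clen_pos[OF u]] by blast
  define E :: real where "E = real_of_int (\<bar>C\<bar> + \<bar>D\<bar> + 1)"
  have E: "E > 0" "real_of_int C \<le> E" "real_of_int D \<le> E" by (auto simp: E_def)
  show "bdd_trans_equiv (reduce u) (reduce v)"
    unfolding bdd_trans_equiv_def
  proof (intro exI[of _ E] conjI ballI)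
    fix \<phi> assume "\<phi> \<in> auto F2"
    then obtain m i where mi: "\<And>w. cyc_length (\<phi> (reduce w)) = len_at m i w"
      using auto_positive_length by blast
    define x y where "x = len_at m i u" and "y = len_at m i v"
    have pos: "x > 0" "y > 0"
      using clen_pos[OF u] clen_pos[OF v] by (auto simp: x_def y_def split: if_splits)
    have "real_of_int (int x) \<le> real_of_int (C * int y)" unfolding of_int_le_iff x_def y_def by (rule C)
    also have "\<dots> \<le> E * real y" using E(2) by (simp add: mult_right_mono)
    finally have xy: "real x \<le> E * real y" by simp
    have "real_of_int (int y) \<le> real_of_int (D * int x)" unfolding of_int_le_iff x_def y_def by (rule D)
    also have "\<dots> \<le> E * real x" using E(3) by (simp add: mult_right_mono)
    finally have yx: "real y \<le> E * real x" by simp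
    show "1 / E \<le> real (cyc_length (\<phi> (reduce u))) / real (cyc_length (\<phi> (reduce v)))"
      using yx pos E(1) unfolding mi x_def[symmetric] y_def[symmetric] by (simp add: field_simps)
    show "real (cyc_length (\<phi> (reduce u))) / real (cyc_length (\<phi> (reduce v))) \<le> E"
      using xy pos E(1) unfolding mi x_def[symmetric] y_def[symmetric] by (simp add: field_simps)
  qed (rule E(1))
qed

section \<open>The decision procedure on codes\<close>

abbreviation encode_word :: "word \<Rightarrow> nat list" where
  "encode_word \<equiv> map letter_code"

text \<open>The algorithm works directly on letter codes, because its inputs are codes of lists of
  these. Numbers above 3 are not letter codes, and their image is arbitrary.\<close>

definition ninv :: "nat \<Rightarrow> nat" where
  "ninv x = (if x = 0 then 1 else if x = 1 then 0 else if x = 2 then 3 else 2)"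

definition nred_cons :: "nat \<Rightarrow> nat list \<Rightarrow> nat list" where
  "nred_cons x w = (case w of [] \<Rightarrow> [x] | y # ys \<Rightarrow> if y = ninv x then ys else x # w)"

definition nreduce :: "nat list \<Rightarrow> nat list" where
  "nreduce w = foldr nred_cons w []"

definition nclen :: "nat list \<Rightarrow> nat" where
  "nclen w = length (nreduce (w @ w)) - length (nreduce w)"

definition nsig :: "nat list \<Rightarrow> nat list" where
  "nsig w = concat (map (\<lambda>x. if x = 0 then [0, 2] else if x = 1 then [3, 1] else [x]) w)"

definition nswap :: "nat list \<Rightarrow> nat list" where
  "nswap w = map (\<lambda>x. if x = 0 then 2 else if x = 1 then 3 else if x = 2 then 0 else 1) w"

definition niota :: "nat list \<Rightarrow> nat list" where
  "niota w = map (\<lambda>x. if x = 2 then 3 else if x = 3 then 2 else x) w"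

text \<open>The test of \<open>elliptic_test\<close>; the multiple of 3 is written as a sum so that
  only addition has to be shown computable.\<close>

definition nelliptic :: "nat list \<Rightarrow> bool" where
  "nelliptic w \<longleftrightarrow> nclen ((nsig ^^ Suc (nclen w + nclen w + nclen w)) w) \<le> nclen w"

definition norbit_step :: "(nat list \<times> nat list) list \<Rightarrow> (nat list \<times> nat list) list" where
  "norbit_step P = P @ map (\<lambda>p. (nsig (fst p), nsig (snd p))) P @
     map (\<lambda>p. (nswap (fst p), nswap (snd p))) P @ map (\<lambda>p. (niota (fst p), niota (snd p))) P"

definition ncriterion :: "nat list \<Rightarrow> nat list \<Rightarrow> bool" where
  "ncriterion u v \<longleftrightarrow> list_all (\<lambda>p. nelliptic (fst p) = nelliptic (snd p))
     ((norbit_step ^^ (((nclen u + nclen v) + (nclen u + nclen v) + (nclen u + nclen v)) + 2)) [(u, v)])"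

lemma letter_code_simps: "letter_code (x, s) = (if x = Gen_a then if s then 0 else 1 else if s then 2 else 3)"
  by (cases x; cases s) auto

lemma letter_code_eq_iff [simp]: "letter_code l = letter_code k \<longleftrightarrow> l = k"
  by (cases l; cases k; cases "fst l"; cases "fst k") (auto simp: letter_code_simps split: if_splits)

lemma letter_code_inv: "letter_code (letter_inv l) = ninv (letter_code l)"
  by (cases l) (simp add: letter_code_simps ninv_def)

lemma encode_red_cons: "encode_word (red_cons x w) = nred_cons (letter_code x) (encode_word w)"
  by (cases w) (auto simp: nred_cons_def simp flip: letter_code_inv)

lemma encode_reduce: "encode_word (reduce w) = nreduce (encode_word w)"
  unfolding reduce_def nreduce_def by (induction w) (simp_all add: encode_red_cons)

lemma nclen_encode: "nclen (encode_word w) = clen w"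
  unfolding nclen_def clen_square by (metis encode_reduce length_map map_append)

lemma encode_sig: "encode_word (sig w) = nsig (encode_word w)"
proof (induction w)
  case (Cons l w)
  obtain x p where l: "l = (x, p)" by (cases l)
  show ?case using Cons unfolding l by (cases x; cases p) (auto simp: sig_def nsig_def)
qed (simp add: sig_def nsig_def)

lemma encode_swap: "encode_word (swap w) = nswap (encode_word w)"
  unfolding swap_def nswap_def
  by (auto simp: letter_code_simps flip_basis_def split: basis.splits if_splits)

lemma encode_iota: "encode_word (iota w) = niota (encode_word w)"
  unfolding iota_def niota_def by (auto simp: letter_code_simps split: if_splits) (use basis.exhaust in blast)+

lemma nelliptic_encode: "nelliptic (encode_word w) = elliptic w"
proof -
  have "(nsig ^^ n) (encode_word w) = encode_word ((sig ^^ n) w)" for n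
    by (induction n) (simp_all add: encode_sig)
  moreover have "clen w + clen w + clen w = 3 * clen w" by simp
  ultimately show ?thesis
    unfolding nelliptic_def elliptic_test nclen_encode by (simp only: nclen_encode)
qed

lemma ncriterion_encode: "ncriterion (encode_word u) (encode_word v) = criterion u v"
proof -
  let ?e = "\<lambda>p. (encode_word (fst p), encode_word (snd p))"
  have "norbit_step (map ?e P) = map ?e (orbit_step P)" for P
    by (simp add: norbit_step_def orbit_step_def encode_sig encode_swap encode_iota comp_def)
  then have "(norbit_step ^^ n) (map ?e P) = map ?e ((orbit_step ^^ n) P)" for n P
    by (induction n) simp_all
  from this[of _ "[(u, v)]"]
  have "(norbit_step ^^ n) [(encode_word u, encode_word v)] = map ?e ((orbit_step ^^ n) [(u, v)])" for n
    by simp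
  moreover have "(clen u + clen v) + (clen u + clen v) + (clen u + clen v) = 3 * (clen u + clen v)" by simp
  ultimately show ?thesis
    unfolding ncriterion_def criterion_def nclen_encode
    by (simp only: list.pred_map comp_def nelliptic_encode fst_conv snd_conv)
qed

lemmas cpt_intros = cpt_id cpt_const cpt_fst cpt_snd cpt_Pair cpt_if cpt_eq cpt_Cons cpt_append
  cpt_length cpt_add cpt_diff cpt_Suc

lemma cpt_ninv: "cpt ninv"
  unfolding ninv_def by (intro cpt_intros)

lemma cpt_nreduce: "cpt nreduce"
proof -
  have "cpt (\<lambda>p. nred_cons (fst p) (snd p))"
    unfolding nred_cons_def by (intro cpt_case_list cpt_intros cpt_comp[OF cpt_ninv])
  then show ?thesis unfolding nreduce_def by (intro cpt_foldr cpt_intros)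
qed

lemma cpt_nclen: "cpt nclen"
  unfolding nclen_def by (intro cpt_intros cpt_comp[OF cpt_nreduce])

lemma cpt_nsig: "cpt nsig"
  unfolding nsig_def by (intro cpt_concat_map cpt_intros)

lemma cpt_nswap: "cpt nswap"
  unfolding nswap_def by (intro cpt_map cpt_intros)

lemma cpt_niota: "cpt niota"
  unfolding niota_def by (intro cpt_map cpt_intros)

lemma cpt_nelliptic: "cpt nelliptic"
  unfolding nelliptic_def by (intro cpt_le cpt_comp[OF cpt_nclen] cpt_funpow cpt_nsig cpt_intros)

lemma cpt_norbit_step: "cpt norbit_step"
  unfolding norbit_step_def
  by (intro cpt_append cpt_map cpt_Pair cpt_comp[OF cpt_nsig] cpt_comp[OF cpt_nswap] cpt_comp[OF cpt_niota]
      cpt_fst cpt_snd cpt_id)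

lemma cpt_ncriterion: "cpt (\<lambda>p. ncriterion (fst p) (snd p))"
  unfolding ncriterion_def
  by (intro cpt_list_all cpt_eq_bool cpt_comp[OF cpt_nelliptic] cpt_funpow cpt_norbit_step
      cpt_comp[OF cpt_nclen] cpt_intros)

theorem mainTheorem5:
  shows "\<exists>alg :: recf. \<forall>u v :: word.
    reduce u \<noteq> \<one>\<^bsub>F2\<^esub> \<longrightarrow> reduce v \<noteq> \<one>\<^bsub>F2\<^esub> \<longrightarrow>
    rec_eval alg [word_code u, word_code v]
      (if bdd_trans_equiv (reduce u) (reduce v) then 1 else 0)"
proof -
  obtain alg where alg: "\<And>u v. rec_eval alg [list_encode u, list_encode v] (if ncriterion u v then 1 else 0)"
    using cpt_imp_recf2[OF cpt_ncriterion] by blast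
  show ?thesis
  proof (intro exI[of _ alg] allI impI)
    fix u v assume "reduce u \<noteq> \<one>\<^bsub>F2\<^esub>" "reduce v \<noteq> \<one>\<^bsub>F2\<^esub>"
    then have "bdd_trans_equiv (reduce u) (reduce v) = criterion u v"
      by (intro bdd_trans_equiv_iff_criterion) (simp_all add: F2_def)
    then show "rec_eval alg [word_code u, word_code v] (if bdd_trans_equiv (reduce u) (reduce v) then 1 else 0)"
      using alg[of "encode_word u" "encode_word v"] by (simp add: word_code_def ncriterion_encode)
  qed
qed

end
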